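(* Let $(M,g)$ be a smooth, connected, compact Riemannian manifold with $\mathcal{C}^1$ boundary $\partial M$, and let $f\in L^2(M)$. Let $C>0$ be the Poincaré constant on $M$, i.e. a constant such that $\|u\|_{L^2(M)}\le C\|u\|_E$ for all $u\in H^1_\perp(M)$. Assume that $F:\mathbb{C}\to\mathbb{C}$ is a globally Lipschitz function with Lipschitz constant $C_1$ such that $C_1C^2<1$. Then the Neumann problem $$-\Delta_g u+F(u)=f \ \text{ in } M,\qquad g(\nabla u,N)\equiv 0\ \text{ on }\partial M,$$ has a weak solution $u\in H_\perp^1(M)$.
   Context: All functions are complex-valued; $d\mu$ is the Riemannian volume form and $N$ is the outward unit normal vector field along $\partial M$. $\langle f,h\rangle_{L^2}=\int_M f\bar h\,d\mu$ and $\langle f,h\rangle_E=\int_M g(\nabla f,\nabla\bar h)\,d\mu$, with $\|u\|_E=\langle u,u\rangle_E^{1/2}$. $\mathcal{C}^\perp=\{u\in\mathcal{C}^\infty(M):\int_M u\,d\mu=0\}$, and $H_\perp^1(M)$ is the completion of $\mathcal{C}^\perp$ with respect to $\langle\cdot,\cdot\rangle_{L^2}+\langle\cdot,\cdot\rangle_E$. $-\Delta_g$ is the Laplace-Beltrami operator with the sign convention that it is nonnegative. A weak solution of the Neumann problem is $u\in H_\perp^1(M)$ such that $\langle v,u\rangle_E+\langle v,F(u)\rangle_{L^2}=\langle v,f\rangle_{L^2}$ for all $v\in H_\perp^1(M)$ (test functions range over $H^1_\perp(M)$ only). *)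

theory Defs
  imports "HOL-Analysis.Analysis"
begin

section \<open>Smooth functions on pieces of \<open>C\<^sup>1\<close> domains\<close>

primrec k_times_diff ::
  "nat \<Rightarrow> (real^'n) set \<Rightarrow> (real^'n \<Rightarrow> 'b::real_normed_vector) \<Rightarrow> bool" where
  "k_times_diff 0 W f \<longleftrightarrow> continuous_on W f"
| "k_times_diff (Suc k) W f \<longleftrightarrow>
     (\<exists>D. (\<forall>x\<in>W. (f has_derivative (\<lambda>h. \<Sum>i\<in>UNIV. (h $ i) *\<^sub>R D i x)) (at x)) \<and>
          (\<forall>i. k_times_diff k W (D i)))"

text \<open>On a set that need not be open, smooth means: locally the restriction of a smooth function
  on an open set. In particular all derivatives extend continuously up to the boundary.\<close>

definition smooth_on :: "(real^'n) set \<Rightarrow> (real^'n \<Rightarrow> 'b::real_normed_vector) \<Rightarrow> bool" where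
  "smooth_on S f \<longleftrightarrow>
     (\<forall>x\<in>S. \<exists>W F. open W \<and> x \<in> W \<and> (\<forall>k. k_times_diff k W F) \<and> (\<forall>y\<in>S \<inter> W. F y = f y))"

text \<open>\<open>V\<close> is a relatively open piece of a closed domain with \<open>C\<^sup>1\<close> boundary: near each of its points
  it is either all of \<open>\<real>\<^sup>n\<close>, or the superlevel set \<open>{\<rho> \<ge> 0}\<close> of a \<open>C\<^sup>1\<close> function with gradient
  \<open>\<rho>' \<noteq> 0\<close> at the point, which then lies on \<open>{\<rho> = 0}\<close>.\<close>

definition C1_domain :: "(real^'n) set \<Rightarrow> bool" where
  "C1_domain V \<longleftrightarrow>
     (\<forall>x\<in>V. \<exists>W. open W \<and> x \<in> W \<and>
        (W \<subseteq> V \<or>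
         (\<exists>\<rho> \<rho>'. (\<forall>y\<in>W. (\<rho> has_derivative (\<lambda>h. \<rho>' y \<bullet> h)) (at y)) \<and> continuous_on W \<rho>' \<and>
                 \<rho> x = (0::real) \<and> \<rho>' x \<noteq> 0 \<and> V \<inter> W = {y \<in> W. 0 \<le> \<rho> y})))"


section \<open>Riemannian manifolds with \<open>C\<^sup>1\<close> boundary\<close>

text \<open>A chart is a pair of its domain and the coordinate map. Charts take values in relatively open
  pieces of \<open>C\<^sup>1\<close> domains and their transition maps are smooth, so the manifold is smooth while its
  boundary (possibly empty) is only \<open>C\<^sup>1\<close>; a half-space model with smooth transition maps would
  force the boundary to be smooth.\<close>

type_synonym ('a, 'n) chart = "'a set \<times> ('a \<Rightarrow> real^'n)"

definition chart_image :: "('a, 'n) chart \<Rightarrow> (real^'n) set" where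
  "chart_image c = snd c ` fst c"

definition chart_inv :: "('a, 'n) chart \<Rightarrow> real^'n \<Rightarrow> 'a" where
  "chart_inv c = inv_into (fst c) (snd c)"

definition transition :: "('a, 'n) chart \<Rightarrow> ('a, 'n) chart \<Rightarrow> real^'n \<Rightarrow> real^'n" where
  "transition c d = snd d \<circ> chart_inv c"

definition is_chart :: "'a::topological_space set \<Rightarrow> ('a, 'n::finite) chart \<Rightarrow> bool" where
  "is_chart M c \<longleftrightarrow>
     openin (top_of_set M) (fst c) \<and>
     homeomorphism (fst c) (chart_image c) (snd c) (chart_inv c) \<and>
     C1_domain (chart_image c)"

definition smooth_atlas :: "'a::topological_space set \<Rightarrow> ('a, 'n::finite) chart set \<Rightarrow> bool" where
  "smooth_atlas M \<A> \<longleftrightarrow>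
     (\<forall>c\<in>\<A>. is_chart M c) \<and> (\<Union>c\<in>\<A>. fst c) = M \<and>
     (\<forall>c\<in>\<A>. \<forall>d\<in>\<A>. smooth_on (snd c ` (fst c \<inter> fst d)) (transition c d))"

definition jacobian :: "('a, 'n) chart \<Rightarrow> ('a, 'n) chart \<Rightarrow> 'a \<Rightarrow> real^'n::finite^'n" where
  "jacobian c d p =
     matrix (frechet_derivative (transition c d) (at (snd c p) within snd c ` (fst c \<inter> fst d)))"

text \<open>A Riemannian metric is given by its components: \<open>g c p\<close> is the matrix \<open>(g\<^sub>i\<^sub>j)\<close> at \<open>p\<close> in the
  chart \<open>c\<close>.\<close>

type_synonym ('a, 'n) metric_tensor = "('a, 'n) chart \<Rightarrow> 'a \<Rightarrow> real^'n^'n"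

definition riemannian_metric ::
  "('a, 'n::finite) chart set \<Rightarrow> ('a, 'n) metric_tensor \<Rightarrow> bool" where
  "riemannian_metric \<A> g \<longleftrightarrow>
     (\<forall>c\<in>\<A>. smooth_on (chart_image c) (g c \<circ> chart_inv c)) \<and>
     (\<forall>c\<in>\<A>. \<forall>p\<in>fst c. transpose (g c p) = g c p \<and> (\<forall>v. v \<noteq> 0 \<longrightarrow> 0 < v \<bullet> (g c p *v v))) \<and>
     (\<forall>c\<in>\<A>. \<forall>d\<in>\<A>. \<forall>p\<in>fst c \<inter> fst d.
        g c p = transpose (jacobian c d p) ** g d p ** jacobian c d p)"

definition riemannian_manifold ::
  "'a::topological_space set \<Rightarrow> ('a, 'n::finite) chart set \<Rightarrow> ('a, 'n) metric_tensor \<Rightarrow> bool" where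
  "riemannian_manifold M \<A> g \<longleftrightarrow> smooth_atlas M \<A> \<and> riemannian_metric \<A> g"

definition is_volume_measure ::
  "'a::topological_space set \<Rightarrow> ('a, 'n::finite) chart set \<Rightarrow> ('a, 'n) metric_tensor \<Rightarrow>
   'a measure \<Rightarrow> bool" where
  "is_volume_measure M \<A> g \<mu> \<longleftrightarrow>
     sets \<mu> = sets (restrict_space borel M) \<and>
     (\<forall>c\<in>\<A>. \<forall>A\<in>sets \<mu>. A \<subseteq> fst c \<longrightarrow>
        emeasure \<mu> A =
          (\<integral>\<^sup>+x\<in>snd c ` A. ennreal (sqrt (det (g c (chart_inv c x)))) \<partial>lborel))"

text \<open>On a compact manifold there is exactly one such measure: by the change of variables formula
  the local expressions agree on overlaps, and finitely many charts cover \<open>M\<close>.\<close>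

definition vol ::
  "'a::topological_space set \<Rightarrow> ('a, 'n::finite) chart set \<Rightarrow> ('a, 'n) metric_tensor \<Rightarrow>
   'a measure" where
  "vol M \<A> g = (THE \<mu>. is_volume_measure M \<A> g \<mu>)"


section \<open>Gradients and the two sesquilinear forms\<close>

definition smooth_functions ::
  "('a, 'n::finite) chart set \<Rightarrow> ('a \<Rightarrow> complex) set" where
  "smooth_functions \<A> = {u. \<forall>c\<in>\<A>. smooth_on (chart_image c) (u \<circ> chart_inv c)}"

definition partial_deriv ::
  "('a, 'n::finite) chart \<Rightarrow> ('a \<Rightarrow> complex) \<Rightarrow> 'a \<Rightarrow> 'n \<Rightarrow> complex" where
  "partial_deriv c u p i =
     frechet_derivative (u \<circ> chart_inv c) (at (snd c p) within chart_image c) (axis i 1)"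

text \<open>The gradient of a complex-valued function is a section of the complexified tangent bundle,
  \<open>(\<nabla>u)\<^sup>i = \<Sum>\<^sub>j g\<^sup>i\<^sup>j \<partial>\<^sub>j u\<close>, and \<open>g\<close> is extended to it complex bilinearly.\<close>

definition gradient ::
  "('a, 'n::finite) metric_tensor \<Rightarrow> ('a, 'n) chart \<Rightarrow> ('a \<Rightarrow> complex) \<Rightarrow> 'a \<Rightarrow> complex^'n" where
  "gradient g c u p =
     (\<chi> i. \<Sum>j\<in>UNIV. complex_of_real (matrix_inv (g c p) $ i $ j) * partial_deriv c u p j)"

definition metric_apply ::
  "('a, 'n::finite) metric_tensor \<Rightarrow> ('a, 'n) chart \<Rightarrow> 'a \<Rightarrow> complex^'n \<Rightarrow> complex^'n \<Rightarrow> complex" where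
  "metric_apply g c p X Y = (\<Sum>i\<in>UNIV. \<Sum>j\<in>UNIV. complex_of_real (g c p $ i $ j) * X $ i * Y $ j)"

text \<open>The function \<open>g(\<nabla>u, \<nabla>v)\<close>. Its value does not depend on the chart around \<open>p\<close>.\<close>

definition gradient_product ::
  "('a, 'n::finite) chart set \<Rightarrow> ('a, 'n) metric_tensor \<Rightarrow> ('a \<Rightarrow> complex) \<Rightarrow> ('a \<Rightarrow> complex) \<Rightarrow>
   'a \<Rightarrow> complex" where
  "gradient_product \<A> g u v p =
     (let c = (SOME c. c \<in> \<A> \<and> p \<in> fst c) in metric_apply g c p (gradient g c u p) (gradient g c v p))"

definition energy_product ::
  "'a::topological_space set \<Rightarrow> ('a, 'n::finite) chart set \<Rightarrow> ('a, 'n) metric_tensor \<Rightarrow>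
   ('a \<Rightarrow> complex) \<Rightarrow> ('a \<Rightarrow> complex) \<Rightarrow> complex" where
  "energy_product M \<A> g f h = (LINT p|vol M \<A> g. gradient_product \<A> g f (\<lambda>x. cnj (h x)) p)"

definition square_integrable :: "'a measure \<Rightarrow> ('a \<Rightarrow> complex) \<Rightarrow> bool" where
  "square_integrable \<mu> f \<longleftrightarrow> f \<in> borel_measurable \<mu> \<and> integrable \<mu> (\<lambda>x. (cmod (f x))\<^sup>2)"

definition L2_product :: "'a measure \<Rightarrow> ('a \<Rightarrow> complex) \<Rightarrow> ('a \<Rightarrow> complex) \<Rightarrow> complex" where
  "L2_product \<mu> f h = (LINT x|\<mu>. f x * cnj (h x))"

definition L2_norm :: "'a measure \<Rightarrow> ('a \<Rightarrow> complex) \<Rightarrow> real" where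
  "L2_norm \<mu> f = sqrt (Re (L2_product \<mu> f f))"


section \<open>The Sobolev space of mean-zero functions\<close>

definition cauchy_seqs :: "'v set \<Rightarrow> ('v \<Rightarrow> 'v \<Rightarrow> real) \<Rightarrow> (nat \<Rightarrow> 'v) set" where
  "cauchy_seqs V d =
     {s. (\<forall>n. s n \<in> V) \<and> (\<forall>e>0. \<exists>N. \<forall>m\<ge>N. \<forall>n\<ge>N. d (s m) (s n) < e)}"

definition cauchy_completion :: "'v set \<Rightarrow> ('v \<Rightarrow> 'v \<Rightarrow> real) \<Rightarrow> (nat \<Rightarrow> 'v) set set" where
  "cauchy_completion V d =
     cauchy_seqs V d //
       {(s, t). s \<in> cauchy_seqs V d \<and> t \<in> cauchy_seqs V d \<and> (\<lambda>n. d (s n) (t n)) \<longlonglongrightarrow> 0}"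

definition mean_zero_smooth ::
  "'a::topological_space set \<Rightarrow> ('a, 'n::finite) chart set \<Rightarrow> ('a, 'n) metric_tensor \<Rightarrow>
   ('a \<Rightarrow> complex) set" where
  "mean_zero_smooth M \<A> g = {u \<in> smooth_functions \<A>. (LINT p|vol M \<A> g. u p) = 0}"

definition H1_dist ::
  "'a::topological_space set \<Rightarrow> ('a, 'n::finite) chart set \<Rightarrow> ('a, 'n) metric_tensor \<Rightarrow>
   ('a \<Rightarrow> complex) \<Rightarrow> ('a \<Rightarrow> complex) \<Rightarrow> real" where
  "H1_dist M \<A> g u v =
     (let w = (\<lambda>x. u x - v x) in
      sqrt (Re (L2_product (vol M \<A> g) w w + energy_product M \<A> g w w)))"

text \<open>Functions on \<open>M\<close> are represented by functions on the whole type, so \<open>H1_dist\<close> is only a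
  pseudometric; passing to equivalence classes of Cauchy sequences identifies functions that agree
  on \<open>M\<close>.\<close>

definition H1_perp ::
  "'a::topological_space set \<Rightarrow> ('a, 'n::finite) chart set \<Rightarrow> ('a, 'n) metric_tensor \<Rightarrow>
   (nat \<Rightarrow> 'a \<Rightarrow> complex) set set" where
  "H1_perp M \<A> g = cauchy_completion (mean_zero_smooth M \<A> g) (H1_dist M \<A> g)"

text \<open>The continuous extension of \<open>\<langle>\<cdot>,\<cdot>\<rangle>\<^sub>E\<close> to the completion.\<close>

definition H1_energy ::
  "'a::topological_space set \<Rightarrow> ('a, 'n::finite) chart set \<Rightarrow> ('a, 'n) metric_tensor \<Rightarrow>
   (nat \<Rightarrow> 'a \<Rightarrow> complex) set \<Rightarrow> (nat \<Rightarrow> 'a \<Rightarrow> complex) set \<Rightarrow> complex" where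
  "H1_energy M \<A> g u v =
     lim (\<lambda>n. energy_product M \<A> g ((SOME s. s \<in> u) n) ((SOME t. t \<in> v) n))"

definition H1_energy_norm ::
  "'a::topological_space set \<Rightarrow> ('a, 'n::finite) chart set \<Rightarrow> ('a, 'n) metric_tensor \<Rightarrow>
   (nat \<Rightarrow> 'a \<Rightarrow> complex) set \<Rightarrow> real" where
  "H1_energy_norm M \<A> g u = sqrt (Re (H1_energy M \<A> g u u))"

text \<open>The function in \<open>L\<^sup>2(M)\<close>, unique up to null sets, that an element of the completion
  represents: the \<open>L\<^sup>2\<close> limit of its Cauchy sequences.\<close>

definition H1_fun ::
  "'a::topological_space set \<Rightarrow> ('a, 'n::finite) chart set \<Rightarrow> ('a, 'n) metric_tensor \<Rightarrow>
   (nat \<Rightarrow> 'a \<Rightarrow> complex) set \<Rightarrow> 'a \<Rightarrow> complex" where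
  "H1_fun M \<A> g u =
     (SOME w. square_integrable (vol M \<A> g) w \<and>
        (\<forall>s\<in>u. (\<lambda>n. L2_norm (vol M \<A> g) (\<lambda>x. s n x - w x)) \<longlonglongrightarrow> 0))"

text \<open>Weak form of \<open>-\<Delta>\<^sub>g u + F(u) = f\<close> in \<open>M\<close>, \<open>g(\<nabla>u, N) = 0\<close> on \<open>\<partial>M\<close>. The boundary condition is
  the natural one: it is encoded by test functions that are unrestricted on \<open>\<partial>M\<close>.\<close>

definition weak_neumann_solution ::
  "'a::topological_space set \<Rightarrow> ('a, 'n::finite) chart set \<Rightarrow> ('a, 'n) metric_tensor \<Rightarrow>
   (complex \<Rightarrow> complex) \<Rightarrow> ('a \<Rightarrow> complex) \<Rightarrow> (nat \<Rightarrow> 'a \<Rightarrow> complex) set \<Rightarrow> bool" where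
  "weak_neumann_solution M \<A> g F f u \<longleftrightarrow>
     u \<in> H1_perp M \<A> g \<and>
     (\<forall>v\<in>H1_perp M \<A> g.
        H1_energy M \<A> g v u
          + L2_product (vol M \<A> g) (H1_fun M \<A> g v) (\<lambda>x. F (H1_fun M \<A> g u x))
        = L2_product (vol M \<A> g) (H1_fun M \<A> g v) f)"

end

(* The energy form is an inner product on the smooth mean-zero functions, and by the Poincare
   inequality it dominates the L^2 norm. For fixed w in L^2, the Riesz representation of the functional
   v |-> <v, f - F(w)> in the completion solves the linear problem -Delta u = f - F(w); since the
   difference of two such solutions is bounded in energy by C ||F(w) - F(w')||, passing from w to the
   L^2 function of u is a contraction of L^2 with factor C_1 C^2, and its fixed point is a weak solution.

   For this to apply to the integrals over M, the volume measure has to exist, be unique and be finite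
   (change of variables on chart overlaps and compactness), and the gradient product has to be independent
   of the chart, which at boundary points rests on the uniqueness of derivatives within a C^1 domain. *)

theory Submission
  imports Defs
begin

section \<open>Change of variables for nonnegative functions\<close>

text \<open>The completion consists of equivalence classes of sequences, and its energy and L^2
  functions are limits along representatives picked by \<open>SOME\<close>; it carries no vector
  space structure in which a Riesz theorem could be quoted. The work is therefore done on smooth
  functions: minimising the quadratic functional approximately yields a smooth approximate solution
  for each tolerance 1/(n+1), and the sequence of these represents the solution. The fixed point is
  taken in L^2 because F(u) sees only the L^2 function of u. The factor C^2 is the Poincare
  inequality used twice, once to bound the functional by C ||h|| in energy and once to return from
  energy to L^2. All test functions have mean zero, so the mean of f - F(w) is invisible and no
  compatibility condition arises. Since functions are determined only up to null sets, fixed points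
  and limits are compared through vanishing L^2 norms, and the Lipschitz bound carries such
  comparisons over to F.\<close>

datatype 'a wo = Wo (un_wo: 'a)

lemma bij_un_wo: "bij un_wo"
proof (rule bijI')
  show "\<exists>x. y = un_wo x" for y :: 'a
    by (rule exI[of _ "Wo y"]) simp
qed (auto intro: wo.expand)

instance wo :: (finite) finite
proof
  have "x \<in> range Wo" for x :: "'a wo"
    by (cases x) simp
  then have "(UNIV :: 'a wo set) = range Wo"
    by blast
  moreover have "finite (range (Wo :: 'a \<Rightarrow> 'a wo))"
    by (rule finite_imageI) (rule finite)
  ultimately show "finite (UNIV :: 'a wo set)"
    by metis
qed

text \<open>Any enumeration of the finite type would serve; pulling the order back along
  \<open>to_nat_on\<close> reduces totality and well-foundedness to the natural numbers. The wrapper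
  type keeps this artificial order off the original index type.\<close>

instantiation wo :: (finite) wellorder
begin

definition less_eq_wo :: "'a wo \<Rightarrow> 'a wo \<Rightarrow> bool" where
  "less_eq_wo x y \<longleftrightarrow> to_nat_on UNIV (un_wo x) \<le> to_nat_on UNIV (un_wo y)"
definition less_wo :: "'a wo \<Rightarrow> 'a wo \<Rightarrow> bool" where
  "less_wo x y \<longleftrightarrow> to_nat_on UNIV (un_wo x) < to_nat_on UNIV (un_wo y)"

instance
proof
  fix x y :: "'a wo"
  assume "x \<le> y" "y \<le> x"
  then have "to_nat_on UNIV (un_wo x) = to_nat_on UNIV (un_wo y)"
    by (simp add: less_eq_wo_def)
  then show "x = y"
    using inj_on_to_nat_on[of "UNIV :: 'a set"] by (simp add: inj_eq countable_finite wo.expand)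
next
  fix P :: "'a wo \<Rightarrow> bool" and a
  assume step: "\<And>x. (\<And>y. y < x \<Longrightarrow> P y) \<Longrightarrow> P x"
  show "P a"
  proof (induction a rule: measure_induct_rule[where f = "\<lambda>x. to_nat_on UNIV (un_wo x)"])
    case (less x)
    show ?case
      by (rule step, rule less) (simp add: less_wo_def)
  qed
qed (auto simp: less_eq_wo_def less_wo_def)

end

text \<open>Conjugation by \<open>f\<close> is a sign-preserving bijection between the two symmetric
  groups, so the Leibniz expansions match term by term.\<close>

lemma det_reindex:
  fixes A :: "'a::comm_ring_1^'n^'n" and f :: "'m::finite \<Rightarrow> 'n::finite"
  assumes "bij f"
  shows "det (\<chi> i j. A $ f i $ f j) = det A"
proof -
  have inj: "inj f"
    using assms by (rule bij_is_inj)
  have bb: "bij_betw (map_permutation UNIV f) {p. p permutes UNIV} {p. p permutes UNIV}"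
  proof -
    have "map_permutation UNIV f = (\<lambda>\<pi> x. if x \<in> UNIV then f (\<pi> (inv_into UNIV f x)) else x)"
      using assms by (auto simp: map_permutation_def restrict_id_def fun_eq_iff bij_def)
    then show ?thesis
      using bij_betw_permutations[of f UNIV UNIV] assms by simp
  qed
  have "det A = (\<Sum>p | p permutes (UNIV::'m set).
      of_int (sign (map_permutation UNIV f p)) * (\<Prod>i\<in>UNIV. A $ i $ map_permutation UNIV f p i))"
    unfolding det_def by (rule sum.reindex_bij_betw[OF bb, symmetric])
  also have "\<dots> = (\<Sum>p | p permutes (UNIV::'m set). of_int (sign p) * (\<Prod>i\<in>UNIV. A $ f i $ f (p i)))"
  proof (rule sum.cong, goal_cases)
    case (2 p)
    have "(\<Prod>i\<in>UNIV. A $ i $ map_permutation UNIV f p i) =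
        (\<Prod>i\<in>UNIV. A $ f i $ map_permutation UNIV f p (f i))"
      using prod.reindex_bij_betw[of f UNIV UNIV "\<lambda>i. A $ i $ map_permutation UNIV f p i"] assms
      by simp
    with 2 show ?case
      using sign_map_permutation[OF inj, of p] map_permutation_apply[OF inj, of _ p] by simp
  qed simp
  finally show ?thesis
    by (simp add: det_def)
qed

section \<open>Relabelled coordinates and Lebesgue measure\<close>

definition to_wo :: "real^'n \<Rightarrow> real^('n::finite) wo" where
  "to_wo x = (\<chi> i. x $ un_wo i)"

definition of_wo :: "real^('n::finite) wo \<Rightarrow> real^'n" where
  "of_wo x = (\<chi> i. x $ Wo i)"

lemma of_to_wo [simp]: "of_wo (to_wo x) = x"
  by (simp add: of_wo_def to_wo_def)

lemma to_of_wo [simp]: "to_wo (of_wo x) = x"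
  by (simp add: of_wo_def to_wo_def)

lemma bounded_linear_to_wo: "bounded_linear to_wo"
  unfolding linear_conv_bounded_linear[symmetric]
  by (auto intro!: linearI simp: to_wo_def vec_eq_iff)

lemma bounded_linear_of_wo: "bounded_linear of_wo"
  unfolding linear_conv_bounded_linear[symmetric]
  by (auto intro!: linearI simp: of_wo_def vec_eq_iff)

lemma measurable_to_wo [measurable]: "to_wo \<in> borel_measurable borel"
  by (intro borel_measurable_continuous_onI linear_continuous_on bounded_linear_to_wo)

lemma measurable_of_wo [measurable]: "of_wo \<in> borel_measurable borel"
  by (intro borel_measurable_continuous_onI linear_continuous_on bounded_linear_of_wo)

text \<open>Lebesgue measure is determined by its values on boxes, and relabelling pulls a box back
  to one with the same side lengths in another order.\<close>

lemma lborel_distr_to_wo: "distr lborel borel to_wo = lborel"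
proof (rule lborel_eqI[symmetric])
  fix l u :: "real^('n::finite) wo"
  assume lu: "\<And>b. b \<in> Basis \<Longrightarrow> l \<bullet> b \<le> u \<bullet> b"
  then have le: "l $ i \<le> u $ i" for i
    by (metis axis_in_Basis_iff Basis_real_def cart_eq_inner_axis insertI1)
  have "to_wo -` box l u = box (of_wo l) (of_wo u)"
  proof -
    have all_wo: "(\<forall>i. P i) \<longleftrightarrow> (\<forall>i. P (Wo i))" for P :: "'n wo \<Rightarrow> bool"
      by (metis wo.collapse)
    show ?thesis
      by (auto simp: mem_box_cart to_wo_def of_wo_def all_wo)
  qed
  moreover have "emeasure lborel (box (of_wo l) (of_wo u)) = (\<Prod>b\<in>Basis. (of_wo u - of_wo l) \<bullet> b)"
    using le by (intro emeasure_lborel_box) (auto simp: Basis_vec_def inner_axis of_wo_def)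
  moreover have "(\<Prod>b\<in>Basis. (of_wo u - of_wo l) \<bullet> b) = (\<Prod>b\<in>Basis. (u - l) \<bullet> b)"
  proof -
    have prod_Basis: "(\<Prod>b\<in>Basis. v \<bullet> b) = (\<Prod>i\<in>UNIV. v $ i)" for v :: "real^'m::finite"
    proof -
      have Basis: "(Basis :: (real^'m) set) = (\<lambda>i. axis i 1) ` UNIV"
        by (auto simp: Basis_vec_def)
      have "inj (\<lambda>i::'m. axis i (1::real))"
        by (simp add: inj_on_def axis_eq_axis)
      then show ?thesis
        unfolding Basis by (subst prod.reindex) (simp_all add: inner_axis)
    qed
    have "(\<Prod>i\<in>UNIV. (u - l) $ i) = (\<Prod>i\<in>UNIV. (u - l) $ Wo i)"
    proof (rule prod.reindex_bij_betw[symmetric])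
      show "bij Wo"
        by (rule bijI') (auto intro: wo.collapse[symmetric])
    qed
    then show ?thesis
      unfolding prod_Basis by (simp add: of_wo_def)
  qed
  ultimately show "emeasure (distr lborel borel to_wo) (box l u) = (\<Prod>b\<in>Basis. (u - l) \<bullet> b)"
    by (simp add: emeasure_distr)
qed simp

lemma nn_integral_to_wo:
  assumes "f \<in> borel_measurable borel"
  shows "(\<integral>\<^sup>+x. f (to_wo x) \<partial>lborel) = (\<integral>\<^sup>+x. f x \<partial>lborel)"
  by (subst lborel_distr_to_wo[symmetric]) (simp add: nn_integral_distr assms)

text \<open>Bridge to the change of variables theorem, which speaks of absolutely integrable
  functions for the completed Lebesgue measure: for a nonnegative function this is finiteness of the
  nonnegative integral, and completion leaves that integral unchanged.\<close>

lemma absolutely_integrable_on_nn_integral: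
  fixes f :: "real^'n \<Rightarrow> real"
  assumes [measurable]: "(\<lambda>x. indicator S x * f x) \<in> borel_measurable borel"
    and f: "\<And>x. x \<in> S \<Longrightarrow> 0 \<le> f x"
  shows "f absolutely_integrable_on S \<longleftrightarrow> (\<integral>\<^sup>+x\<in>S. f x \<partial>lborel) < \<infinity>"
    and "f absolutely_integrable_on S \<Longrightarrow> (\<integral>\<^sup>+x\<in>S. f x \<partial>lborel) = ennreal (integral S f)"
proof -
  have [measurable]: "(\<lambda>x. indicator S x * f x) \<in> borel_measurable (completion lborel)"
    by (intro measurable_completion) simp
  have eq: "(\<integral>\<^sup>+x\<in>S. f x \<partial>lborel) = (\<integral>\<^sup>+x. ennreal (indicator S x * f x) \<partial>completion lborel)"
    unfolding nn_integral_completion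
    by (intro nn_integral_cong) (auto simp: indicator_def)
  have "norm (indicator S x * f x) = indicator S x * f x" for x
    using f by (auto simp: indicator_def)
  then show 1: "f absolutely_integrable_on S \<longleftrightarrow> (\<integral>\<^sup>+x\<in>S. f x \<partial>lborel) < \<infinity>"
    unfolding eq set_integrable_def integrable_iff_bounded by simp
  show "(\<integral>\<^sup>+x\<in>S. f x \<partial>lborel) = ennreal (integral S f)" if "f absolutely_integrable_on S"
  proof -
    have "integral S f = integral\<^sup>L (completion lborel) (\<lambda>x. indicator S x * f x)"
      using set_lebesgue_integral_eq_integral(2)[OF that] by (simp add: set_lebesgue_integral_def)
    then show ?thesis
      unfolding eq using that f
      by (subst nn_integral_eq_integral) (auto simp: set_integrable_def indicator_def)
  qed
qed

text \<open>The transformed integrand enters as a separate function \<open>h\<close> tied to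
  \<open>f\<close> by \<open>hf\<close>, so that Borel measurability is assumed of \<open>h\<close>
  and never has to be derived for the Jacobian determinant.\<close>

lemma nn_integral_change_of_variables_wo:
  fixes T :: "real^'n::{finite,wellorder} \<Rightarrow> real^'n::_" and f h :: "real^'n::_ \<Rightarrow> real"
  assumes S: "S \<in> sets borel"
    and T: "\<And>x. x \<in> S \<Longrightarrow> (T has_derivative T' x) (at x within S)" and inj: "inj_on T S"
    and h: "(\<lambda>x. indicator S x * h x) \<in> borel_measurable borel"
    and f: "(\<lambda>x. indicator (T ` S) x * f x) \<in> borel_measurable borel"
    and nn: "\<And>x. x \<in> T ` S \<Longrightarrow> 0 \<le> f x"
    and hf: "\<And>x. x \<in> S \<Longrightarrow> h x = \<bar>det (matrix (T' x))\<bar> * f (T x)"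
  shows "(\<integral>\<^sup>+x\<in>T ` S. f x \<partial>lborel) = (\<integral>\<^sup>+x\<in>S. h x \<partial>lborel)"
proof -
  have SL: "S \<in> sets lebesgue"
    using S by simp
  have cv: "h absolutely_integrable_on S \<and> integral S h = b \<longleftrightarrow>
      f absolutely_integrable_on (T ` S) \<and> integral (T ` S) f = b" for b
  proof -
    \<comment> \<open>The theorem invoked is about functions with values in a coordinate space, so
      scalars are wrapped as \<open>real^1\<close> and unwrapped again.\<close>
    let ?D = "\<lambda>x. \<bar>det (matrix (T' x))\<bar> *\<^sub>R vec (f (T x)) :: real^1"
    have "?D absolutely_integrable_on S \<and> integral S ?D = vec b \<longleftrightarrow>
      (\<lambda>x. vec (f x) :: real^1) absolutely_integrable_on (T ` S) \<and> integral (T ` S) (\<lambda>x. vec (f x) :: real^1) = vec b"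
      by (rule has_absolute_integral_change_of_variables[OF SL T inj])
    moreover have "?D absolutely_integrable_on S \<longleftrightarrow> h absolutely_integrable_on S"
      unfolding absolutely_integrable_on_1_iff
      by (rule set_integrable_cong) (auto simp: hf)
    moreover have "integral S ?D = vec (integral S h)"
      unfolding integral_on_1_eq
      by (rule arg_cong[of _ _ vec], rule integral_cong) (auto simp: hf)
    moreover have "(\<lambda>x. vec (f x) :: real^1) absolutely_integrable_on (T ` S) \<longleftrightarrow> f absolutely_integrable_on (T ` S)"
      unfolding absolutely_integrable_on_1_iff by simp
    moreover have "integral (T ` S) (\<lambda>x. vec (f x) :: real^1) = vec (integral (T ` S) f)"
      unfolding integral_on_1_eq by simp
    ultimately show ?thesis
      by (simp add: vec_eq_iff)
  qed
  have hnn: "\<And>x. x \<in> S \<Longrightarrow> 0 \<le> h x"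
    using nn hf by simp
  note af = absolutely_integrable_on_nn_integral[OF f nn]
  note ah = absolutely_integrable_on_nn_integral[OF h hnn]
  show ?thesis
  proof (cases "f absolutely_integrable_on (T ` S)")
    case True
    then have "h absolutely_integrable_on S" "integral S h = integral (T ` S) f"
      using cv[of "integral (T ` S) f"] by auto
    with True show ?thesis
      using af(2) ah(2) by simp
  next
    \<comment> \<open>Integrability transfers in both directions by \<open>cv\<close>, so here both
      nonnegative integrals are infinite.\<close>
    case False
    moreover from this have "\<not> h absolutely_integrable_on S"
      using cv by blast
    ultimately show ?thesis
      using af(1) ah(1) by (auto simp: less_top[symmetric])
  qed
qed

text \<open>The library proves the change of variables formula only for well-ordered index types; this
  is its transport along a relabelling of the coordinates.\<close>

lemma nn_integral_change_of_variables:
  fixes T :: "real^'n::finite \<Rightarrow> real^'n" and f h :: "real^'n \<Rightarrow> real"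
  assumes S [measurable]: "S \<in> sets borel"
    and T: "\<And>x. x \<in> S \<Longrightarrow> (T has_derivative T' x) (at x within S)" and inj: "inj_on T S"
    and h [measurable]: "(\<lambda>x. indicator S x * h x) \<in> borel_measurable borel"
    and f [measurable]: "(\<lambda>x. indicator (T ` S) x * f x) \<in> borel_measurable borel"
    and nn: "\<And>x. x \<in> T ` S \<Longrightarrow> 0 \<le> f x"
    and hf: "\<And>x. x \<in> S \<Longrightarrow> h x = \<bar>det (matrix (T' x))\<bar> * f (T x)"
  shows "(\<integral>\<^sup>+x\<in>T ` S. f x \<partial>lborel) = (\<integral>\<^sup>+x\<in>S. h x \<partial>lborel)"
proof -
  define S' where "S' = of_wo -` S"
  define U where "U = to_wo \<circ> T \<circ> of_wo"
  have US: "U ` S' = of_wo -` (T ` S)"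
  proof (intro equalityI subsetI)
    fix y assume "y \<in> of_wo -` (T ` S)"
    then obtain x where x: "x \<in> S" "of_wo y = T x"
      by auto
    then have "y = U (to_wo x)"
      by (metis U_def comp_apply of_to_wo to_of_wo)
    with x show "y \<in> U ` S'"
      by (auto simp: S'_def)
  qed (auto simp: U_def S'_def)
  have of_wo_D: "(of_wo has_derivative of_wo) F" and to_wo_D: "(to_wo has_derivative to_wo) F'" for F F'
    using bounded_linear_of_wo bounded_linear_to_wo by (auto intro: bounded_linear_imp_has_derivative)
  have "(\<integral>\<^sup>+x\<in>T ` S. f x \<partial>lborel) = (\<integral>\<^sup>+x. ennreal (indicator (T ` S) x * f x) \<partial>lborel)"
    by (intro nn_integral_cong) (auto simp: indicator_def)
  also have "\<dots> = (\<integral>\<^sup>+x. ennreal (indicator (T ` S) (of_wo x) * f (of_wo x)) \<partial>lborel)"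
    using nn_integral_to_wo[of "\<lambda>x. ennreal (indicator (T ` S) (of_wo x) * f (of_wo x))"] by simp
  also have "\<dots> = (\<integral>\<^sup>+x\<in>U ` S'. (f \<circ> of_wo) x \<partial>lborel)"
    unfolding US by (intro nn_integral_cong) (auto simp: indicator_def)
  also have "\<dots> = (\<integral>\<^sup>+x\<in>S'. (h \<circ> of_wo) x \<partial>lborel)"
  proof (rule nn_integral_change_of_variables_wo)
    show "S' \<in> sets borel"
      unfolding S'_def using measurable_sets[OF measurable_of_wo S] by simp
    show "(U has_derivative to_wo \<circ> T' (of_wo x) \<circ> of_wo) (at x within S')" if "x \<in> S'" for x
    proof -
      have "(T has_derivative T' (of_wo x)) (at (of_wo x) within of_wo ` S')"
        using that T by (intro has_derivative_subset[OF T]) (auto simp: S'_def)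
      then have "(T \<circ> of_wo has_derivative T' (of_wo x) \<circ> of_wo) (at x within S')"
        by (rule diff_chain_within[OF of_wo_D])
      then show ?thesis
        unfolding U_def comp_assoc by (rule diff_chain_within[OF _ to_wo_D])
    qed
    show "inj_on U S'"
    proof (rule inj_onI)
      fix x y assume *: "x \<in> S'" "y \<in> S'" "U x = U y"
      then have "of_wo (U x) = of_wo (U y)"
        by simp
      then have "of_wo x = of_wo y"
        using inj_onD[OF inj, of "of_wo x" "of_wo y"] * by (simp add: U_def S'_def)
      then show "x = y"
        by (metis to_of_wo)
    qed
    have "(\<lambda>x. indicator S' x * (h \<circ> of_wo) x) = (\<lambda>x. indicator S x * h x) \<circ> of_wo"
      by (auto simp: S'_def indicator_def fun_eq_iff)
    then show "(\<lambda>x. indicator S' x * (h \<circ> of_wo) x) \<in> borel_measurable borel"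
      using measurable_comp[OF measurable_of_wo h] by simp
    have "(\<lambda>x. indicator (U ` S') x * (f \<circ> of_wo) x) = (\<lambda>x. indicator (T ` S) x * f x) \<circ> of_wo"
      unfolding US by (auto simp: indicator_def fun_eq_iff)
    then show "(\<lambda>x. indicator (U ` S') x * (f \<circ> of_wo) x) \<in> borel_measurable borel"
      using measurable_comp[OF measurable_of_wo f] by simp
    show "0 \<le> (f \<circ> of_wo) x" if "x \<in> U ` S'" for x
      using that nn unfolding US by auto
    show "(h \<circ> of_wo) x = \<bar>det (matrix (to_wo \<circ> T' (of_wo x) \<circ> of_wo))\<bar> * (f \<circ> of_wo) (U x)"
      if "x \<in> S'" for x
    proof -
      have ax: "of_wo (axis i 1) = axis (un_wo i) 1" for i :: "'n wo"
        by (auto simp: of_wo_def axis_def vec_eq_iff wo.expand)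
      have "matrix (to_wo \<circ> T' (of_wo x) \<circ> of_wo) =
          (\<chi> i j. matrix (T' (of_wo x)) $ un_wo i $ un_wo j)"
        by (simp add: matrix_def to_wo_def ax)
      then have "det (matrix (to_wo \<circ> T' (of_wo x) \<circ> of_wo)) = det (matrix (T' (of_wo x)))"
        using det_reindex[OF bij_un_wo] by metis
      with hf[of "of_wo x"] that show ?thesis
        by (simp add: S'_def U_def)
    qed
  qed
  also have "\<dots> = (\<integral>\<^sup>+x. ennreal (indicator S (of_wo x) * h (of_wo x)) \<partial>lborel)"
    unfolding S'_def by (intro nn_integral_cong) (auto simp: indicator_def)
  also have "\<dots> = (\<integral>\<^sup>+x. ennreal (indicator S x * h x) \<partial>lborel)"
    using nn_integral_to_wo[of "\<lambda>x. ennreal (indicator S (of_wo x) * h (of_wo x))"] by simp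
  also have "\<dots> = (\<integral>\<^sup>+x\<in>S. h x \<partial>lborel)"
    by (intro nn_integral_cong) (auto simp: indicator_def)
  finally show ?thesis .
qed

section \<open>Smooth functions on pieces of C1 domains\<close>

lemma k_times_diff_subset: "k_times_diff k W f \<Longrightarrow> W' \<subseteq> W \<Longrightarrow> k_times_diff k W' f"
  by (induction k arbitrary: f) (auto intro: continuous_on_subset, blast)

lemma k_times_diff_add:
  "k_times_diff k W f \<Longrightarrow> k_times_diff k W h \<Longrightarrow> k_times_diff k W (\<lambda>x. f x + h x)"
proof (induction k arbitrary: f h)
  case (Suc k)
  obtain D where D: "\<forall>x\<in>W. (f has_derivative (\<lambda>v. \<Sum>i\<in>UNIV. (v $ i) *\<^sub>R D i x)) (at x)"
    "\<And>i. k_times_diff k W (D i)"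
    using Suc.prems(1) by auto
  obtain D' where D': "\<forall>x\<in>W. (h has_derivative (\<lambda>v. \<Sum>i\<in>UNIV. (v $ i) *\<^sub>R D' i x)) (at x)"
    "\<And>i. k_times_diff k W (D' i)"
    using Suc.prems(2) by auto
  have "((\<lambda>x. f x + h x) has_derivative (\<lambda>v. \<Sum>i\<in>UNIV. (v $ i) *\<^sub>R (D i x + D' i x))) (at x)"
    if "x \<in> W" for x
    using has_derivative_add[OF D(1)[rule_format, OF that] D'(1)[rule_format, OF that]]
    by (simp add: scaleR_add_right sum.distrib)
  then show ?case
    using Suc.IH[OF D(2) D'(2)] by (auto intro!: exI[of _ "\<lambda>i x. D i x + D' i x"])
qed (auto intro: continuous_on_add)

lemma k_times_diff_bounded_linear:
  assumes "bounded_linear L"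
  shows "k_times_diff k W f \<Longrightarrow> k_times_diff k W (\<lambda>x. L (f x))"
proof (induction k arbitrary: f)
  case 0
  then show ?case
    using bounded_linear.continuous_on[OF assms] by simp
next
  case (Suc k)
  obtain D where D: "\<forall>x\<in>W. (f has_derivative (\<lambda>v. \<Sum>i\<in>UNIV. (v $ i) *\<^sub>R D i x)) (at x)"
    "\<And>i. k_times_diff k W (D i)"
    using Suc.prems by auto
  interpret L: bounded_linear L by fact
  have "((\<lambda>x. L (f x)) has_derivative (\<lambda>v. \<Sum>i\<in>UNIV. (v $ i) *\<^sub>R L (D i x))) (at x)" if "x \<in> W" for x
    using L.has_derivative[OF D(1)[rule_format, OF that]] by (simp add: L.sum L.scaleR)
  then show ?case
    using Suc.IH[OF D(2)] by (auto intro!: exI[of _ "\<lambda>i x. L (D i x)"])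
qed

lemma smooth_on_add:
  assumes "smooth_on S f" "smooth_on S h"
  shows "smooth_on S (\<lambda>x. f x + h x)"
  unfolding smooth_on_def
proof
  fix x assume "x \<in> S"
  obtain W F where W: "open W" "x \<in> W" "\<And>k. k_times_diff k W F" "\<forall>y\<in>S \<inter> W. F y = f y"
    using assms(1) \<open>x \<in> S\<close> unfolding smooth_on_def by meson
  obtain U H where U: "open U" "x \<in> U" "\<And>k. k_times_diff k U H" "\<forall>y\<in>S \<inter> U. H y = h y"
    using assms(2) \<open>x \<in> S\<close> unfolding smooth_on_def by meson
  have "k_times_diff k (W \<inter> U) (\<lambda>x. F x + H x)" for k
    by (intro k_times_diff_add k_times_diff_subset[OF W(3)] k_times_diff_subset[OF U(3)]) auto
  then show "\<exists>W F. open W \<and> x \<in> W \<and> (\<forall>k. k_times_diff k W F) \<and> (\<forall>y\<in>S \<inter> W. F y = f y + h y)"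
    using W U by (intro exI[of _ "W \<inter> U"] exI[of _ "\<lambda>x. F x + H x"]) auto
qed

lemma smooth_on_bounded_linear:
  assumes "bounded_linear L" "smooth_on S f"
  shows "smooth_on S (\<lambda>x. L (f x))"
  unfolding smooth_on_def
proof
  fix x assume "x \<in> S"
  obtain W F where W: "open W" "x \<in> W" "\<And>k. k_times_diff k W F" "\<forall>y\<in>S \<inter> W. F y = f y"
    using assms(2) \<open>x \<in> S\<close> unfolding smooth_on_def by meson
  then show "\<exists>W F. open W \<and> x \<in> W \<and> (\<forall>k. k_times_diff k W F) \<and> (\<forall>y\<in>S \<inter> W. F y = L (f y))"
    using k_times_diff_bounded_linear[OF assms(1) W(3)]
    by (intro exI[of _ W] exI[of _ "\<lambda>x. L (F x)"]) auto
qed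

lemma smooth_on_zero: "smooth_on S (\<lambda>x. 0)"
proof -
  have "k_times_diff k UNIV (\<lambda>x. 0 :: 'b)" for k
    by (induction k) (auto intro!: exI[of _ "\<lambda>i x. 0"])
  then show ?thesis
    unfolding smooth_on_def by (intro ballI exI[of _ UNIV] exI[of _ "\<lambda>x. 0"]) auto
qed

text \<open>The coefficients \<open>D\<close> are those of a local extension and hence continuous on
  a full neighbourhood, also around boundary points. They depend on the chosen extension; uniqueness
  has to come from the shape of \<open>S\<close>.\<close>

lemma smooth_on_has_derivative:
  assumes "smooth_on S f" "x \<in> S"
  shows "\<exists>W D. open W \<and> x \<in> W \<and> (\<forall>i. continuous_on W (D i)) \<and>
    (\<forall>y\<in>S \<inter> W. (f has_derivative (\<lambda>v. \<Sum>i\<in>UNIV. (v $ i) *\<^sub>R D i y)) (at y within S))"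
proof -
  obtain W F where W: "open W" "x \<in> W" "\<And>k. k_times_diff k W F" and F: "\<forall>y\<in>S \<inter> W. F y = f y"
    using assms unfolding smooth_on_def by meson
  obtain D where D: "\<forall>x\<in>W. (F has_derivative (\<lambda>v. \<Sum>i\<in>UNIV. (v $ i) *\<^sub>R D i x)) (at x)"
    "\<And>i. continuous_on W (D i)"
    using W(3)[of "Suc 0"] by auto
  have "(f has_derivative (\<lambda>v. \<Sum>i\<in>UNIV. (v $ i) *\<^sub>R D i y)) (at y within S)" if y: "y \<in> S \<inter> W" for y
  proof -
    have "(F has_derivative (\<lambda>v. \<Sum>i\<in>UNIV. (v $ i) *\<^sub>R D i y)) (at y within S)"
      using D(1) y by (auto intro: has_derivative_at_withinI)
    moreover have "eventually (\<lambda>z. z \<in> W) (at y within S)"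
      using y W(1) by (meson IntD2 eventually_at_topological eventually_at_filter)
    then have "eventually (\<lambda>z. F z = f z) (at y within S)"
      using F unfolding eventually_at_filter by (auto elim: eventually_mono)
    ultimately show ?thesis
      using F y by (elim has_derivative_transform_eventually) auto
  qed
  with W D(2) show ?thesis
    by (intro exI[of _ W] exI[of _ D]) auto
qed

lemma smooth_on_differentiable:
  assumes "smooth_on S f" "x \<in> S"
  shows "f differentiable (at x within S)"
proof -
  obtain W D where "open W" "x \<in> W" "\<forall>i. continuous_on W (D i)"
    "\<forall>y\<in>S \<inter> W. (f has_derivative (\<lambda>v. \<Sum>i\<in>UNIV. (v $ i) *\<^sub>R D i y)) (at y within S)"
    using smooth_on_has_derivative[OF assms] by (elim exE conjE) (rule that; assumption)
  with assms(2) show ?thesis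
    unfolding differentiable_def by blast
qed

lemma smooth_on_continuous_on: "smooth_on S f \<Longrightarrow> continuous_on S f"
  unfolding continuous_on_eq_continuous_within
  by (blast intro: differentiable_imp_continuous_within smooth_on_differentiable)

section \<open>Measurability of C1 domains and uniqueness of derivatives within them\<close>

lemma C1_domainE:
  assumes "C1_domain V" "x \<in> V"
  obtains (interior) W where "open W" "x \<in> W" "W \<subseteq> V"
  | (boundary) W \<rho> \<rho>' where "open W" "x \<in> W" "\<forall>y\<in>W. (\<rho> has_derivative (\<lambda>h. \<rho>' y \<bullet> h)) (at y)"
    "continuous_on W \<rho>'" "\<rho> x = (0::real)" "\<rho>' x \<noteq> 0" "V \<inter> W = {y \<in> W. 0 \<le> \<rho> y}"
  using bspec[OF assms(1)[unfolded C1_domain_def] assms(2)]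
  by (elim exE conjE disjE) (rule that; assumption)+

text \<open>Chart overlaps are relatively open parts of chart images; through this they inherit
  uniqueness of derivatives.\<close>

lemma C1_domain_Int_open:
  assumes "C1_domain V" "open U"
  shows "C1_domain (V \<inter> U)"
  unfolding C1_domain_def
proof
  fix x assume x: "x \<in> V \<inter> U"
  then have "x \<in> V"
    by simp
  from assms(1) this show "\<exists>W. open W \<and> x \<in> W \<and> (W \<subseteq> V \<inter> U \<or>
      (\<exists>\<rho> \<rho>'. (\<forall>y\<in>W. (\<rho> has_derivative (\<lambda>h. \<rho>' y \<bullet> h)) (at y)) \<and> continuous_on W \<rho>' \<and>
         \<rho> x = (0::real) \<and> \<rho>' x \<noteq> 0 \<and> V \<inter> U \<inter> W = {y \<in> W. 0 \<le> \<rho> y}))"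
  proof (cases rule: C1_domainE)
    case (interior W)
    then show ?thesis
      using assms(2) x by (intro exI[of _ "W \<inter> U"]) auto
  next
    case (boundary W \<rho> \<rho>')
    have "V \<inter> U \<inter> (W \<inter> U) = {y \<in> W \<inter> U. 0 \<le> \<rho> y}"
      using boundary(7) by blast
    moreover have "continuous_on (W \<inter> U) \<rho>'"
      using boundary(4) by (rule continuous_on_subset) simp
    ultimately show ?thesis
      using boundary assms(2) x
      by (intro exI[of _ "W \<inter> U"] conjI disjI2 exI[of _ \<rho>] exI[of _ \<rho>'] open_Int) simp_all
  qed
qed

text \<open>\<open>V\<close> is locally closed: near a boundary point its complement is
  \<open>{\<rho> < 0}\<close>, which is open by continuity. Collecting the neighbourhoods writes
  \<open>V\<close> as a difference of two open sets, with no countability argument for the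
  union.\<close>

lemma C1_domain_borel:
  assumes "C1_domain V"
  shows "V \<in> sets borel"
proof -
  have "\<exists>W. open W \<and> x \<in> W \<and> open (W - V)" if x: "x \<in> V" for x
    using assms x
  proof (cases rule: C1_domainE)
    case (interior W)
    then have "W - V = {}"
      by blast
    with interior show ?thesis
      by (metis open_empty)
  next
    case (boundary W \<rho> \<rho>')
    then have "continuous_on W \<rho>"
      by (meson has_derivative_continuous continuous_at_imp_continuous_on)
    then have "open (W \<inter> \<rho> -` {..<0})"
      using boundary(1) continuous_on_open_vimage[of W \<rho>] by (metis open_lessThan Int_commute)
    moreover have "W - V = W \<inter> \<rho> -` {..<0}"
    proof -
      have "W - V = W - V \<inter> W"
        by blast
      also have "\<dots> = W \<inter> \<rho> -` {..<0}"
        unfolding boundary(7) by fastforce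
      finally show ?thesis .
    qed
    ultimately show ?thesis
      using boundary(1,2) by metis
  qed
  then obtain W where W: "\<And>x. x \<in> V \<Longrightarrow> open (W x) \<and> x \<in> W x \<and> open (W x - V)"
    by metis
  have "V = (\<Union>x\<in>V. W x) - (\<Union>x\<in>V. W x - V)"
    using W by blast
  moreover have "open (\<Union>x\<in>V. W x)" "open (\<Union>x\<in>V. W x - V)"
    using W by blast+
  ultimately show ?thesis
    by (metis borel_open sets.Diff)
qed

text \<open>Restricting \<open>f\<close> to the segment from \<open>x\<close> in direction
  \<open>v\<close> gives a one-sided derivative in one real variable, which is unique because 0 is a
  limit point of \<open>{0..<e}\<close>.\<close>

lemma has_derivative_unique_direction:
  fixes f :: "'a::real_normed_vector \<Rightarrow> 'b::real_normed_vector"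
  assumes "(f has_derivative f') (at x within V)" "(f has_derivative f'') (at x within V)"
    and "e > 0" "\<And>t. 0 \<le> t \<Longrightarrow> t < e \<Longrightarrow> x + t *\<^sub>R v \<in> V"
  shows "f' v = f'' v"
proof -
  have "((\<lambda>t. f (x + t *\<^sub>R v)) has_vector_derivative D v) (at 0 within {0..<e})"
    if D: "(f has_derivative D) (at x within V)" for D
  proof -
    have g: "((\<lambda>t. x + t *\<^sub>R v) has_derivative (\<lambda>t. t *\<^sub>R v)) (at 0 within {0..<e})"
      by (auto intro!: derivative_eq_intros)
    have "(f has_derivative D) (at (x + 0 *\<^sub>R v) within (\<lambda>t. x + t *\<^sub>R v) ` {0..<e})"
      using assms(4) by (auto intro!: has_derivative_subset[OF D])
    from diff_chain_within[OF g this]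
    have "((\<lambda>t. f (x + t *\<^sub>R v)) has_derivative (\<lambda>t. D (t *\<^sub>R v))) (at 0 within {0..<e})"
      by (simp add: o_def)
    then show ?thesis
      using linear_cmul[OF has_derivative_linear[OF D]] by (simp add: has_vector_derivative_def)
  qed
  moreover have "at (0::real) within {0..<e} \<noteq> bot"
    using \<open>e > 0\<close> by (simp add: trivial_limit_within islimpt_Ico)
  ultimately show ?thesis
    using vector_derivative_unique_within assms(1,2) by metis
qed

text \<open>The directions pointing into the domain contain an open half space, hence span.\<close>

lemma C1_domain_derivative_unique:
  fixes f :: "real^'n \<Rightarrow> 'b::real_normed_vector"
  assumes V: "C1_domain V" "x \<in> V"
    and D: "(f has_derivative f') (at x within V)" "(f has_derivative f'') (at x within V)"
  shows "f' = f''"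
proof -
  have near: "\<exists>e>0. \<forall>t. 0 \<le> t \<and> t < e \<longrightarrow> x + t *\<^sub>R v \<in> W" if W: "open W" "x \<in> W" for W v
  proof -
    obtain d where d: "d > 0" "ball x d \<subseteq> W"
      using W open_contains_ball by blast
    have "x + t *\<^sub>R v \<in> W" if "0 \<le> t" "t < d / (norm v + 1)" for t
    proof -
      have "t * norm v \<le> t * (norm v + 1)"
        using that by (simp add: mult_left_mono)
      also have "\<dots> < d"
        using that by (simp add: pos_less_divide_eq add_nonneg_pos)
      finally show ?thesis
        using d that by (intro subsetD[OF d(2)]) (simp add: dist_norm)
    qed
    moreover have "d / (norm v + 1) > 0"
      using d by (simp add: add_nonneg_pos)
    ultimately show ?thesis
      by blast
  qed
  from V show ?thesis
  proof (cases rule: C1_domainE)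
    case (interior W)
    show ?thesis
    proof
      fix v
      obtain e where "e > 0" "\<forall>t. 0 \<le> t \<and> t < e \<longrightarrow> x + t *\<^sub>R v \<in> W"
        using near interior by blast
      then show "f' v = f'' v"
        using interior(3) by (intro has_derivative_unique_direction[OF D, of e]) auto
    qed
  next
    case (boundary W \<rho> \<rho>')
    note \<rho> = boundary(3,5,6) and VW = boundary(7) and W = boundary(1,2)
    \<comment> \<open>\<rho> vanishes at \<open>x\<close> and has positive derivative along
      \<open>v\<close>, so a short segment in this direction stays in
      \<open>{\<rho> \<ge> 0}\<close>.\<close>
    have inward: "f' v = f'' v" if v: "\<rho>' x \<bullet> v > 0" for v
    proof -
      have "((\<lambda>t. x + t *\<^sub>R v) has_derivative (\<lambda>t. t *\<^sub>R v)) (at 0)"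
        by (auto intro!: derivative_eq_intros)
      moreover have "(\<rho> has_derivative (\<lambda>h. \<rho>' x \<bullet> h)) (at (x + 0 *\<^sub>R v))"
        using \<rho>(1) W(2) by simp
      ultimately have "((\<lambda>t. \<rho> (x + t *\<^sub>R v)) has_derivative (\<lambda>t. \<rho>' x \<bullet> (t *\<^sub>R v))) (at 0)"
        using diff_chain_at[of "\<lambda>t. x + t *\<^sub>R v"] by (fastforce simp: o_def)
      then have "((\<lambda>t. \<rho> (x + t *\<^sub>R v)) has_real_derivative (\<rho>' x \<bullet> v)) (at 0)"
        by (simp add: has_field_derivative_def mult_commute_abs)
      from has_real_derivative_pos_inc_right[OF this v]
      obtain d where d: "d > 0" "\<And>h. 0 < h \<Longrightarrow> h < d \<Longrightarrow> 0 < \<rho> (x + h *\<^sub>R v)"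
        using \<rho>(2) by auto
      obtain e where e: "e > 0" "\<forall>t. 0 \<le> t \<and> t < e \<longrightarrow> x + t *\<^sub>R v \<in> W"
        using near W by blast
      have "x + t *\<^sub>R v \<in> V" if t: "0 \<le> t" "t < min d e" for t
      proof -
        have "0 \<le> \<rho> (x + t *\<^sub>R v)"
          using t d(2)[of t] \<rho>(2) by (cases "t = 0") auto
        then show ?thesis
          using t e VW by auto
      qed
      then show ?thesis
        using d(1) e(1) by (intro has_derivative_unique_direction[OF D, of "min d e"]) auto
    qed
    show ?thesis
    proof
      fix v
      define r where "r = \<rho>' x \<bullet> \<rho>' x"
      \<comment> \<open>This makes the product of \<rho>'(x) with K \<rho>'(x) equal to |\<rho>'(x)
        . v| + 1. Hence both K \<rho>'(x) and v + K \<rho>'(x) point strictly inward, and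
        \<open>v\<close> is their difference.\<close>
      define K where "K = (\<bar>\<rho>' x \<bullet> v\<bar> + 1) / r"
      have r: "r > 0"
        using \<rho>(3) by (simp add: r_def)
      have K: "K > 0" "\<rho>' x \<bullet> (K *\<^sub>R \<rho>' x) = \<bar>\<rho>' x \<bullet> v\<bar> + 1"
        using r by (simp_all add: K_def r_def[symmetric] add_nonneg_pos)
      have "f' (v + K *\<^sub>R \<rho>' x) = f'' (v + K *\<^sub>R \<rho>' x)"
        by (rule inward) (use K(2) in \<open>simp add: inner_add_right\<close>)
      moreover have "f' (K *\<^sub>R \<rho>' x) = f'' (K *\<^sub>R \<rho>' x)"
        by (rule inward) (use K(2) in simp)
      ultimately show "f' v = f'' v"
        using linear_add[OF has_derivative_linear[OF D(1)]] linear_add[OF has_derivative_linear[OF D(2)]]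
        by simp
    qed
  qed
qed

lemma C1_domain_frechet_derivative:
  assumes "C1_domain V" "x \<in> V" "(f has_derivative f') (at x within V)"
  shows "frechet_derivative f (at x within V) = f'"
  using C1_domain_derivative_unique[OF assms(1,2) _ assms(3)] assms(3)
  by (metis differentiableI frechet_derivative_works)

text \<open>\<open>frechet_derivative\<close> is a choice among possible derivatives; uniqueness on
  a C1 domain identifies it near each point with the continuous coefficients of a local
  extension.\<close>

lemma smooth_on_continuous_frechet_derivative:
  assumes V: "C1_domain V" and f: "smooth_on V f"
  shows "continuous_on V (\<lambda>x. frechet_derivative f (at x within V) v)"
  unfolding continuous_on_eq_continuous_within
proof
  fix x assume x: "x \<in> V"
  obtain W D where W: "open W" "x \<in> W" and D: "\<forall>i. continuous_on W (D i)"
    "\<forall>y\<in>V \<inter> W. (f has_derivative (\<lambda>v. \<Sum>i\<in>UNIV. (v $ i) *\<^sub>R D i y)) (at y within V)"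
    using smooth_on_has_derivative[OF f x] by (elim exE conjE) (rule that; assumption)
  have eq: "frechet_derivative f (at y within V) v = (\<Sum>i\<in>UNIV. (v $ i) *\<^sub>R D i y)" if "y \<in> V \<inter> W" for y
    using C1_domain_frechet_derivative[OF V _ bspec[OF D(2) that]] that by simp
  have "continuous_on W (\<lambda>y. \<Sum>i\<in>UNIV. (v $ i) *\<^sub>R D i y)"
    by (intro continuous_intros D(1)[rule_format])
  then have "continuous (at x within V) (\<lambda>y. \<Sum>i\<in>UNIV. (v $ i) *\<^sub>R D i y)"
    by (rule continuous_at_imp_continuous_at_within[OF continuous_on_interior])
      (simp add: interior_open W)
  moreover have "eventually (\<lambda>y. (\<Sum>i\<in>UNIV. (v $ i) *\<^sub>R D i y) = frechet_derivative f (at y within V) v) (at x within V)"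
    unfolding eventually_at_topological by (rule exI[of _ W]) (use W eq in simp)
  ultimately have "((\<lambda>y. frechet_derivative f (at y within V) v) \<longlongrightarrow> (\<Sum>i\<in>UNIV. (v $ i) *\<^sub>R D i x)) (at x within V)"
    unfolding continuous_within by (rule Lim_transform_eventually)
  then show "continuous (at x within V) (\<lambda>x. frechet_derivative f (at x within V) v)"
    using eq[of x] x W by (simp add: continuous_within)
qed

section \<open>The volume measure\<close>

lemma continuous_on_det [continuous_intros]:
  fixes A :: "'a::topological_space \<Rightarrow> real^'n^'n"
  assumes "\<And>i j. continuous_on S (\<lambda>x. A x $ i $ j)"
  shows "continuous_on S (\<lambda>x. det (A x))"
  unfolding det_def by (intro continuous_intros assms)

text \<open>Each added set gives up the points already covered. The index is kept, so that every
  piece remembers a chart that contains it.\<close>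

lemma finite_disjoint_refinement:
  assumes "finite D" "\<And>c. c \<in> D \<Longrightarrow> F c \<in> sets N"
  shows "\<exists>B. (\<forall>c\<in>D. B c \<in> sets N \<and> B c \<subseteq> F c) \<and> disjoint_family_on B D \<and> (\<Union>c\<in>D. B c) = (\<Union>c\<in>D. F c)"
  using assms
proof (induction D)
  case (insert d D)
  then obtain B where B: "\<forall>c\<in>D. B c \<in> sets N \<and> B c \<subseteq> F c" "disjoint_family_on B D" "(\<Union>c\<in>D. B c) = (\<Union>c\<in>D. F c)"
    by auto
  define B' where "B' = B(d := F d - (\<Union>c\<in>D. F c))"
  have eq: "B' c = B c" if "c \<in> D" for c
    using that insert.hyps by (auto simp: B'_def)
  have "F d - (\<Union>c\<in>D. F c) \<in> sets N"
    using insert.prems insert.hyps(1) by (intro sets.Diff sets.finite_UN) auto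
  then have "\<forall>c\<in>insert d D. B' c \<in> sets N \<and> B' c \<subseteq> F c"
    using B insert.hyps by (auto simp: B'_def)
  moreover have "disjoint_family_on B' (insert d D)"
    using B insert.hyps eq unfolding disjoint_family_on_def by (auto simp: B'_def)
  moreover have "(\<Union>c\<in>insert d D. B' c) = (\<Union>c\<in>insert d D. F c)"
  proof -
    have "(\<Union>c\<in>D. B' c) = (\<Union>c\<in>D. F c)"
      using eq B(3) by simp
    then show ?thesis
      by (auto simp: B'_def)
  qed
  ultimately show ?case
    by (intro exI[of _ B'] conjI)
qed (auto simp: disjoint_family_on_def)

lemma openin_sets_restrict_space:
  assumes "openin (top_of_set M) U"
  shows "U \<in> sets (restrict_space borel M)"
proof -
  obtain T where "open T" "U = M \<inter> T"
    using assms by (auto simp: openin_open)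
  then show ?thesis
    unfolding sets_restrict_space by (intro image_eqI[of _ _ T]) auto
qed

section \<open>Charts and their measurability\<close>

locale compact_riemannian =
  fixes M :: "'a::topological_space set" and \<A> :: "('a, 'n::finite) chart set"
    and g :: "('a, 'n) metric_tensor"
  assumes manifold: "riemannian_manifold M \<A> g" and compact: "compact M"
begin

lemma chart: "c \<in> \<A> \<Longrightarrow> is_chart M c"
  using manifold by (simp add: riemannian_manifold_def smooth_atlas_def)

lemma chart_openin: "c \<in> \<A> \<Longrightarrow> openin (top_of_set M) (fst c)"
  using chart by (simp add: is_chart_def)

lemma chart_subset: "c \<in> \<A> \<Longrightarrow> fst c \<subseteq> M"
  by (rule openin_imp_subset[OF chart_openin])

lemma charts_cover: "(\<Union>c\<in>\<A>. fst c) = M"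
  using manifold by (simp add: riemannian_manifold_def smooth_atlas_def)

lemma chart_image_C1: "c \<in> \<A> \<Longrightarrow> C1_domain (chart_image c)"
  using chart by (simp add: is_chart_def)

lemma chart_homeomorphism: "c \<in> \<A> \<Longrightarrow> homeomorphism (fst c) (chart_image c) (snd c) (chart_inv c)"
  using chart by (simp add: is_chart_def)

lemma chart_inv_snd: "c \<in> \<A> \<Longrightarrow> p \<in> fst c \<Longrightarrow> chart_inv c (snd c p) = p"
  by (rule homeomorphism_apply1[OF chart_homeomorphism])

lemma snd_chart_inv: "c \<in> \<A> \<Longrightarrow> x \<in> chart_image c \<Longrightarrow> snd c (chart_inv c x) = x"
  by (rule homeomorphism_apply2[OF chart_homeomorphism])

lemma chart_inv_mem: "c \<in> \<A> \<Longrightarrow> x \<in> chart_image c \<Longrightarrow> chart_inv c x \<in> fst c"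
  using homeomorphism_image2[OF chart_homeomorphism] by blast

lemma chart_mem: "p \<in> fst c \<Longrightarrow> snd c p \<in> chart_image c"
  by (simp add: chart_image_def)

lemma chart_continuous: "c \<in> \<A> \<Longrightarrow> continuous_on (fst c) (snd c)"
  by (rule homeomorphism_cont1[OF chart_homeomorphism])

lemma chart_inv_continuous: "c \<in> \<A> \<Longrightarrow> continuous_on (chart_image c) (chart_inv c)"
  by (rule homeomorphism_cont2[OF chart_homeomorphism])

lemma continuous_on_chart:
  assumes "c \<in> \<A>" "continuous_on (chart_image c) h"
  shows "continuous_on (fst c) (\<lambda>p. h (snd c p))"
  by (rule continuous_on_compose2[OF assms(2) chart_continuous[OF assms(1)]]) (auto simp: chart_mem)

lemma chart_sets: "c \<in> \<A> \<Longrightarrow> fst c \<in> sets (restrict_space borel M)"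
  by (rule openin_sets_restrict_space[OF chart_openin])

lemma chart_image_borel: "c \<in> \<A> \<Longrightarrow> chart_image c \<in> sets borel"
  by (rule C1_domain_borel[OF chart_image_C1])

text \<open>Images under a chart become preimages under its continuous inverse, which is what makes
  them Borel sets.\<close>

lemma image_eq_vimage:
  assumes "c \<in> \<A>" "A \<subseteq> fst c"
  shows "snd c ` A = chart_inv c -` A \<inter> chart_image c"
proof (intro equalityI subsetI)
  fix x assume "x \<in> chart_inv c -` A \<inter> chart_image c"
  then show "x \<in> snd c ` A"
    using snd_chart_inv[OF assms(1), of x] by (auto simp: image_iff intro!: bexI[of _ "chart_inv c x"])
next
  fix x assume "x \<in> snd c ` A"
  then obtain p where "p \<in> A" "x = snd c p"
    by auto
  with assms(2) show "x \<in> chart_inv c -` A \<inter> chart_image c"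
    using chart_inv_snd[OF assms(1), of p] chart_mem[of p c] by auto
qed

lemma chart_inv_measurable:
  assumes "c \<in> \<A>"
  shows "chart_inv c \<in> restrict_space borel (chart_image c) \<rightarrow>\<^sub>M restrict_space borel M"
  using chart_inv_mem[OF assms] chart_subset[OF assms]
  by (intro measurable_restrict_space2 borel_measurable_continuous_on_restrict chart_inv_continuous assms)
    (auto simp: space_restrict_space)

lemma image_borel:
  assumes "c \<in> \<A>" "A \<in> sets (restrict_space borel M)" "A \<subseteq> fst c"
  shows "snd c ` A \<in> sets borel"
proof -
  have "chart_inv c -` A \<inter> chart_image c \<in> sets (restrict_space borel (chart_image c))"
    using measurable_sets[OF chart_inv_measurable[OF assms(1)] assms(2)] by (simp add: space_restrict_space)
  then show ?thesis
    using chart_image_borel[OF assms(1)] by (simp add: image_eq_vimage[OF assms(1,3)] sets_restrict_space_iff)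
qed

section \<open>The volume density under change of chart\<close>

lemma metric_continuous: "c \<in> \<A> \<Longrightarrow> continuous_on (chart_image c) (\<lambda>x. g c (chart_inv c x))"
  using manifold smooth_on_continuous_on[of "chart_image c" "g c \<circ> chart_inv c"]
  by (simp add: riemannian_manifold_def riemannian_metric_def o_def)

definition vol_density :: "('a, 'n) chart \<Rightarrow> real^'n \<Rightarrow> real" where
  "vol_density c x = sqrt (det (g c (chart_inv c x)))"

lemma vol_density_continuous: "c \<in> \<A> \<Longrightarrow> continuous_on (chart_image c) (vol_density c)"
  unfolding vol_density_def by (intro continuous_intros metric_continuous)

lemma transition_derivative:
  assumes "c \<in> \<A>" "d \<in> \<A>" "p \<in> fst c \<inter> fst d"
  shows "(transition c d has_derivative (\<lambda>v. jacobian c d p *v v)) (at (snd c p) within snd c ` (fst c \<inter> fst d))"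
proof -
  have "smooth_on (snd c ` (fst c \<inter> fst d)) (transition c d)"
    using manifold assms by (simp add: riemannian_manifold_def smooth_atlas_def)
  then have D: "(transition c d has_derivative frechet_derivative (transition c d) (at (snd c p) within snd c ` (fst c \<inter> fst d)))
      (at (snd c p) within snd c ` (fst c \<inter> fst d))"
    using smooth_on_differentiable assms(3) by (auto simp: frechet_derivative_works)
  then show ?thesis
    unfolding jacobian_def matrix_vector_mul(2)[OF has_derivative_linear[OF D]] .
qed

lemma metric_change:
  "c \<in> \<A> \<Longrightarrow> d \<in> \<A> \<Longrightarrow> p \<in> fst c \<inter> fst d \<Longrightarrow>
    g c p = transpose (jacobian c d p) ** g d p ** jacobian c d p"
  using manifold unfolding riemannian_manifold_def riemannian_metric_def by blast

text \<open>Taking determinants in g_c = J^T g_d J gives sqrt(det g_c) = |det J| sqrt(det g_d),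
  which is exactly the Jacobian factor in the change of variables along the transition map.\<close>

lemma nn_integral_vol_density_eq:
  assumes c: "c \<in> \<A>" and d: "d \<in> \<A>" and A: "A \<in> sets (restrict_space borel M)" "A \<subseteq> fst c" "A \<subseteq> fst d"
  shows "(\<integral>\<^sup>+x\<in>snd c ` A. ennreal (vol_density c x) \<partial>lborel) = (\<integral>\<^sup>+x\<in>snd d ` A. ennreal (vol_density d x) \<partial>lborel)"
proof -
  define S where "S = snd c ` A"
  define T where "T = transition c d"
  have T: "T (snd c p) = snd d p" if "p \<in> A" for p
    using that A(2) chart_inv_snd[OF c] by (auto simp: T_def transition_def)
  then have TS: "T ` S = snd d ` A"
    by (force simp: S_def)
  have S: "S \<in> sets borel" "T ` S \<in> sets borel"
    unfolding TS by (simp_all add: S_def image_borel A c d)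
  have sub: "S \<subseteq> chart_image c" "T ` S \<subseteq> chart_image d"
    using A unfolding TS unfolding S_def chart_image_def by auto
  have meas: "(\<lambda>x. indicator R x * max 0 (vol_density e x)) \<in> borel_measurable borel"
    if "e \<in> \<A>" "R \<in> sets borel" "R \<subseteq> chart_image e" for e R
    using borel_measurable_continuous_on_indicator[OF that(2), of "\<lambda>x. max 0 (vol_density e x)"]
      continuous_on_subset[OF vol_density_continuous[OF that(1)] that(3)]
    by (simp add: continuous_on_max)
  \<comment> \<open>truncation at \<open>0\<close> spares proving that \<open>det g\<close> is positive\<close>
  have "(\<integral>\<^sup>+x\<in>T ` S. ennreal (max 0 (vol_density d x)) \<partial>lborel) = (\<integral>\<^sup>+x\<in>S. ennreal (max 0 (vol_density c x)) \<partial>lborel)"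
  proof (rule nn_integral_change_of_variables)
    show "(T has_derivative (\<lambda>v. jacobian c d (chart_inv c x) *v v)) (at x within S)" if x: "x \<in> S" for x
    proof -
      obtain p where p: "p \<in> A" "x = snd c p"
        using x unfolding S_def by blast
      have "(T has_derivative (\<lambda>v. jacobian c d p *v v)) (at x within snd c ` (fst c \<inter> fst d))"
        unfolding T_def p(2) using p(1) A by (intro transition_derivative c d) auto
      moreover have "S \<subseteq> snd c ` (fst c \<inter> fst d)"
        unfolding S_def using A by (intro image_mono) blast
      ultimately have "(T has_derivative (\<lambda>v. jacobian c d p *v v)) (at x within S)"
        by (rule has_derivative_subset)
      moreover have "chart_inv c x = p"
        using p A chart_inv_snd[OF c, of p] by auto
      ultimately show ?thesis
        by simp
    qed
    show "inj_on T S"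
      unfolding S_def
    proof (rule inj_onI, elim imageE)
      fix x y p q assume "T x = T y" "x = snd c p" "y = snd c q" "p \<in> A" "q \<in> A"
      then have "snd d p = snd d q"
        by (simp add: T)
      then show "x = y"
        using \<open>x = snd c p\<close> \<open>y = snd c q\<close> \<open>p \<in> A\<close> \<open>q \<in> A\<close> A chart_inv_snd[OF d] by (metis subsetD)
    qed
    show "max 0 (vol_density c x) = \<bar>det (matrix (\<lambda>v. jacobian c d (chart_inv c x) *v v))\<bar> * max 0 (vol_density d (T x))"
      if x: "x \<in> S" for x
    proof -
      obtain p where p: "p \<in> A" "x = snd c p"
        using x unfolding S_def by blast
      have inv: "chart_inv c x = p" "chart_inv d (T x) = p"
        using p A chart_inv_snd[OF c, of p] chart_inv_snd[OF d, of p] T by auto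
      have "det (g c p) = (det (jacobian c d p))\<^sup>2 * det (g d p)"
        using p A by (subst metric_change[OF c d])
          (auto simp: det_mul det_transpose power2_eq_square)
      then have "vol_density c x = \<bar>det (jacobian c d p)\<bar> * vol_density d (T x)"
        by (simp add: vol_density_def inv real_sqrt_mult)
      then show ?thesis
        by (simp add: inv max_mult_distrib_left)
    qed
  qed (use S sub meas c d in auto)
  moreover have "ennreal (max 0 a) = ennreal a" for a
    by (simp add: max_def ennreal_neg)
  ultimately show ?thesis
    unfolding TS by (simp add: S_def)
qed

text \<open>The coordinate volume pushed forward to \<open>M\<close>. It gives no mass to the
  complement of the chart domain, so all chart measures live on one sigma-algebra and can be
  added.\<close>

definition chart_measure :: "('a, 'n) chart \<Rightarrow> 'a measure" where
  "chart_measure c = distr (density (restrict_space lborel (chart_image c)) (\<lambda>x. ennreal (vol_density c x)))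
     (restrict_space borel M) (chart_inv c)"

lemma sets_chart_measure [simp]: "sets (chart_measure c) = sets (restrict_space borel M)"
  by (simp add: chart_measure_def)

lemma emeasure_chart_measure:
  assumes c: "c \<in> \<A>" and A: "A \<in> sets (restrict_space borel M)" "A \<subseteq> fst c"
  shows "emeasure (chart_measure c) A = (\<integral>\<^sup>+x\<in>snd c ` A. ennreal (vol_density c x) \<partial>lborel)"
proof -
  have V: "chart_image c \<in> sets borel"
    by (rule chart_image_borel[OF c])
  have sets_eq: "sets (restrict_space lborel (chart_image c)) = sets (restrict_space borel (chart_image c))"
    by (rule sets_restrict_space_cong) simp
  have meas: "chart_inv c \<in> density (restrict_space lborel (chart_image c)) (\<lambda>x. ennreal (vol_density c x)) \<rightarrow>\<^sub>M restrict_space borel M"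
    using chart_inv_measurable[OF c] by (simp cong: measurable_cong_sets add: sets_eq measurable_cong_sets[OF sets_eq refl])
  have dens: "(\<lambda>x. ennreal (vol_density c x)) \<in> borel_measurable (restrict_space lborel (chart_image c))"
    using borel_measurable_continuous_on_restrict[OF vol_density_continuous[OF c]]
    by (simp add: measurable_cong_sets[OF sets_eq refl])
  have S: "snd c ` A \<in> sets (restrict_space lborel (chart_image c))"
    using image_borel[OF c A] V A(2) by (auto simp: sets_restrict_space_iff chart_image_def)
  have "emeasure (chart_measure c) A =
      emeasure (density (restrict_space lborel (chart_image c)) (\<lambda>x. ennreal (vol_density c x))) (snd c ` A)"
    unfolding chart_measure_def using A(1)
    by (subst emeasure_distr[OF meas]) (auto simp: space_restrict_space image_eq_vimage[OF c A(2)])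
  also have "\<dots> = (\<integral>\<^sup>+x\<in>snd c ` A. ennreal (vol_density c x) \<partial>restrict_space lborel (chart_image c))"
    by (rule emeasure_density[OF dens S])
  also have "\<dots> = (\<integral>\<^sup>+x\<in>snd c ` A. ennreal (vol_density c x) \<partial>lborel)"
  proof -
    have "snd c ` A \<subseteq> chart_image c"
      unfolding chart_image_def using A(2) by (rule image_mono)
    then show ?thesis
      using V by (subst nn_integral_restrict_space)
        (simp_all add: mult.assoc indicator_inter_arith[symmetric] Int_absorb2)
  qed
  finally show ?thesis .
qed

lemma emeasure_chart_measure_eq:
  assumes "c \<in> \<A>" "d \<in> \<A>" "A \<in> sets (restrict_space borel M)" "A \<subseteq> fst c" "A \<subseteq> fst d"
  shows "emeasure (chart_measure c) A = emeasure (chart_measure d) A"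
  using nn_integral_vol_density_eq[OF assms] assms by (simp add: emeasure_chart_measure)

section \<open>Gluing the chart measures\<close>

lemma is_volume_measure_iff:
  "is_volume_measure M \<A> g \<mu> \<longleftrightarrow> sets \<mu> = sets (restrict_space borel M) \<and>
    (\<forall>c\<in>\<A>. \<forall>A\<in>sets (restrict_space borel M). A \<subseteq> fst c \<longrightarrow> emeasure \<mu> A = emeasure (chart_measure c) A)"
  unfolding is_volume_measure_def
  by (auto simp: emeasure_chart_measure vol_density_def)

text \<open>Compactness in the form used twice below: for chart domains and for sets of finite
  volume.\<close>

lemma finite_cover:
  assumes "\<And>p. p \<in> M \<Longrightarrow> \<exists>U. p \<in> U \<and> openin (top_of_set M) U \<and> P U"
  obtains D where "finite D" "\<And>U. U \<in> D \<Longrightarrow> openin (top_of_set M) U \<and> P U" "\<Union>D = M"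
proof -
  have "M \<subseteq> \<Union>{U. openin (top_of_set M) U \<and> P U}"
    using assms by blast
  then obtain D where D: "D \<subseteq> {U. openin (top_of_set M) U \<and> P U}" "finite D" "M \<subseteq> \<Union>D"
    using compact unfolding compact_eq_openin_cover by (metis (no_types, lifting) mem_Collect_eq)
  then have "\<Union>D \<subseteq> M"
    using openin_imp_subset by blast
  with D show thesis
    by (intro that[of D]) auto
qed

lemma finite_chart_partition:
  "\<exists>D B. finite D \<and> D \<subseteq> \<A> \<and> (\<forall>c\<in>D. B c \<in> sets (restrict_space borel M)) \<and>
    (\<forall>c\<in>D. B c \<subseteq> fst c) \<and> disjoint_family_on B D \<and> (\<Union>c\<in>D. B c) = M"
proof -
  have "\<exists>U. p \<in> U \<and> openin (top_of_set M) U \<and> U \<in> fst ` \<A>" if "p \<in> M" for p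
    using that charts_cover chart_openin by blast
  then obtain D where D: "finite D" "\<And>U. U \<in> D \<Longrightarrow> openin (top_of_set M) U \<and> U \<in> fst ` \<A>" "\<Union>D = M"
    using finite_cover[of "\<lambda>U. U \<in> fst ` \<A>"] by metis
  then have "D \<subseteq> fst ` \<A>"
    by blast
  then obtain D' where D': "D' \<subseteq> \<A>" "finite D'" "D = fst ` D'"
    using D(1) by (meson finite_subset_image)
  obtain B where "\<forall>c\<in>D'. B c \<in> sets (restrict_space borel M) \<and> B c \<subseteq> fst c" "disjoint_family_on B D'"
    "(\<Union>c\<in>D'. B c) = (\<Union>c\<in>D'. fst c)"
    using finite_disjoint_refinement[OF D'(2), of fst "restrict_space borel M"] chart_sets D'(1) by blast
  with D D' show ?thesis
    by (intro exI[of _ D'] exI[of _ B]) auto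
qed

text \<open>Existence: sum the chart measures over a finite Borel partition subordinate to charts.
  For a set inside an arbitrary chart, each piece lies in two chart domains, where the chart
  measures agree, so the sum collapses to the measure of that chart. Uniqueness: on each piece of
  the partition the value is prescribed.\<close>

lemma ex1_volume_measure: "\<exists>!\<mu>. is_volume_measure M \<A> g \<mu>"
proof -
  obtain D B where D: "finite D" "D \<subseteq> \<A>" and B': "\<forall>c\<in>D. B c \<in> sets (restrict_space borel M)"
    "\<forall>c\<in>D. B c \<subseteq> fst c" "disjoint_family_on B D" "(\<Union>c\<in>D. B c) = M"
    using finite_chart_partition by (elim exE conjE) (rule that; assumption)
  note B = B'(1,2)[rule_format] B'(3,4)
  let ?R = "restrict_space borel M"
  have spR: "space ?R = M"
    by (simp add: space_restrict_space)
  define \<nu> where "\<nu> A = (\<Sum>c\<in>D. emeasure (chart_measure c) (A \<inter> B c))" for A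
  define \<mu> where "\<mu> = measure_of M (sets ?R) \<nu>"
  have sets_\<mu>: "sets \<mu> = sets ?R"
    unfolding \<mu>_def using sets.sets_measure_of_eq[of ?R] spR by simp
  have "positive (sets \<mu>) \<nu>"
    by (simp add: positive_def \<nu>_def)
  moreover have "countably_additive (sets \<mu>) \<nu>"
  proof (rule countably_additiveI)
    fix A :: "nat \<Rightarrow> 'a set" assume A: "range A \<subseteq> sets \<mu>" "disjoint_family A"
    have "(\<Sum>i. emeasure (chart_measure c) (A i \<inter> B c)) = emeasure (chart_measure c) ((\<Union>i. A i) \<inter> B c)" if "c \<in> D" for c
    proof -
      have "range (\<lambda>i. A i \<inter> B c) \<subseteq> sets (chart_measure c)"
        using A(1) B(1)[OF that] by (auto simp: sets_\<mu>)
      moreover have "disjoint_family (\<lambda>i. A i \<inter> B c)"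
        using A(2) unfolding disjoint_family_on_def by blast
      ultimately show ?thesis
        by (simp add: suminf_emeasure)
    qed
    then show "(\<Sum>i. \<nu> (A i)) = \<nu> (\<Union>i. A i)"
      unfolding \<nu>_def by (simp add: suminf_sum)
  qed
  ultimately have emeasure_\<mu>: "emeasure \<mu> A = \<nu> A" if "A \<in> sets ?R" for A
    using that sets.space_closed[of ?R]
    by (intro emeasure_measure_of[OF \<mu>_def]) (auto simp: sets_\<mu> spR)
  show ?thesis
  proof (rule ex1I)
    show "is_volume_measure M \<A> g \<mu>"
      unfolding is_volume_measure_iff
    proof (intro conjI sets_\<mu> ballI impI)
      fix c A assume c: "c \<in> \<A>" and A: "A \<in> sets ?R" "A \<subseteq> fst c"
      have "emeasure \<mu> A = (\<Sum>d\<in>D. emeasure (chart_measure c) (A \<inter> B d))"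
        unfolding emeasure_\<mu>[OF A(1)] \<nu>_def
      proof (intro sum.cong refl emeasure_chart_measure_eq)
        fix d assume "d \<in> D"
        then show "d \<in> \<A>" "A \<inter> B d \<in> sets ?R" "A \<inter> B d \<subseteq> fst d" "A \<inter> B d \<subseteq> fst c"
          using A B(1,2)[of d] D(2) by blast+
      qed (rule c)
      also have "\<dots> = emeasure (chart_measure c) A"
        using A B c chart_subset[OF c]
        by (intro sum_emeasure_cover[symmetric] D) auto
      finally show "emeasure \<mu> A = emeasure (chart_measure c) A" .
    qed
  next
    fix \<mu>' assume "is_volume_measure M \<A> g \<mu>'"
    then have sets_\<mu>': "sets \<mu>' = sets ?R"
      and em: "\<And>c A. c \<in> \<A> \<Longrightarrow> A \<in> sets ?R \<Longrightarrow> A \<subseteq> fst c \<Longrightarrow> emeasure \<mu>' A = emeasure (chart_measure c) A"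
      unfolding is_volume_measure_iff by auto
    show "\<mu>' = \<mu>"
    proof (rule measure_eqI)
      fix A assume "A \<in> sets \<mu>'"
      then have A: "A \<in> sets ?R" "A \<subseteq> M"
        using sets.sets_into_space[of A ?R] by (auto simp: sets_\<mu>' spR)
      have "emeasure \<mu>' A = (\<Sum>c\<in>D. emeasure \<mu>' (A \<inter> B c))"
        using A B by (intro sum_emeasure_cover D) (auto simp: sets_\<mu>')
      also have "\<dots> = \<nu> A"
        unfolding \<nu>_def
      proof (intro sum.cong refl em)
        fix d assume "d \<in> D"
        then show "d \<in> \<A>" "A \<inter> B d \<in> sets ?R" "A \<inter> B d \<subseteq> fst d"
          using A B(1,2)[of d] D(2) by blast+
      qed
      finally show "emeasure \<mu>' A = emeasure \<mu> A"
        by (simp add: emeasure_\<mu>[OF A(1)])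
    qed (simp add: sets_\<mu> sets_\<mu>')
  qed
qed

lemma is_volume_measure_vol: "is_volume_measure M \<A> g (vol M \<A> g)"
  unfolding vol_def by (rule theI'[OF ex1_volume_measure])

lemma sets_vol [simp, measurable_cong]: "sets (vol M \<A> g) = sets (restrict_space borel M)"
  using is_volume_measure_vol by (simp add: is_volume_measure_iff)

lemma space_vol [simp]: "space (vol M \<A> g) = M"
  using sets_eq_imp_space_eq[OF sets_vol] by (simp add: space_restrict_space)

text \<open>The image of a chart or its density may be unbounded, so the neighbourhood is shrunk
  until the coordinates lie in a unit ball and the density stays below its value at \<open>p\<close>
  plus one.\<close>

lemma locally_finite_vol:
  assumes "p \<in> M"
  shows "\<exists>U. p \<in> U \<and> openin (top_of_set M) U \<and> emeasure (vol M \<A> g) U < \<infinity>"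
proof -
  obtain c where c: "c \<in> \<A>" "p \<in> fst c"
    using assms charts_cover by blast
  define K where "K = vol_density c (snd c p) + 1"
  define O1 where "O1 = ball (snd c p) 1"
  have cont: "continuous_on (fst c) (\<lambda>q. vol_density c (snd c q))"
    by (rule continuous_on_chart[OF c(1) vol_density_continuous[OF c(1)]])
  define U where "U = (fst c \<inter> snd c -` O1) \<inter> (fst c \<inter> (\<lambda>q. vol_density c (snd c q)) -` {..<K})"
  have "openin (top_of_set (fst c)) U"
    unfolding U_def O1_def
    by (intro openin_Int continuous_openin_preimage_gen chart_continuous c cont) auto
  then have U: "openin (top_of_set M) U"
    using chart_openin[OF c(1)] by (rule openin_trans)
  then have UR: "U \<in> sets (restrict_space borel M)"
    by (rule openin_sets_restrict_space)
  have Uc: "U \<subseteq> fst c"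
    by (auto simp: U_def)
  have "emeasure (vol M \<A> g) U = (\<integral>\<^sup>+x\<in>snd c ` U. ennreal (vol_density c x) \<partial>lborel)"
    using is_volume_measure_vol c(1) UR Uc by (simp add: is_volume_measure_iff emeasure_chart_measure)
  also have "\<dots> \<le> (\<integral>\<^sup>+x. ennreal K * indicator O1 x \<partial>lborel)"
    by (intro nn_integral_mono) (auto simp: U_def indicator_def intro!: ennreal_leI)
  also have "\<dots> = ennreal K * emeasure lborel O1"
    by (rule nn_integral_cmult_indicator) (simp add: O1_def)
  also have "\<dots> < \<infinity>"
    using emeasure_bounded_finite[of O1] by (simp add: O1_def ennreal_mult_less_top)
  finally have "emeasure (vol M \<A> g) U < \<infinity>" .
  moreover have "p \<in> U"
    using c by (simp add: U_def O1_def K_def)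
  ultimately show ?thesis
    using U by blast
qed

lemma finite_measure_vol: "finite_measure (vol M \<A> g)"
proof
  obtain D where D: "finite D" "\<And>U. U \<in> D \<Longrightarrow> openin (top_of_set M) U \<and> emeasure (vol M \<A> g) U < \<infinity>" "\<Union>D = M"
    by (rule finite_cover[of "\<lambda>U. emeasure (vol M \<A> g) U < \<infinity>"]) (use locally_finite_vol in auto)
  have "D \<subseteq> sets (vol M \<A> g)"
    using D(2) openin_sets_restrict_space by auto
  then have "emeasure (vol M \<A> g) M \<le> (\<Sum>U\<in>D. emeasure (vol M \<A> g) U)"
    using emeasure_subadditive_finite[OF D(1), of "\<lambda>U. U" "vol M \<A> g"] D(3) by simp
  also have "\<dots> < \<infinity>"
    using D(1,2) by simp
  finally show "emeasure (vol M \<A> g) (space (vol M \<A> g)) \<noteq> \<infinity>"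
    by simp
qed

end

section \<open>Semi-inner products and square integrable functions\<close>

text \<open>Evaluate at the vertex -b/c. The case c = 0 really occurs, for directions of zero
  seminorm; there a nonzero b would give the value -1 at t = -(a+1)/(2b).\<close>

lemma discriminant_le:
  fixes a b c :: real
  assumes "\<And>t. 0 \<le> a + 2 * b * t + c * t\<^sup>2" "0 \<le> c"
  shows "b\<^sup>2 \<le> a * c"
proof (cases "c = 0")
  case True
  have "b = 0"
  proof (rule ccontr)
    assume "b \<noteq> 0"
    then have "a + 2 * b * (- (a + 1) / (2 * b)) + c * (- (a + 1) / (2 * b))\<^sup>2 = -1"
      by (simp add: True field_simps)
    with assms(1)[of "- (a + 1) / (2 * b)"] show False
      by simp
  qed
  with True show ?thesis
    by simp
next
  case False
  with assms(2) have "c > 0"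
    by simp
  moreover have "a + 2 * b * (- b / c) + c * (- b / c)\<^sup>2 = (a * c - b\<^sup>2) / c"
    using False by (simp add: field_simps power2_eq_square)
  ultimately show ?thesis
    using assms(1)[of "- b / c"] by (simp add: zero_le_divide_iff)
qed

text \<open>Rotating a complex number onto its modulus turns estimates of complex pairings into
  statements about real quadratics.\<close>

lemma exists_phase:
  obtains z :: complex where "cmod z = 1" "Re (z * w) = cmod w"
proof (cases "w = 0")
  case False
  have "cnj w / of_real (cmod w) * w = of_real (cmod w)"
    using False by (simp add: field_simps complex_norm_square[symmetric] power2_eq_square)
  with False show thesis
    by (intro that[of "cnj w / of_real (cmod w)"]) (auto simp: norm_divide)
qed (use that[of 1] in simp)

text \<open>Definiteness is left out because functions are not identified almost everywhere: both
  the L^2 form and the energy form vanish on functions that are zero on \<open>M\<close>. The one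
  locale covers both forms.\<close>

locale complex_semi_inner =
  fixes V :: "('a \<Rightarrow> complex) set" and E :: "('a \<Rightarrow> complex) \<Rightarrow> ('a \<Rightarrow> complex) \<Rightarrow> complex"
  assumes zero_mem: "(\<lambda>x. 0) \<in> V"
    and add_mem: "u \<in> V \<Longrightarrow> v \<in> V \<Longrightarrow> (\<lambda>x. u x + v x) \<in> V"
    and scale_mem: "u \<in> V \<Longrightarrow> (\<lambda>x. c * u x) \<in> V"
    and add_left: "u \<in> V \<Longrightarrow> v \<in> V \<Longrightarrow> w \<in> V \<Longrightarrow> E (\<lambda>x. u x + v x) w = E u w + E v w"
    and scale_left: "u \<in> V \<Longrightarrow> w \<in> V \<Longrightarrow> E (\<lambda>x. c * u x) w = c * E u w"
    and commute: "u \<in> V \<Longrightarrow> v \<in> V \<Longrightarrow> E v u = cnj (E u v)"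
    and nonneg: "u \<in> V \<Longrightarrow> 0 \<le> Re (E u u)"
begin

definition nrm :: "('a \<Rightarrow> complex) \<Rightarrow> real" where
  "nrm u = sqrt (Re (E u u))"

lemma diff_mem: "u \<in> V \<Longrightarrow> v \<in> V \<Longrightarrow> (\<lambda>x. u x - v x) \<in> V"
  using add_mem[of u "\<lambda>x. -1 * v x"] scale_mem[of v "-1"] by simp

lemma diff_left: "u \<in> V \<Longrightarrow> v \<in> V \<Longrightarrow> w \<in> V \<Longrightarrow> E (\<lambda>x. u x - v x) w = E u w - E v w"
  using add_left[of u "\<lambda>x. -1 * v x" w] scale_left[of v w "-1"] scale_mem[of v "-1"] by simp

lemma add_right: "u \<in> V \<Longrightarrow> v \<in> V \<Longrightarrow> w \<in> V \<Longrightarrow> E w (\<lambda>x. u x + v x) = E w u + E w v"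
  using add_left[of u v w] by (simp add: commute[of _ w] add_mem)

lemma scale_right: "u \<in> V \<Longrightarrow> w \<in> V \<Longrightarrow> E w (\<lambda>x. c * u x) = cnj c * E w u"
  using scale_left[of u w c] by (simp add: commute[of _ w] scale_mem)

lemma diff_right: "u \<in> V \<Longrightarrow> v \<in> V \<Longrightarrow> w \<in> V \<Longrightarrow> E w (\<lambda>x. u x - v x) = E w u - E w v"
  using diff_left[of u v w] by (simp add: commute[of _ w] diff_mem)

lemma nrm_nonneg: "u \<in> V \<Longrightarrow> 0 \<le> nrm u"
  by (simp add: nrm_def nonneg)

lemma nrm_power2: "u \<in> V \<Longrightarrow> (nrm u)\<^sup>2 = Re (E u u)"
  by (simp add: nrm_def nonneg)

lemma self_eq: "u \<in> V \<Longrightarrow> E u u = of_real ((nrm u)\<^sup>2)"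
  using commute[of u u] by (simp add: nrm_power2 complex_eq_iff)

lemma nrm_add_scale:
  assumes "u \<in> V" "v \<in> V"
  shows "(nrm (\<lambda>x. u x + c * v x))\<^sup>2 = (nrm u)\<^sup>2 + 2 * Re (c * E v u) + (cmod c)\<^sup>2 * (nrm v)\<^sup>2"
proof -
  have "E (\<lambda>x. u x + c * v x) (\<lambda>x. u x + c * v x) = E u u + cnj c * E u v + c * E v u + c * cnj c * E v v"
    using assms by (simp add: add_left add_right scale_left scale_right scale_mem add_mem)
  moreover have "Re (cnj c * E u v) = Re (c * E v u)"
    using commute[OF assms] by simp
  moreover have "c * cnj c * E v v = of_real ((cmod c)\<^sup>2 * (nrm v)\<^sup>2)"
    by (simp only: self_eq[OF assms(2)] complex_norm_square[symmetric] of_real_mult)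
  ultimately show ?thesis
    using assms by (simp add: nrm_power2 add_mem scale_mem)
qed

text \<open>After a rotation of \<open>u\<close> by a phase, the squared seminorm of v + t z u is a
  real quadratic in t whose linear coefficient is twice the modulus of \<open>E u v\<close>; its
  discriminant is the claim.\<close>

lemma Cauchy_Schwarz:
  assumes "u \<in> V" "v \<in> V"
  shows "cmod (E u v) \<le> nrm u * nrm v"
proof -
  obtain z where z: "cmod z = 1" "Re (z * E u v) = cmod (E u v)"
    by (rule exists_phase)
  have "0 \<le> (nrm v)\<^sup>2 + 2 * cmod (E u v) * t + (nrm u)\<^sup>2 * t\<^sup>2" for t
  proof -
    have "Re (of_real t * z * E u v) = t * Re (z * E u v)"
      by (simp add: mult.assoc)
    then have "(nrm (\<lambda>x. v x + (of_real t * z) * u x))\<^sup>2 = (nrm v)\<^sup>2 + 2 * cmod (E u v) * t + (nrm u)\<^sup>2 * t\<^sup>2"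
      unfolding nrm_add_scale[OF assms(2,1)] using z by (simp add: norm_mult)
    then show ?thesis
      using zero_le_power2[of "nrm (\<lambda>x. v x + (of_real t * z) * u x)"] by simp
  qed
  from discriminant_le[OF this] have "(cmod (E u v))\<^sup>2 \<le> (nrm u * nrm v)\<^sup>2"
    by (simp add: power_mult_distrib mult.commute)
  then show ?thesis
    by (rule power2_le_imp_le) (use assms nrm_nonneg in auto)
qed

lemma nrm_add_le:
  assumes "u \<in> V" "v \<in> V"
  shows "nrm (\<lambda>x. u x + v x) \<le> nrm u + nrm v"
proof (rule power2_le_imp_le)
  have "(nrm (\<lambda>x. u x + v x))\<^sup>2 = (nrm u)\<^sup>2 + 2 * Re (E v u) + (nrm v)\<^sup>2"
    using nrm_add_scale[OF assms, of 1] by simp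
  also have "Re (E v u) \<le> nrm u * nrm v"
    using Cauchy_Schwarz[OF assms(2,1)] complex_Re_le_cmod[of "E v u"] by (simp add: mult.commute)
  finally show "(nrm (\<lambda>x. u x + v x))\<^sup>2 \<le> (nrm u + nrm v)\<^sup>2"
    by (simp add: power2_sum)
  show "0 \<le> nrm u + nrm v"
    using assms nrm_nonneg by simp
qed

lemma nrm_scale:
  assumes "u \<in> V"
  shows "nrm (\<lambda>x. c * u x) = cmod c * nrm u"
proof -
  have "E (\<lambda>x. c * u x) (\<lambda>x. c * u x) = of_real ((cmod c * nrm u)\<^sup>2)"
  proof -
    have "E (\<lambda>x. c * u x) (\<lambda>x. c * u x) = c * cnj c * E u u"
      using assms by (simp add: scale_left scale_right scale_mem)
    also have "\<dots> = of_real ((cmod c * nrm u)\<^sup>2)"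
      by (simp only: self_eq[OF assms] complex_norm_square[symmetric] of_real_mult power_mult_distrib)
    finally show ?thesis .
  qed
  then show ?thesis
    using nrm_nonneg[OF assms] by (simp add: nrm_def)
qed

lemma nrm_minus_commute: "u \<in> V \<Longrightarrow> v \<in> V \<Longrightarrow> nrm (\<lambda>x. u x - v x) = nrm (\<lambda>x. v x - u x)"
  using nrm_scale[OF diff_mem, of u v "-1"] by simp

lemma nrm_diff_triangle:
  assumes "u \<in> V" "v \<in> V" "w \<in> V"
  shows "nrm (\<lambda>x. u x - w x) \<le> nrm (\<lambda>x. u x - v x) + nrm (\<lambda>x. v x - w x)"
  using nrm_add_le[OF diff_mem diff_mem, OF assms(1,2,2,3)] by simp

lemma nrm_le_add_diff:
  assumes "u \<in> V" "v \<in> V"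
  shows "nrm u \<le> nrm v + nrm (\<lambda>x. u x - v x)"
  using nrm_add_le[OF assms(2) diff_mem, OF assms] by simp

text \<open>An approximate minimiser \<open>u\<close> of \<open>J u = \<parallel>u\<parallel>\<^sup>2 / 2 - Re (l u)\<close> satisfies the Euler--Lagrange
  equation approximately: \<open>J\<close> stays above \<open>J u - \<epsilon>\<close> on the line \<open>u + t v\<close>, and the discriminant of this
  quadratic in \<open>t\<close> bounds its linear coefficient.\<close>

lemma Riesz_approximation:
  assumes l_add: "\<And>u v. u \<in> V \<Longrightarrow> v \<in> V \<Longrightarrow> l (\<lambda>x. u x + v x) = l u + l v"
    and l_scale: "\<And>u c. u \<in> V \<Longrightarrow> l (\<lambda>x. c * u x) = c * l u"
    and bound: "\<And>u. u \<in> V \<Longrightarrow> cmod (l u) \<le> K * nrm u"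
    and "0 < e"
  shows "\<exists>u\<in>V. \<forall>v\<in>V. cmod (E v u - l v) \<le> e * nrm v"
proof -
  define J where "J u = (nrm u)\<^sup>2 / 2 - Re (l u)" for u
  \<comment> \<open>Young's inequality bounds \<open>J\<close> from below. The infimum is all that
    is used, as no minimiser need exist in the incomplete space \<open>V\<close>.\<close>
  have below: "- K\<^sup>2 / 2 \<le> J u" if "u \<in> V" for u
  proof -
    have "Re (l u) \<le> K * nrm u"
      using bound[OF that] complex_Re_le_cmod[of "l u"] by simp
    moreover have "2 * (K * nrm u) \<le> K\<^sup>2 + (nrm u)\<^sup>2"
      using sum_squares_bound[of K "nrm u"] by (simp add: mult.assoc)
    ultimately show ?thesis
      by (simp add: J_def field_simps)
  qed
  have ne: "J ` V \<noteq> {}"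
    using zero_mem by blast
  have bdd: "bdd_below (J ` V)"
    using below by (intro bdd_belowI2)
  \<comment> \<open>The tolerance \<open>e\<^sup>2 / 2\<close> becomes, after doubling, the constant
    term \<open>e\<^sup>2\<close> of the quadratic, so the discriminant bound is the square of
    \<open>e * nrm v\<close>.\<close>
  have "Inf (J ` V) < Inf (J ` V) + e\<^sup>2 / 2"
    using \<open>0 < e\<close> by simp
  then obtain u where u: "u \<in> V" "J u < Inf (J ` V) + e\<^sup>2 / 2"
    using cInf_lessD[OF ne] by blast
  have "cmod (E v u - l v) \<le> e * nrm v" if v: "v \<in> V" for v
  proof -
    obtain z where z: "cmod z = 1" "Re (z * (E v u - l v)) = cmod (E v u - l v)"
      by (rule exists_phase)
    have "0 \<le> e\<^sup>2 + 2 * cmod (E v u - l v) * t + (nrm v)\<^sup>2 * t\<^sup>2" for t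
    proof -
      define c where "c = of_real t * z"
      have w: "(\<lambda>x. u x + c * v x) \<in> V"
        using u(1) v by (intro add_mem scale_mem)
      have "J u - e\<^sup>2 / 2 \<le> J (\<lambda>x. u x + c * v x)"
        using u(2) cInf_lower[OF imageI[OF w] bdd] by linarith
      moreover have "l (\<lambda>x. u x + c * v x) = l u + c * l v"
        using u(1) v by (simp only: l_add l_scale scale_mem)
      moreover have "cmod c ^ 2 = t\<^sup>2"
        using z(1) by (simp add: c_def norm_mult)
      ultimately have "0 \<le> e\<^sup>2 / 2 + (Re (c * E v u) - Re (c * l v)) + t\<^sup>2 * (nrm v)\<^sup>2 / 2"
        by (simp add: J_def nrm_add_scale[OF u(1) v] field_simps)
      also have "Re (c * E v u) - Re (c * l v) = t * Re (z * (E v u - l v))"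
        by (simp add: c_def algebra_simps)
      finally show ?thesis
        unfolding z(2) by (simp add: mult_ac)
    qed
    from discriminant_le[OF this] have "(cmod (E v u - l v))\<^sup>2 \<le> (e * nrm v)\<^sup>2"
      by (simp add: power_mult_distrib)
    then show ?thesis
      by (rule power2_le_imp_le) (use nrm_nonneg[OF v] \<open>0 < e\<close> in auto)
  qed
  with u(1) show ?thesis
    by blast
qed

end

section \<open>Square integrable functions and completeness\<close>

lemma square_integrable_mult_integrable:
  assumes "square_integrable \<mu> f" "square_integrable \<mu> h"
  shows "integrable \<mu> (\<lambda>x. f x * cnj (h x))"
proof (rule Bochner_Integration.integrable_bound)
  show "integrable \<mu> (\<lambda>x. (cmod (f x))\<^sup>2 + (cmod (h x))\<^sup>2)"
    using assms by (simp add: square_integrable_def)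
  have "f \<in> borel_measurable \<mu>" "h \<in> borel_measurable \<mu>"
    using assms by (simp_all add: square_integrable_def)
  then show "(\<lambda>x. f x * cnj (h x)) \<in> borel_measurable \<mu>"
    by (intro borel_measurable_times borel_measurable_continuous_on[OF continuous_on_cnj[OF continuous_on_id]]) auto
  have "cmod a * cmod b \<le> (cmod a)\<^sup>2 + (cmod b)\<^sup>2" for a b
    using sum_squares_bound[of "cmod a" "cmod b"] mult_nonneg_nonneg[of "cmod a" "cmod b"]
    by (simp del: mult_nonneg_nonneg)
  then show "AE x in \<mu>. norm (f x * cnj (h x)) \<le> norm ((cmod (f x))\<^sup>2 + (cmod (h x))\<^sup>2)"
    by (simp add: norm_mult)
qed

lemma square_integrable_scale:
  "square_integrable \<mu> f \<Longrightarrow> square_integrable \<mu> (\<lambda>x. c * f x)"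
  by (auto simp: square_integrable_def norm_mult power_mult_distrib)

lemma square_integrable_add:
  assumes "square_integrable \<mu> f" "square_integrable \<mu> h"
  shows "square_integrable \<mu> (\<lambda>x. f x + h x)"
  unfolding square_integrable_def
proof
  show m: "(\<lambda>x. f x + h x) \<in> borel_measurable \<mu>"
    using assms by (auto simp: square_integrable_def)
  show "integrable \<mu> (\<lambda>x. (cmod (f x + h x))\<^sup>2)"
  proof (rule Bochner_Integration.integrable_bound)
    show "integrable \<mu> (\<lambda>x. 2 * (cmod (f x))\<^sup>2 + 2 * (cmod (h x))\<^sup>2)"
      using assms by (simp add: square_integrable_def)
    show "(\<lambda>x. (cmod (f x + h x))\<^sup>2) \<in> borel_measurable \<mu>"
      using m by measurable
    have "(cmod (a + b))\<^sup>2 \<le> 2 * (cmod a)\<^sup>2 + 2 * (cmod b)\<^sup>2" for a b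
    proof -
      have "(cmod (a + b))\<^sup>2 \<le> (cmod a + cmod b)\<^sup>2"
        by (intro power_mono norm_triangle_ineq) simp
      also have "\<dots> \<le> 2 * (cmod a)\<^sup>2 + 2 * (cmod b)\<^sup>2"
        using sum_squares_bound[of "cmod a" "cmod b"] by (simp add: power2_sum)
      finally show ?thesis .
    qed
    then show "AE x in \<mu>. norm ((cmod (f x + h x))\<^sup>2) \<le> norm (2 * (cmod (f x))\<^sup>2 + 2 * (cmod (h x))\<^sup>2)"
      by simp
  qed
qed

lemma L2_product_self:
  "L2_product \<mu> f f = of_real (LINT x|\<mu>. (cmod (f x))\<^sup>2)"
  unfolding L2_product_def complex_norm_square[symmetric] by (simp only: integral_complex_of_real)

lemma complex_semi_inner_L2: "complex_semi_inner {f. square_integrable \<mu> f} (L2_product \<mu>)"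
proof
  show "L2_product \<mu> (\<lambda>x. u x + v x) w = L2_product \<mu> u w + L2_product \<mu> v w"
    if "u \<in> {f. square_integrable \<mu> f}" "v \<in> {f. square_integrable \<mu> f}" "w \<in> {f. square_integrable \<mu> f}" for u v w
    using that by (simp add: L2_product_def distrib_right square_integrable_mult_integrable)
  show "L2_product \<mu> v u = cnj (L2_product \<mu> u v)" for u v
  proof -
    have "cnj (L2_product \<mu> u v) = (LINT x|\<mu>. cnj (u x * cnj (v x)))"
      unfolding L2_product_def by (rule Bochner_Integration.integral_cnj[symmetric])
    then show ?thesis
      by (simp add: L2_product_def mult.commute)
  qed
  show "0 \<le> Re (L2_product \<mu> u u)" for u
    by (simp add: L2_product_self)
qed (auto simp: square_integrable_add square_integrable_scale L2_product_def mult.assoc, simp add: square_integrable_def)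

interpretation L2: complex_semi_inner "{f. square_integrable \<mu> f}" "L2_product \<mu>"
  rewrites "complex_semi_inner.nrm (L2_product \<mu>) = L2_norm \<mu>"
    and "\<And>f. f \<in> {f. square_integrable \<mu> f} \<longleftrightarrow> square_integrable \<mu> f"
  for \<mu> :: "'a measure"
  using complex_semi_inner_L2
  by (auto simp: complex_semi_inner.nrm_def[OF complex_semi_inner_L2] L2_norm_def fun_eq_iff)

lemma nn_integral_L2_norm:
  assumes "square_integrable \<mu> f"
  shows "(\<integral>\<^sup>+x. ennreal ((cmod (f x))\<^sup>2) \<partial>\<mu>) = ennreal ((L2_norm \<mu> f)\<^sup>2)"
  using assms by (subst nn_integral_eq_integral)
    (auto simp: square_integrable_def L2_norm_def L2_product_self)

text \<open>One bound on the nonnegative integral gives membership and norm estimate together, which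
  suits Fatou's lemma and domination, where integrability is not known beforehand.\<close>

lemma square_integrableI_nn_integral:
  assumes "f \<in> borel_measurable \<mu>" "(\<integral>\<^sup>+x. ennreal ((cmod (f x))\<^sup>2) \<partial>\<mu>) \<le> ennreal (c\<^sup>2)" "0 \<le> c"
  shows "square_integrable \<mu> f" and "L2_norm \<mu> f \<le> c"
proof -
  have "(\<integral>\<^sup>+x. ennreal ((cmod (f x))\<^sup>2) \<partial>\<mu>) < \<infinity>"
    using assms(2) by (rule le_less_trans) simp
  then show sq: "square_integrable \<mu> f"
    using assms(1) unfolding square_integrable_def integrable_iff_bounded by simp
  show "L2_norm \<mu> f \<le> c"
    using assms(2,3) unfolding nn_integral_L2_norm[OF sq] by (simp add: power2_le_iff_abs_le)
qed

text \<open>The Riesz--Fischer theorem: a rapidly Cauchy subsequence converges almost everywhere,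
  and Fatou's lemma identifies its pointwise limit as the norm limit of the whole sequence.\<close>

lemma L2_complete:
  assumes s: "\<And>n. square_integrable \<mu> (s n)"
    and cauchy: "\<And>e. 0 < e \<Longrightarrow> \<exists>N. \<forall>m\<ge>N. \<forall>n\<ge>N. L2_norm \<mu> (\<lambda>x. s m x - s n x) < e"
  shows "\<exists>w. square_integrable \<mu> w \<and> (\<lambda>n. L2_norm \<mu> (\<lambda>x. s n x - w x)) \<longlonglongrightarrow> 0"
proof -
  have [measurable]: "s n \<in> borel_measurable \<mu>" for n
    using s by (simp add: square_integrable_def)
  have "\<exists>N. \<forall>m\<ge>N. \<forall>n\<ge>N. L2_norm \<mu> (\<lambda>x. s m x - s n x) < 1 / 2 ^ k" for k :: nat
    by (rule cauchy) simp
  then obtain N where N: "\<And>k m n. m \<ge> N k \<Longrightarrow> n \<ge> N k \<Longrightarrow> L2_norm \<mu> (\<lambda>x. s m x - s n x) < 1 / 2 ^ k"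
    by metis
  \<comment> \<open>Summing the thresholds makes \<open>r k\<close> at least \<open>N i\<close> for
    all i up to k, whether or not \<open>N\<close> is monotone; the summand \<open>k\<close> forces
    the indices to infinity.\<close>
  define r where "r k = (\<Sum>i\<le>k. N i) + k" for k
  have r: "r k \<ge> N k" "r k \<ge> k" "r (Suc k) \<ge> N k" for k
    using member_le_sum[of k "{..k}" N] by (auto simp: r_def)
  define d where "d k x = s (r (Suc k)) x - s (r k) x" for k x
  have [measurable]: "d k \<in> borel_measurable \<mu>" for k
    unfolding d_def by measurable
  have d: "square_integrable \<mu> (d k)" "L2_norm \<mu> (d k) \<le> 1 / 2 ^ k" for k
    unfolding d_def using L2.diff_mem[OF s s] N[OF r(3,1)] by (auto intro: less_imp_le)
  \<comment> \<open>The squared norms of \<open>d k\<close> are at most \<open>4 ^ -k\<close>, so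
    the weight \<open>2 ^ k\<close> still leaves a convergent sum of integrals. Where the weighted
    sum is finite, |d_k|^2 is eventually below \<open>2 ^ -k\<close>, hence the increments are
    dominated by a geometric series.\<close>
  have AE_sum: "AE x in \<mu>. (\<Sum>k. ennreal (2 ^ k * (cmod (d k x))\<^sup>2)) \<noteq> \<infinity>"
  proof (rule nn_integral_PInf_AE)
    have "(\<integral>\<^sup>+x. (\<Sum>k. ennreal (2 ^ k * (cmod (d k x))\<^sup>2)) \<partial>\<mu>) =
        (\<Sum>k. \<integral>\<^sup>+x. ennreal (2 ^ k * (cmod (d k x))\<^sup>2) \<partial>\<mu>)"
      by (rule nn_integral_suminf) measurable
    also have "\<dots> \<le> (\<Sum>k. ennreal ((1 / 2) ^ k))"
    proof (rule suminf_le)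
      fix k
      have "(\<integral>\<^sup>+x. ennreal (2 ^ k * (cmod (d k x))\<^sup>2) \<partial>\<mu>) = ennreal (2 ^ k) * (\<integral>\<^sup>+x. ennreal ((cmod (d k x))\<^sup>2) \<partial>\<mu>)"
        by (simp add: ennreal_mult' nn_integral_cmult)
      also have "\<dots> = ennreal (2 ^ k * (L2_norm \<mu> (d k))\<^sup>2)"
        by (simp add: nn_integral_L2_norm[OF d(1)] ennreal_mult')
      also have "\<dots> \<le> ennreal (2 ^ k * (1 / 2 ^ k)\<^sup>2)"
        using d L2.nrm_nonneg[OF d(1)] by (intro ennreal_leI mult_left_mono power_mono) auto
      also have "2 ^ k * (1 / 2 ^ k)\<^sup>2 = ((1 / 2) ^ k :: real)"
        by (simp add: power2_eq_square power_one_over)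
      finally show "(\<integral>\<^sup>+x. ennreal (2 ^ k * (cmod (d k x))\<^sup>2) \<partial>\<mu>) \<le> ennreal ((1 / 2) ^ k)" .
    qed auto
    also have "\<dots> = ennreal (\<Sum>k. (1 / 2) ^ k)"
      by (intro suminf_ennreal2) (auto intro: summable_geometric)
    also have "\<dots> < \<infinity>"
      by simp
    finally show "(\<integral>\<^sup>+x. (\<Sum>k. ennreal (2 ^ k * (cmod (d k x))\<^sup>2)) \<partial>\<mu>) \<noteq> \<infinity>"
      by simp
  qed measurable
  define w where "w x = lim (\<lambda>k. s (r k) x)" for x
  have [measurable]: "w \<in> borel_measurable \<mu>"
    unfolding w_def by (rule borel_measurable_lim_metric) measurable
  have conv: "AE x in \<mu>. (\<lambda>k. s (r k) x) \<longlonglongrightarrow> w x"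
    using AE_sum
  proof eventually_elim
    case (elim x)
    then have "summable (\<lambda>k. 2 ^ k * (cmod (d k x))\<^sup>2)"
      by (intro summable_suminf_not_top) auto
    then have "(\<lambda>k. 2 ^ k * (cmod (d k x))\<^sup>2) \<longlonglongrightarrow> 0"
      by (rule summable_LIMSEQ_zero)
    then have "eventually (\<lambda>k. 2 ^ k * (cmod (d k x))\<^sup>2 < 1) sequentially"
      by (rule order_tendstoD) simp
    then have "eventually (\<lambda>k. norm (d k x) \<le> sqrt (1 / 2) ^ k) sequentially"
    proof eventually_elim
      case (elim k)
      then have "(cmod (d k x))\<^sup>2 \<le> (sqrt (1 / 2) ^ k)\<^sup>2"
      proof -
        have "(sqrt (1 / 2) ^ k)\<^sup>2 = ((sqrt (1 / 2))\<^sup>2) ^ k"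
          by (simp only: power_mult[symmetric] mult.commute)
        also have "\<dots> = 1 / 2 ^ k"
          by (simp add: power_one_over)
        finally show ?thesis
          using elim by (simp only:) (simp add: field_simps)
      qed
      then show ?case
        by (rule power2_le_imp_le) simp
    qed
    moreover have "summable (\<lambda>k. sqrt (1 / 2) ^ k)"
      by (rule summable_geometric) (simp add: real_sqrt_lt_1_iff)
    ultimately have "summable (\<lambda>k. d k x)"
      by (rule summable_comparison_test_ev)
    then have "convergent (\<lambda>n. \<Sum>k<n. d k x)"
      by (simp add: summable_iff_convergent)
    moreover have "(\<Sum>k<n. d k x) = s (r n) x - s (r 0) x" for n
      unfolding d_def by (rule sum_lessThan_telescope)
    ultimately have "convergent (\<lambda>n. s (r n) x - s (r 0) x)"
      by simp
    from convergent_add[OF this convergent_const[of "s (r 0) x"]] have "convergent (\<lambda>n. s (r n) x)"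
      by simp
    then show ?case
      by (simp add: w_def convergent_LIMSEQ_iff)
  qed
  \<comment> \<open>Fatou's lemma is applied along the subsequence while \<open>n\<close> is held
    fixed; the bound therefore concerns all \<open>n\<close> from \<open>N k\<close> on and not only
    subsequence members.\<close>
  have close: "square_integrable \<mu> (\<lambda>x. s n x - w x) \<and> L2_norm \<mu> (\<lambda>x. s n x - w x) \<le> 1 / 2 ^ k"
    if n: "n \<ge> N k" for n k
  proof -
    have "(\<integral>\<^sup>+x. ennreal ((cmod (s n x - w x))\<^sup>2) \<partial>\<mu>) =
        (\<integral>\<^sup>+x. liminf (\<lambda>j. ennreal ((cmod (s n x - s (r j) x))\<^sup>2)) \<partial>\<mu>)"
    proof (rule nn_integral_cong_AE)
      show "AE x in \<mu>. ennreal ((cmod (s n x - w x))\<^sup>2) = liminf (\<lambda>j. ennreal ((cmod (s n x - s (r j) x))\<^sup>2))"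
        using conv
      proof eventually_elim
        case (elim x)
        then have "(\<lambda>j. ennreal ((cmod (s n x - s (r j) x))\<^sup>2)) \<longlonglongrightarrow> ennreal ((cmod (s n x - w x))\<^sup>2)"
          by (intro tendsto_intros)
        then show ?case
          by (intro lim_imp_Liminf[symmetric]) auto
      qed
    qed
    also have "\<dots> \<le> liminf (\<lambda>j. \<integral>\<^sup>+x. ennreal ((cmod (s n x - s (r j) x))\<^sup>2) \<partial>\<mu>)"
      by (rule nn_integral_liminf) measurable
    also have "\<dots> \<le> ennreal ((1 / 2 ^ k)\<^sup>2)"
    proof (rule Liminf_le)
      have "eventually (\<lambda>j. j \<ge> N k) sequentially"
        by (rule eventually_ge_at_top)
      then show "eventually (\<lambda>j. (\<integral>\<^sup>+x. ennreal ((cmod (s n x - s (r j) x))\<^sup>2) \<partial>\<mu>) \<le> ennreal ((1 / 2 ^ k)\<^sup>2)) sequentially"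
      proof eventually_elim
        case (elim j)
        then have "L2_norm \<mu> (\<lambda>x. s n x - s (r j) x) < 1 / 2 ^ k"
          using r(2)[of j] n by (intro N) auto
        then show ?case
          unfolding nn_integral_L2_norm[OF L2.diff_mem[OF s s]]
          by (intro ennreal_leI power_mono L2.nrm_nonneg L2.diff_mem s) auto
      qed
    qed (rule sequentially_bot)
    finally show ?thesis
      by (intro conjI square_integrableI_nn_integral) auto
  qed
  have "square_integrable \<mu> w"
    using L2.diff_mem[OF s[of "N 0"] conjunct1[OF close[of 0 "N 0"]]] by simp
  moreover have "(\<lambda>n. L2_norm \<mu> (\<lambda>x. s n x - w x)) \<longlonglongrightarrow> 0"
  proof (rule LIMSEQ_I)
    fix e :: real assume "0 < e"
    then obtain k where "(1 / 2) ^ k < e"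
      using real_arch_pow_inv[of e "1 / 2"] by auto
    then have "norm (L2_norm \<mu> (\<lambda>x. s n x - w x) - 0) < e" if "n \<ge> N k" for n
      using close[OF that] L2.nrm_nonneg[of \<mu> "\<lambda>x. s n x - w x"] by (simp add: power_one_over)
    then show "\<exists>M. \<forall>n\<ge>M. norm (L2_norm \<mu> (\<lambda>x. s n x - w x) - 0) < e"
      by blast
  qed
  ultimately show ?thesis
    by blast
qed

section \<open>The energy form\<close>

definition cmat :: "real^'n^'m \<Rightarrow> complex^'n^'m" where
  "cmat A = (\<chi> i j. complex_of_real (A $ i $ j))"

text \<open>Bilinear, without conjugation, to match the complex bilinear extension of the metric in
  \<open>metric_apply\<close>.\<close>

definition cdot :: "complex^'n \<Rightarrow> complex^'n \<Rightarrow> complex" where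
  "cdot x y = (\<Sum>i\<in>UNIV. x $ i * y $ i)"

lemma cmat_mult: "cmat (A ** B) = cmat A ** cmat B"
  by (simp add: cmat_def matrix_matrix_mult_def vec_eq_iff)

lemma cmat_one: "cmat (mat 1) = mat 1"
  by (simp add: cmat_def mat_def vec_eq_iff)

lemma cdot_mult_right: "cdot x (A *v y) = cdot (transpose A *v x) y"
proof -
  have "cdot x (A *v y) = (\<Sum>i\<in>UNIV. \<Sum>j\<in>UNIV. A $ i $ j * x $ i * y $ j)"
    by (simp add: cdot_def matrix_vector_mult_def sum_distrib_left mult_ac)
  also have "\<dots> = (\<Sum>j\<in>UNIV. \<Sum>i\<in>UNIV. A $ i $ j * x $ i * y $ j)"
    by (rule sum.swap)
  also have "\<dots> = cdot (transpose A *v x) y"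
    by (simp add: cdot_def matrix_vector_mult_def transpose_def sum_distrib_right)
  finally show ?thesis .
qed

lemma mult_matrix_inv:
  fixes A :: "real^'n^'n"
  assumes "det A \<noteq> 0"
  shows "A ** matrix_inv A = mat 1"
proof -
  have "\<exists>B. A ** B = mat 1 \<and> B ** A = mat 1"
    using assms by (simp add: invertible_det_nz[symmetric] invertible_def)
  then show ?thesis
    unfolding matrix_inv_def by (rule someI2_ex) simp
qed

text \<open>Cramer's rule; as a quotient of determinants the entry visibly depends continuously on
  the matrix.\<close>

lemma matrix_inv_entry:
  fixes A :: "real^'n^'n"
  assumes "det A \<noteq> 0"
  shows "matrix_inv A $ i $ j = det (\<chi> k l. if l = i then axis j 1 $ k else A $ k $ l) / det A"
proof -
  have "A ** matrix_inv A = mat 1"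
    using assms by (rule mult_matrix_inv)
  then have "A *v (matrix_inv A *v axis j 1) = axis j 1"
    by (simp add: matrix_vector_mul_assoc)
  then have "matrix_inv A *v axis j 1 = (\<chi> i. det (\<chi> k l. if l = i then axis j 1 $ k else A $ k $ l) / det A)"
    using cramer[OF assms] by blast
  moreover have "(matrix_inv A *v axis j 1) $ i = matrix_inv A $ i $ j"
    by (simp add: matrix_vector_mult_basis column_def)
  ultimately show ?thesis
    by simp
qed

lemma continuous_on_matrix_inv_entry:
  fixes A :: "'a::topological_space \<Rightarrow> real^'n^'n"
  assumes "continuous_on S A" "\<And>x. x \<in> S \<Longrightarrow> det (A x) \<noteq> 0"
  shows "continuous_on S (\<lambda>x. matrix_inv (A x) $ i $ j)"
proof -
  have A: "continuous_on S (\<lambda>x. A x $ k $ l)" for k l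
    using assms(1) by (intro continuous_intros)
  have "continuous_on S (\<lambda>x. det (\<chi> k l. if l = i then axis j 1 $ k else A x $ k $ l) / det (A x))"
  proof (intro continuous_on_divide continuous_on_det)
    show "continuous_on S (\<lambda>x. (\<chi> k l. if l = i then axis j 1 $ k else A x $ k $ l) $ k $ l)" for k l
      using A by (cases "l = i") auto
  qed (use A assms(2) in auto)
  then show ?thesis
    by (rule continuous_on_eq) (simp add: matrix_inv_entry assms(2))
qed

lemma continuous_on_openin_cover:
  assumes "\<And>x. x \<in> S \<Longrightarrow> \<exists>U. x \<in> U \<and> openin (top_of_set S) U \<and> continuous_on U f"
  shows "continuous_on S f"
  unfolding continuous_on_def
proof
  fix x assume "x \<in> S"
  then obtain U T where U: "x \<in> U" "continuous_on U f" and T: "open T" "U = S \<inter> T"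
    using assms by (metis openin_open)
  have "at x within S = at x within U"
    by (rule at_within_nhd[of x T]) (use U T in auto)
  then show "(f \<longlongrightarrow> f x) (at x within S)"
    using U by (simp add: continuous_on_def)
qed

context compact_riemannian
begin

lemma metric_symmetric_posdef:
  assumes "c \<in> \<A>" "p \<in> fst c"
  shows "transpose (g c p) = g c p" and "v \<noteq> 0 \<Longrightarrow> 0 < v \<bullet> (g c p *v v)"
  using manifold assms unfolding riemannian_manifold_def riemannian_metric_def by blast+

lemma metric_sym:
  assumes "c \<in> \<A>" "p \<in> fst c"
  shows "g c p $ i $ j = g c p $ j $ i"
proof -
  have "g c p $ i $ j = transpose (g c p) $ i $ j"
    by (simp only: metric_symmetric_posdef(1)[OF assms])
  then show ?thesis
    by (simp add: transpose_def)
qed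

lemma metric_nonneg: "c \<in> \<A> \<Longrightarrow> p \<in> fst c \<Longrightarrow> 0 \<le> v \<bullet> (g c p *v v)"
  using metric_symmetric_posdef(2)[of c p v] by (cases "v = 0") auto

lemma det_metric:
  assumes "c \<in> \<A>" "p \<in> fst c"
  shows "det (g c p) \<noteq> 0"
proof -
  have "v = 0" if "g c p *v v = 0" for v
    using metric_symmetric_posdef(2)[OF assms, of v] that by auto
  then show ?thesis
    using invertible_det_nz matrix_left_invertible_ker invertible_left_inverse by metis
qed

lemma metric_inverse: "c \<in> \<A> \<Longrightarrow> p \<in> fst c \<Longrightarrow> g c p ** matrix_inv (g c p) = mat 1"
  by (rule mult_matrix_inv[OF det_metric])

text \<open>Multiplying g_c = J^T g_d J by the inverse of g_c exhibits a right inverse of J^T. For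
  square matrices it is also a left inverse, which yields the contravariant rule without first
  inverting the Jacobian.\<close>

lemma matrix_inv_metric_change:
  assumes "c \<in> \<A>" "d \<in> \<A>" "p \<in> fst c \<inter> fst d"
  shows "jacobian c d p ** matrix_inv (g c p) ** transpose (jacobian c d p) = matrix_inv (g d p)"
proof -
  let ?J = "jacobian c d p"
  have "transpose ?J ** (g d p ** ?J ** matrix_inv (g c p)) = mat 1"
    using metric_inverse[of c p] metric_change[OF assms] assms by (simp add: matrix_mul_assoc)
  then have "(g d p ** ?J ** matrix_inv (g c p)) ** transpose ?J = mat 1"
    by (rule matrix_left_right_inverse[THEN iffD1])
  then have "g d p ** (?J ** matrix_inv (g c p) ** transpose ?J) = mat 1"
    by (simp add: matrix_mul_assoc)
  moreover have "matrix_inv (g d p) ** g d p = mat 1"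
    using metric_inverse[of d p] assms matrix_left_right_inverse by blast
  ultimately show ?thesis
    by (metis matrix_mul_assoc matrix_mul_lid matrix_mul_rid)
qed

lemma metric_apply_cdot: "metric_apply g c p x y = cdot x (cmat (g c p) *v y)"
  by (simp add: metric_apply_def cdot_def cmat_def matrix_vector_mult_def sum_distrib_left mult_ac)

lemma gradient_cmat: "gradient g c u p = cmat (matrix_inv (g c p)) *v (\<chi> i. partial_deriv c u p i)"
  by (simp add: gradient_def cmat_def matrix_vector_mult_def)

text \<open>The metric cancels one of the two inverse metrics; what remains is the dual metric on
  differentials, the form that is easiest to carry between charts.\<close>

lemma metric_apply_gradient:
  assumes "c \<in> \<A>" "p \<in> fst c"
  shows "metric_apply g c p (gradient g c u p) (gradient g c v p) =
    cdot (cmat (matrix_inv (g c p)) *v (\<chi> i. partial_deriv c u p i)) (\<chi> i. partial_deriv c v p i)"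
  using metric_inverse[OF assms]
  by (simp add: metric_apply_cdot gradient_cmat matrix_vector_mul_assoc cmat_mult[symmetric] cmat_one)

section \<open>Partial derivatives and gradient products across charts\<close>

lemma smooth_functions_derivative:
  assumes "u \<in> smooth_functions \<A>" "c \<in> \<A>" "p \<in> fst c"
  shows "(u \<circ> chart_inv c has_derivative frechet_derivative (u \<circ> chart_inv c) (at (snd c p) within chart_image c))
    (at (snd c p) within chart_image c)"
  using smooth_on_differentiable[of "chart_image c" "u \<circ> chart_inv c"] assms chart_mem[of p c]
  by (simp add: smooth_functions_def frechet_derivative_works)

lemma partial_deriv_eqI:
  assumes "c \<in> \<A>" "p \<in> fst c" "(u \<circ> chart_inv c has_derivative D) (at (snd c p) within chart_image c)"
  shows "partial_deriv c u p i = D (axis i 1)"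
  unfolding partial_deriv_def
  using C1_domain_frechet_derivative[OF chart_image_C1[OF assms(1)] chart_mem[OF assms(2)] assms(3)] by simp

lemma partial_deriv_continuous:
  assumes "u \<in> smooth_functions \<A>" "c \<in> \<A>"
  shows "continuous_on (fst c) (\<lambda>p. partial_deriv c u p i)"
  unfolding partial_deriv_def using assms
  by (intro continuous_on_chart[of c "\<lambda>x. frechet_derivative (u \<circ> chart_inv c) (at x within chart_image c) (axis i 1)"]
      smooth_on_continuous_frechet_derivative chart_image_C1) (auto simp: smooth_functions_def)

lemma smooth_functions_add:
  "u \<in> smooth_functions \<A> \<Longrightarrow> v \<in> smooth_functions \<A> \<Longrightarrow> (\<lambda>x. u x + v x) \<in> smooth_functions \<A>"
  by (auto simp: smooth_functions_def o_def intro: smooth_on_add)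

lemma smooth_functions_linear:
  "bounded_linear L \<Longrightarrow> u \<in> smooth_functions \<A> \<Longrightarrow> (\<lambda>x. L (u x)) \<in> smooth_functions \<A>"
  by (auto simp: smooth_functions_def o_def intro: smooth_on_bounded_linear)

lemma smooth_functions_zero: "(\<lambda>x. 0) \<in> smooth_functions \<A>"
  by (simp add: smooth_functions_def o_def smooth_on_zero)

lemma smooth_functions_scale: "u \<in> smooth_functions \<A> \<Longrightarrow> (\<lambda>x. a * u x) \<in> smooth_functions \<A>"
  by (rule smooth_functions_linear[OF bounded_linear_mult_right])

lemma smooth_functions_cnj: "u \<in> smooth_functions \<A> \<Longrightarrow> (\<lambda>x. cnj (u x)) \<in> smooth_functions \<A>"
  by (rule smooth_functions_linear[OF bounded_linear_cnj])

lemma partial_deriv_add: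
  assumes "u \<in> smooth_functions \<A>" "v \<in> smooth_functions \<A>" "c \<in> \<A>" "p \<in> fst c"
  shows "partial_deriv c (\<lambda>x. u x + v x) p i = partial_deriv c u p i + partial_deriv c v p i"
proof -
  note D = has_derivative_add[OF smooth_functions_derivative[OF assms(1,3,4)] smooth_functions_derivative[OF assms(2,3,4)]]
  show ?thesis
    by (subst partial_deriv_eqI[OF assms(3,4)]) (use D in \<open>simp add: o_def\<close>, simp add: partial_deriv_def o_def)
qed

lemma partial_deriv_linear:
  assumes "bounded_linear L" "u \<in> smooth_functions \<A>" "c \<in> \<A>" "p \<in> fst c"
  shows "partial_deriv c (\<lambda>x. L (u x)) p i = L (partial_deriv c u p i)"
proof -
  note D = bounded_linear.has_derivative[OF assms(1) smooth_functions_derivative[OF assms(2,3,4)]]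
  show ?thesis
    by (subst partial_deriv_eqI[OF assms(3,4)]) (use D in \<open>simp add: o_def\<close>, simp add: partial_deriv_def o_def)
qed

lemma C1_domain_overlap:
  assumes "c \<in> \<A>" "d \<in> \<A>"
  shows "C1_domain (snd c ` (fst c \<inter> fst d))"
proof -
  have "openin (top_of_set (chart_image c)) (chart_image c \<inter> chart_inv c -` fst d)"
    using chart_inv_mem[OF assms(1)] chart_subset[OF assms(1)]
    by (intro continuous_openin_preimage[of _ _ M] chart_inv_continuous chart_openin assms) auto
  then obtain U where "open U" "chart_image c \<inter> chart_inv c -` fst d = chart_image c \<inter> U"
    by (auto simp: openin_open)
  moreover have "snd c ` (fst c \<inter> fst d) = chart_image c \<inter> chart_inv c -` fst d"
    using image_eq_vimage[OF assms(1), of "fst c \<inter> fst d"] chart_inv_mem[OF assms(1)] by auto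
  ultimately show ?thesis
    using C1_domain_Int_open[OF chart_image_C1[OF assms(1)]] by simp
qed

text \<open>Chain rule on the overlap. The derivative in chart \<open>c\<close> and the composite
  through chart \<open>d\<close> are both derivatives within the overlap, a C1 domain, and hence
  coincide, at boundary points as well.\<close>

lemma partial_deriv_change:
  assumes u: "u \<in> smooth_functions \<A>" and c: "c \<in> \<A>" and d: "d \<in> \<A>" and p: "p \<in> fst c \<inter> fst d"
  shows "partial_deriv c u p i = (\<Sum>k\<in>UNIV. complex_of_real (jacobian c d p $ k $ i) * partial_deriv d u p k)"
proof -
  define S where "S = snd c ` (fst c \<inter> fst d)"
  define Dc where "Dc = frechet_derivative (u \<circ> chart_inv c) (at (snd c p) within chart_image c)"
  define Dd where "Dd = frechet_derivative (u \<circ> chart_inv d) (at (snd d p) within chart_image d)"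
  have T: "transition c d (snd c q) = snd d q" if "q \<in> fst c \<inter> fst d" for q
    using that chart_inv_snd[OF c] by (simp add: transition_def)
  have x: "snd c p \<in> S"
    using p by (simp add: S_def)
  have "S \<subseteq> chart_image c"
    by (auto simp: S_def chart_image_def)
  then have Dc: "(u \<circ> chart_inv c has_derivative Dc) (at (snd c p) within S)"
    unfolding Dc_def using smooth_functions_derivative[OF u c] p by (blast intro: has_derivative_subset)
  have Dd0: "(u \<circ> chart_inv d has_derivative Dd) (at (snd d p) within chart_image d)"
    unfolding Dd_def using smooth_functions_derivative[OF u d] p by blast
  moreover have "transition c d ` S \<subseteq> chart_image d"
    using T by (auto simp: S_def chart_image_def)
  ultimately have Dd: "(u \<circ> chart_inv d has_derivative Dd) (at (transition c d (snd c p)) within transition c d ` S)"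
    using T[OF p] by (auto intro: has_derivative_subset)
  have "((u \<circ> chart_inv d) \<circ> transition c d has_derivative Dd \<circ> (\<lambda>v. jacobian c d p *v v)) (at (snd c p) within S)"
    by (rule diff_chain_within[OF transition_derivative[OF c d p, folded S_def] Dd])
  then have "(u \<circ> chart_inv c has_derivative Dd \<circ> (\<lambda>v. jacobian c d p *v v)) (at (snd c p) within S)"
  proof (rule has_derivative_transform[OF x, rotated])
    fix y assume "y \<in> S"
    then obtain q where "q \<in> fst c \<inter> fst d" "y = snd c q"
      unfolding S_def by blast
    then show "(u \<circ> chart_inv c) y = ((u \<circ> chart_inv d) \<circ> transition c d) y"
      using T chart_inv_snd[OF c] chart_inv_snd[OF d] by simp
  qed
  then have "Dc = Dd \<circ> (\<lambda>v. jacobian c d p *v v)"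
    using C1_domain_derivative_unique[OF _ x Dc] C1_domain_overlap[OF c d] by (simp add: S_def)
  then have "Dc (axis i 1) = Dd (column i (jacobian c d p))"
    by (simp add: matrix_vector_mult_basis)
  also have "column i (jacobian c d p) = (\<Sum>k\<in>UNIV. (jacobian c d p $ k $ i) *\<^sub>R axis k 1)"
    using basis_expansion[of "column i (jacobian c d p)"] by (simp add: column_def scalar_mult_eq_scaleR)
  also have "Dd \<dots> = (\<Sum>k\<in>UNIV. (jacobian c d p $ k $ i) *\<^sub>R Dd (axis k 1))"
    using has_derivative_linear[OF Dd0] by (simp add: linear_sum linear_cmul)
  finally show ?thesis
    by (simp add: partial_deriv_def Dc_def Dd_def scaleR_conv_of_real)
qed

text \<open>Frees the product from the chart chosen by \<open>SOME\<close>: the Jacobians of the two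
  differentials combine with the inverse metric into the inverse metric of the chosen chart.\<close>

lemma gradient_product_eq:
  assumes u: "u \<in> smooth_functions \<A>" and v: "v \<in> smooth_functions \<A>" and c: "c \<in> \<A>" "p \<in> fst c"
  shows "gradient_product \<A> g u v p = metric_apply g c p (gradient g c u p) (gradient g c v p)"
proof -
  define d where "d = (SOME c. c \<in> \<A> \<and> p \<in> fst c)"
  have d: "d \<in> \<A>" "p \<in> fst d"
    unfolding d_def using someI[of "\<lambda>c. c \<in> \<A> \<and> p \<in> fst c"] c by blast+
  let ?J = "cmat (jacobian c d p)"
  have change: "(\<chi> i. partial_deriv c w p i) = transpose ?J *v (\<chi> i. partial_deriv d w p i)"
    if "w \<in> smooth_functions \<A>" for w
    using partial_deriv_change[OF that c(1) d(1)] c d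
    by (simp add: vec_eq_iff matrix_vector_mult_def transpose_def cmat_def)
  have J: "?J ** cmat (matrix_inv (g c p)) ** transpose ?J = cmat (matrix_inv (g d p))"
  proof -
    have "transpose ?J = cmat (transpose (jacobian c d p))"
      by (simp add: cmat_def transpose_def vec_eq_iff)
    then show ?thesis
      using matrix_inv_metric_change[OF c(1) d(1)] c d by (simp add: cmat_mult[symmetric])
  qed
  have "metric_apply g c p (gradient g c u p) (gradient g c v p) =
    cdot (?J ** cmat (matrix_inv (g c p)) ** transpose ?J *v (\<chi> i. partial_deriv d u p i)) (\<chi> i. partial_deriv d v p i)"
    unfolding metric_apply_gradient[OF c] change[OF u] change[OF v] cdot_mult_right
    by (simp add: matrix_vector_mul_assoc matrix_mul_assoc del: transpose_matrix_vector)
  also have "\<dots> = metric_apply g d p (gradient g d u p) (gradient g d v p)"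
    unfolding J metric_apply_gradient[OF d] ..
  finally show ?thesis
    by (simp add: gradient_product_def d_def[symmetric] Let_def)
qed

text \<open>The chart chosen in the definition may vary from point to point. Chart independence
  replaces it near each point by a fixed chart, where the coordinate formula is continuous.\<close>

lemma gradient_product_continuous:
  assumes "u \<in> smooth_functions \<A>" "v \<in> smooth_functions \<A>"
  shows "continuous_on M (gradient_product \<A> g u v)"
proof (rule continuous_on_openin_cover)
  fix p assume "p \<in> M"
  then obtain c where c: "c \<in> \<A>" "p \<in> fst c"
    using charts_cover by blast
  have "continuous_on (fst c) (\<lambda>q. g c (chart_inv c (snd c q)))"
    by (rule continuous_on_chart[OF c(1) metric_continuous[OF c(1)]])
  then have "continuous_on (fst c) (g c)"
    by (rule continuous_on_eq) (simp add: chart_inv_snd c)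
  then have inv: "continuous_on (fst c) (\<lambda>q. matrix_inv (g c q) $ i $ j)" for i j
    by (intro continuous_on_matrix_inv_entry det_metric c) auto
  have "continuous_on (fst c) (\<lambda>q. \<Sum>i\<in>UNIV. (\<Sum>j\<in>UNIV. complex_of_real (matrix_inv (g c q) $ i $ j) *
      partial_deriv c u q j) * partial_deriv c v q i)"
    by (intro continuous_on_sum continuous_on_mult continuous_on_of_real inv partial_deriv_continuous assms c)
  then have "continuous_on (fst c) (gradient_product \<A> g u v)"
  proof (rule continuous_on_eq)
    fix q assume "q \<in> fst c"
    then show "(\<Sum>i\<in>UNIV. (\<Sum>j\<in>UNIV. complex_of_real (matrix_inv (g c q) $ i $ j) *
      partial_deriv c u q j) * partial_deriv c v q i) = gradient_product \<A> g u v q"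
      unfolding gradient_product_eq[OF assms c(1) \<open>q \<in> fst c\<close>] metric_apply_gradient[OF c(1) \<open>q \<in> fst c\<close>]
      by (simp add: cdot_def cmat_def matrix_vector_mult_def)
  qed
  then show "\<exists>U. p \<in> U \<and> openin (top_of_set M) U \<and> continuous_on U (gradient_product \<A> g u v)"
    using c chart_openin by blast
qed

lemma smooth_functions_continuous:
  assumes "u \<in> smooth_functions \<A>"
  shows "continuous_on M u"
proof (rule continuous_on_openin_cover)
  fix p assume "p \<in> M"
  then obtain c where c: "c \<in> \<A>" "p \<in> fst c"
    using charts_cover by blast
  have "continuous_on (fst c) (\<lambda>q. (u \<circ> chart_inv c) (snd c q))"
    using assms c(1) by (intro continuous_on_chart[of c "u \<circ> chart_inv c"] smooth_on_continuous_on)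
      (auto simp: smooth_functions_def)
  then have "continuous_on (fst c) u"
    by (rule continuous_on_eq) (simp add: chart_inv_snd c)
  then show "\<exists>U. p \<in> U \<and> openin (top_of_set M) U \<and> continuous_on U u"
    using c chart_openin by blast
qed

lemma continuous_integrable:
  fixes h :: "'a \<Rightarrow> 'b::{banach, second_countable_topology}"
  assumes "continuous_on M h"
  shows "integrable (vol M \<A> g) h"
proof -
  obtain B where B: "\<And>x. x \<in> M \<Longrightarrow> norm (h x) \<le> B"
    using compact_imp_bounded[OF compact_continuous_image[OF assms compact]] by (auto simp: bounded_iff)
  have "h \<in> borel_measurable (vol M \<A> g)"
    using borel_measurable_continuous_on_restrict[OF assms] measurable_cong_sets[OF sets_vol refl] by blast
  then show ?thesis
    using B by (intro finite_measure.integrable_const_bound[OF finite_measure_vol, of _ B] AE_I2) auto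
qed

lemma smooth_functions_square_integrable:
  assumes "u \<in> smooth_functions \<A>"
  shows "square_integrable (vol M \<A> g) u"
  unfolding square_integrable_def
  using smooth_functions_continuous[OF assms] continuous_integrable[of u]
  by (auto intro!: continuous_integrable continuous_intros)

section \<open>Sesquilinearity and positivity of the energy form\<close>

lemma gradient_product_add:
  assumes "u \<in> smooth_functions \<A>" "v \<in> smooth_functions \<A>" "w \<in> smooth_functions \<A>" "p \<in> M"
  shows "gradient_product \<A> g (\<lambda>x. u x + v x) w p = gradient_product \<A> g u w p + gradient_product \<A> g v w p"
proof -
  obtain c where c: "c \<in> \<A>" "p \<in> fst c"
    using assms(4) charts_cover by blast
  have "gradient g c (\<lambda>x. u x + v x) p = gradient g c u p + gradient g c v p"
    by (simp add: gradient_def vec_eq_iff partial_deriv_add assms c distrib_left sum.distrib)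
  then show ?thesis
    by (simp add: gradient_product_eq[OF _ _ c] smooth_functions_add assms metric_apply_def
        algebra_simps sum.distrib)
qed

lemma gradient_product_scale:
  assumes "u \<in> smooth_functions \<A>" "w \<in> smooth_functions \<A>" "p \<in> M"
  shows "gradient_product \<A> g (\<lambda>x. a * u x) w p = a * gradient_product \<A> g u w p"
proof -
  obtain c where c: "c \<in> \<A>" "p \<in> fst c"
    using assms(3) charts_cover by blast
  have "gradient g c (\<lambda>x. a * u x) p = a *s gradient g c u p"
    by (simp add: gradient_def vec_eq_iff partial_deriv_linear[OF bounded_linear_mult_right] assms c
        sum_distrib_left mult_ac)
  then show ?thesis
    by (simp add: gradient_product_eq[OF _ _ c] smooth_functions_scale assms metric_apply_def
        sum_distrib_left mult_ac)
qed

lemma gradient_cnj: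
  assumes "u \<in> smooth_functions \<A>" "c \<in> \<A>" "p \<in> fst c"
  shows "gradient g c (\<lambda>x. cnj (u x)) p $ i = cnj (gradient g c u p $ i)"
  by (simp add: gradient_def partial_deriv_linear[OF bounded_linear_cnj] assms)

lemma gradient_product_cnj_commute:
  assumes "u \<in> smooth_functions \<A>" "v \<in> smooth_functions \<A>" "p \<in> M"
  shows "gradient_product \<A> g v (\<lambda>x. cnj (u x)) p = cnj (gradient_product \<A> g u (\<lambda>x. cnj (v x)) p)"
proof -
  obtain c where c: "c \<in> \<A>" "p \<in> fst c"
    using assms(3) charts_cover by blast
  have "cnj (gradient_product \<A> g u (\<lambda>x. cnj (v x)) p) =
      (\<Sum>i\<in>UNIV. \<Sum>j\<in>UNIV. complex_of_real (g c p $ j $ i) * gradient g c v p $ j * cnj (gradient g c u p $ i))"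
    by (simp add: gradient_product_eq[OF _ _ c] smooth_functions_cnj assms metric_apply_def gradient_cnj c
        metric_sym[of c p] mult_ac)
  also have "\<dots> = gradient_product \<A> g v (\<lambda>x. cnj (u x)) p"
    by (subst sum.swap) (simp add: gradient_product_eq[OF _ _ c] smooth_functions_cnj assms metric_apply_def gradient_cnj c)
  finally show ?thesis ..
qed

text \<open>Writing the gradient as a + ib with real a and b, the real part equals g(a,a) +
  g(b,b).\<close>

lemma gradient_product_nonneg:
  assumes "u \<in> smooth_functions \<A>" "p \<in> M"
  shows "0 \<le> Re (gradient_product \<A> g u (\<lambda>x. cnj (u x)) p)"
proof -
  obtain c where c: "c \<in> \<A>" "p \<in> fst c"
    using assms(2) charts_cover by blast
  define a where "a = (\<chi> i. Re (gradient g c u p $ i))"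
  define b where "b = (\<chi> i. Im (gradient g c u p $ i))"
  have "Re (gradient_product \<A> g u (\<lambda>x. cnj (u x)) p) =
      (\<Sum>i\<in>UNIV. \<Sum>j\<in>UNIV. g c p $ i $ j * (a $ i * a $ j + b $ i * b $ j))"
    by (simp add: gradient_product_eq[OF _ _ c] smooth_functions_cnj assms metric_apply_def gradient_cnj c
        a_def b_def algebra_simps)
  also have "\<dots> = a \<bullet> (g c p *v a) + b \<bullet> (g c p *v b)"
    by (simp add: inner_vec_def matrix_vector_mult_def sum_distrib_left sum.distrib algebra_simps)
  also have "\<dots> \<ge> 0"
    by (intro add_nonneg_nonneg metric_nonneg c)
  finally show ?thesis .
qed

lemma gradient_product_integrable:
  "u \<in> smooth_functions \<A> \<Longrightarrow> v \<in> smooth_functions \<A> \<Longrightarrow>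
    integrable (vol M \<A> g) (gradient_product \<A> g u (\<lambda>x. cnj (v x)))"
  by (intro continuous_integrable gradient_product_continuous smooth_functions_cnj)

lemma complex_semi_inner_energy: "complex_semi_inner (mean_zero_smooth M \<A> g) (energy_product M \<A> g)"
proof
  let ?E = "energy_product M \<A> g"
  have smooth: "u \<in> smooth_functions \<A>" if "u \<in> mean_zero_smooth M \<A> g" for u
    using that by (simp add: mean_zero_smooth_def)
  show "(\<lambda>x. 0) \<in> mean_zero_smooth M \<A> g"
    by (simp add: mean_zero_smooth_def smooth_functions_zero)
  fix u v w and a :: complex
  assume u: "u \<in> mean_zero_smooth M \<A> g"
  show "(\<lambda>x. a * u x) \<in> mean_zero_smooth M \<A> g"
    using u by (simp add: mean_zero_smooth_def smooth_functions_scale)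
  show "0 \<le> Re (?E u u)"
  proof -
    have "Re (?E u u) = (LINT p|vol M \<A> g. Re (gradient_product \<A> g u (\<lambda>x. cnj (u x)) p))"
      unfolding energy_product_def by (rule integral_Re[symmetric, OF gradient_product_integrable]) (intro smooth u)+
    also have "\<dots> \<ge> 0"
      using smooth[OF u] by (intro integral_nonneg_AE AE_I2) (simp add: gradient_product_nonneg)
    finally show ?thesis .
  qed
  show "?E (\<lambda>x. a * u x) w = a * ?E u w" if w: "w \<in> mean_zero_smooth M \<A> g"
  proof -
    have "?E (\<lambda>x. a * u x) w = (LINT p|vol M \<A> g. a * gradient_product \<A> g u (\<lambda>x. cnj (w x)) p)"
      unfolding energy_product_def using smooth[OF u] smooth[OF w]
      by (intro Bochner_Integration.integral_cong refl gradient_product_scale smooth_functions_cnj) auto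
    then show ?thesis
      by (simp add: energy_product_def)
  qed
  assume v: "v \<in> mean_zero_smooth M \<A> g"
  show "(\<lambda>x. u x + v x) \<in> mean_zero_smooth M \<A> g"
    using u v smooth_functions_continuous[THEN continuous_integrable]
    by (simp add: mean_zero_smooth_def smooth_functions_add)
  show "?E (\<lambda>x. u x + v x) w = ?E u w + ?E v w" if w: "w \<in> mean_zero_smooth M \<A> g"
  proof -
    have "?E (\<lambda>x. u x + v x) w = (LINT p|vol M \<A> g. gradient_product \<A> g u (\<lambda>x. cnj (w x)) p +
        gradient_product \<A> g v (\<lambda>x. cnj (w x)) p)"
      unfolding energy_product_def using smooth[OF u] smooth[OF v] smooth[OF w]
      by (intro Bochner_Integration.integral_cong refl gradient_product_add smooth_functions_cnj) auto
    also have "\<dots> = ?E u w + ?E v w"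
      unfolding energy_product_def
      by (intro Bochner_Integration.integral_add gradient_product_integrable smooth u v w)
    finally show ?thesis .
  qed
  show "?E v u = cnj (?E u v)"
  proof -
    have "?E v u = (LINT p|vol M \<A> g. cnj (gradient_product \<A> g u (\<lambda>x. cnj (v x)) p))"
      unfolding energy_product_def using smooth[OF u] smooth[OF v]
      by (intro Bochner_Integration.integral_cong refl gradient_product_cnj_commute) auto
    also have "\<dots> = cnj (?E u v)"
      unfolding energy_product_def by (rule Bochner_Integration.integral_cnj)
    finally show ?thesis .
  qed
qed

end

section \<open>The completion and weak solutions\<close>

lemma tendsto_zero_squeeze:
  fixes f h :: "nat \<Rightarrow> real"
  assumes "\<And>n. 0 \<le> f n" "\<And>n. f n \<le> h n" "h \<longlonglongrightarrow> 0"
  shows "f \<longlonglongrightarrow> 0"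
  by (rule tendsto_sandwich[OF _ _ tendsto_const assms(3)]) (simp_all add: assms(1,2))

lemma square_integrable_mono:
  assumes "f \<in> borel_measurable \<mu>" "square_integrable \<mu> h" "\<And>x. cmod (f x) \<le> cmod (h x)"
  shows "square_integrable \<mu> f" and "L2_norm \<mu> f \<le> L2_norm \<mu> h"
proof -
  have le: "(\<integral>\<^sup>+x. ennreal ((cmod (f x))\<^sup>2) \<partial>\<mu>) \<le> ennreal ((L2_norm \<mu> h)\<^sup>2)"
    unfolding nn_integral_L2_norm[OF assms(2), symmetric]
    using assms(3) by (intro nn_integral_mono ennreal_leI power_mono) auto
  note * = square_integrableI_nn_integral[OF assms(1) le L2.nrm_nonneg[OF assms(2)]]
  show "square_integrable \<mu> f" "L2_norm \<mu> f \<le> L2_norm \<mu> h"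
    by (fact *)+
qed

text \<open>A Lipschitz function has linear growth, |F(w)| \<le> |F(0)| + K |w|, and the constant is
  square integrable because the measure is finite.\<close>

lemma square_integrable_lipschitz:
  assumes \<mu>: "finite_measure \<mu>" and F: "K-lipschitz_on UNIV F" and w: "square_integrable \<mu> w"
  shows "square_integrable \<mu> (\<lambda>x. F (w x))"
proof (rule square_integrable_mono(1))
  have "F \<in> borel_measurable borel"
    using lipschitz_on_continuous_on[OF F] by (rule borel_measurable_continuous_onI)
  with w show "(\<lambda>x. F (w x)) \<in> borel_measurable \<mu>"
    by (auto simp: square_integrable_def)
  have "square_integrable \<mu> (\<lambda>x. of_real (cmod (F 0)))"
    using finite_measure.integrable_const[OF \<mu>] by (simp add: square_integrable_def)
  moreover have "square_integrable \<mu> (\<lambda>x. of_real (cmod (w x)))"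
    using w by (auto simp: square_integrable_def)
  ultimately show "square_integrable \<mu> (\<lambda>x. of_real (cmod (F 0)) + of_real K * of_real (cmod (w x)))"
    by (intro square_integrable_add square_integrable_scale)
  fix x
  have "cmod (F (w x)) \<le> cmod (F 0) + cmod (F (w x) - F 0)"
    by (rule norm_triangle_sub)
  also have "cmod (F (w x) - F 0) \<le> K * cmod (w x)"
    using lipschitz_onD[OF F, of "w x" 0] by (simp add: dist_norm)
  also have "cmod (F 0) + K * cmod (w x) \<le> cmod (of_real (cmod (F 0)) + of_real K * of_real (cmod (w x)))"
    unfolding of_real_add[symmetric] of_real_mult[symmetric] norm_of_real by simp
  finally show "cmod (F (w x)) \<le> cmod (of_real (cmod (F 0)) + of_real K * of_real (cmod (w x)))"
    by simp
qed

lemma L2_norm_lipschitz: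
  assumes \<mu>: "finite_measure \<mu>" and F: "K-lipschitz_on UNIV F"
    and w: "square_integrable \<mu> w" and z: "square_integrable \<mu> z"
  shows "L2_norm \<mu> (\<lambda>x. F (w x) - F (z x)) \<le> K * L2_norm \<mu> (\<lambda>x. w x - z x)"
proof -
  have K: "0 \<le> K"
    using F by (rule lipschitz_on_nonneg)
  have "L2_norm \<mu> (\<lambda>x. F (w x) - F (z x)) \<le> L2_norm \<mu> (\<lambda>x. of_real K * (w x - z x))"
  proof (rule square_integrable_mono(2))
    show "(\<lambda>x. F (w x) - F (z x)) \<in> borel_measurable \<mu>"
      using L2.diff_mem[OF square_integrable_lipschitz[OF \<mu> F w] square_integrable_lipschitz[OF \<mu> F z]]
      by (simp add: square_integrable_def)
    show "square_integrable \<mu> (\<lambda>x. of_real K * (w x - z x))"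
      by (intro square_integrable_scale L2.diff_mem w z)
    show "cmod (F (w x) - F (z x)) \<le> cmod (of_real K * (w x - z x))" for x
      using lipschitz_onD[OF F, of "w x" "z x"] K by (simp add: dist_norm norm_mult)
  qed
  also have "\<dots> = K * L2_norm \<mu> (\<lambda>x. w x - z x)"
    using K by (subst L2.nrm_scale[OF L2.diff_mem[OF w z]]) simp
  finally show ?thesis .
qed

text \<open>Banach's iteration for a seminorm: limits are determined only up to null functions, so
  the result is a vanishing distance between \<open>T w\<close> and \<open>w\<close> instead of an
  equality.\<close>

lemma L2_contraction_fixed_point:
  assumes T: "\<And>w. square_integrable \<mu> w \<Longrightarrow> square_integrable \<mu> (T w)"
    and contr: "\<And>w z. square_integrable \<mu> w \<Longrightarrow> square_integrable \<mu> z \<Longrightarrow>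
      L2_norm \<mu> (\<lambda>x. T w x - T z x) \<le> q * L2_norm \<mu> (\<lambda>x. w x - z x)"
    and q: "0 \<le> q" "q < 1"
  shows "\<exists>w. square_integrable \<mu> w \<and> L2_norm \<mu> (\<lambda>x. T w x - w x) = 0"
proof -
  define w where "w n = (T ^^ n) (\<lambda>x. 0)" for n
  have w_Suc: "w (Suc n) = T (w n)" for n
    by (simp add: w_def)
  have w: "square_integrable \<mu> (w n)" for n
    by (induction n) (simp_all add: w_Suc T, simp add: w_def L2.zero_mem)
  define d where "d m n = L2_norm \<mu> (\<lambda>x. w m x - w n x)" for m n
  have d_nonneg: "0 \<le> d m n" for m n
    unfolding d_def by (intro L2.nrm_nonneg L2.diff_mem w)
  have d_commute: "d m n = d n m" for m n
    unfolding d_def by (rule L2.nrm_minus_commute[OF w w])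
  \<comment> \<open>The solution of D = q D + d 1 0, that is, the sum of the geometric series; it
    bounds the distance of every iterate from the start.\<close>
  define D where "D = d 1 0 / (1 - q)"
  have D: "0 \<le> D" "d 1 0 = (1 - q) * D"
    using d_nonneg[of 1 0] q by (simp_all add: D_def)
  have bound: "d n 0 \<le> D" for n
  proof (induction n)
    case 0
    then show ?case
      using D L2.nrm_scale[OF L2.zero_mem, of \<mu> 0] by (simp add: d_def)
  next
    case (Suc n)
    have "d (Suc n) 0 \<le> d (Suc n) 1 + d 1 0"
      unfolding d_def by (rule L2.nrm_diff_triangle[OF w w w])
    also have "d (Suc n) 1 \<le> q * d n 0"
      using contr[OF w[of n] w[of 0]] w_Suc[of n] w_Suc[of 0] by (simp add: d_def)
    also have "q * d n 0 \<le> q * D"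
      using Suc q by (intro mult_left_mono)
    also have "q * D + d 1 0 = D"
      unfolding D(2) by (simp add: algebra_simps)
    finally show ?case
      by simp
  qed
  \<comment> \<open>Contracting the uniform bound \<open>d k 0 \<le> D\<close> n times makes the
    estimate independent of the gap \<open>k\<close>, as the Cauchy property requires.\<close>
  have shift: "d (n + k) n \<le> q ^ n * D" for n k
  proof (induction n)
    case (Suc n)
    have "d (Suc n + k) (Suc n) \<le> q * d (n + k) n"
      using contr[OF w[of "n + k"] w[of n]] by (simp add: d_def w_Suc)
    also have "\<dots> \<le> q * (q ^ n * D)"
      using Suc q by (intro mult_left_mono)
    finally show ?case
      by (simp add: mult.assoc)
  qed (use bound in simp)
  have cauchy: "\<exists>N. \<forall>m\<ge>N. \<forall>n\<ge>N. L2_norm \<mu> (\<lambda>x. w m x - w n x) < e" if "0 < e" for e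
  proof -
    have "(\<lambda>n. q ^ n * D) \<longlonglongrightarrow> 0"
      using q by (auto intro: tendsto_mult_left_zero LIMSEQ_realpow_zero)
    then have "eventually (\<lambda>n. q ^ n * D < e) sequentially"
      by (rule order_tendstoD) (rule that)
    then obtain N where N: "\<And>n. n \<ge> N \<Longrightarrow> q ^ n * D < e"
      by (auto simp: eventually_sequentially)
    have "d m n < e" if "m \<ge> N" "n \<ge> N" for m n
    proof (cases "n \<le> m")
      case True
      then show ?thesis
        using shift[of n "m - n"] N[OF that(2)] by simp
    next
      case False
      then show ?thesis
        using shift[of m "n - m"] N[OF that(1)] d_commute[of m n] by simp
    qed
    then show ?thesis
      unfolding d_def by blast
  qed
  from L2_complete[OF w cauchy]
  obtain z where z: "square_integrable \<mu> z" and lim: "(\<lambda>n. L2_norm \<mu> (\<lambda>x. w n x - z x)) \<longlonglongrightarrow> 0"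
    by blast
  have "L2_norm \<mu> (\<lambda>x. T z x - z x) \<le> q * L2_norm \<mu> (\<lambda>x. w n x - z x) + L2_norm \<mu> (\<lambda>x. w (Suc n) x - z x)" for n
    using L2.nrm_diff_triangle[OF T[OF z] w[of "Suc n"] z] contr[OF z w[of n]] L2.nrm_minus_commute[OF z w[of n]]
    by (simp add: w_Suc)
  moreover have "(\<lambda>n. q * L2_norm \<mu> (\<lambda>x. w n x - z x) + L2_norm \<mu> (\<lambda>x. w (Suc n) x - z x)) \<longlonglongrightarrow> q * 0 + 0"
    by (intro tendsto_intros lim LIMSEQ_Suc[OF lim])
  ultimately have "L2_norm \<mu> (\<lambda>x. T z x - z x) \<le> 0"
    by (intro LIMSEQ_le_const) auto
  with L2.nrm_nonneg[OF L2.diff_mem[OF T[OF z] z]] z show ?thesis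
    by (auto intro!: exI[of _ z])
qed

context compact_riemannian
begin

section \<open>Representatives in the completion\<close>

abbreviation "V \<equiv> mean_zero_smooth M \<A> g"
abbreviation "\<mu> \<equiv> vol M \<A> g"
abbreviation "E \<equiv> energy_product M \<A> g"

interpretation energy: complex_semi_inner V E
  by (rule complex_semi_inner_energy)

lemma V_square_integrable: "u \<in> V \<Longrightarrow> square_integrable \<mu> u"
  by (simp add: mean_zero_smooth_def smooth_functions_square_integrable)

text \<open>As the root of a sum of squares, the distance is equivalent to the sum of the two
  seminorms; convergence can then be checked in each separately.\<close>

lemma H1_dist_bounds:
  assumes "u \<in> V" "v \<in> V"
  shows "L2_norm \<mu> (\<lambda>x. u x - v x) \<le> H1_dist M \<A> g u v" "energy.nrm (\<lambda>x. u x - v x) \<le> H1_dist M \<A> g u v"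
    "H1_dist M \<A> g u v \<le> L2_norm \<mu> (\<lambda>x. u x - v x) + energy.nrm (\<lambda>x. u x - v x)"
proof -
  define w where "w = (\<lambda>x. u x - v x)"
  have w: "w \<in> V"
    unfolding w_def by (intro energy.diff_mem assms)
  have nn: "0 \<le> Re (L2_product \<mu> w w)" "0 \<le> Re (E w w)"
    by (simp_all add: L2_product_self energy.nonneg[OF w])
  have d: "H1_dist M \<A> g u v = sqrt (Re (L2_product \<mu> w w) + Re (E w w))"
    by (simp add: H1_dist_def w_def Let_def)
  show "L2_norm \<mu> (\<lambda>x. u x - v x) \<le> H1_dist M \<A> g u v" "energy.nrm (\<lambda>x. u x - v x) \<le> H1_dist M \<A> g u v"
    "H1_dist M \<A> g u v \<le> L2_norm \<mu> (\<lambda>x. u x - v x) + energy.nrm (\<lambda>x. u x - v x)"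
    using nn unfolding w_def[symmetric] d L2_norm_def energy.nrm_def
    by (auto intro: sqrt_add_le_add_sqrt)
qed

lemma cauchy_seqs_H1_iff:
  "s \<in> cauchy_seqs V (H1_dist M \<A> g) \<longleftrightarrow> (\<forall>n. s n \<in> V) \<and>
    (\<forall>e>0. \<exists>N. \<forall>m\<ge>N. \<forall>n\<ge>N. H1_dist M \<A> g (s m) (s n) < e)"
  by (simp add: cauchy_seqs_def)

lemma H1_dist_tendsto_iff:
  assumes "\<And>n. s n \<in> V" "\<And>n. t n \<in> V"
  shows "(\<lambda>n. H1_dist M \<A> g (s n) (t n)) \<longlonglongrightarrow> 0 \<longleftrightarrow>
    (\<lambda>n. L2_norm \<mu> (\<lambda>x. s n x - t n x)) \<longlonglongrightarrow> 0 \<and> (\<lambda>n. energy.nrm (\<lambda>x. s n x - t n x)) \<longlonglongrightarrow> 0"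
    (is "?H \<longleftrightarrow> ?L \<and> ?E")
proof -
  note b = H1_dist_bounds[OF assms]
  have nnL: "0 \<le> L2_norm \<mu> (\<lambda>x. s n x - t n x)" for n
    by (intro L2.nrm_nonneg V_square_integrable energy.diff_mem assms)
  have nnE: "0 \<le> energy.nrm (\<lambda>x. s n x - t n x)" for n
    by (intro energy.nrm_nonneg energy.diff_mem assms)
  have ?L if ?H
    by (rule tendsto_zero_squeeze[OF nnL b(1) that])
  moreover have ?E if ?H
    by (rule tendsto_zero_squeeze[OF nnE b(2) that])
  moreover have ?H if L: ?L and E: ?E
  proof -
    have nnH: "0 \<le> H1_dist M \<A> g (s n) (t n)" for n
      by (rule order_trans[OF nnL b(1)])
    show ?thesis
      by (rule tendsto_zero_squeeze[OF nnH b(3) tendsto_add_zero[OF L E]])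
  qed
  ultimately show ?thesis
    by blast
qed

text \<open>The equivalence class of \<open>s\<close> in the completion. Since the Cauchy condition
  is part of the relation, it is empty when \<open>s\<close> is not Cauchy.\<close>

definition H1_class :: "(nat \<Rightarrow> 'a \<Rightarrow> complex) \<Rightarrow> (nat \<Rightarrow> 'a \<Rightarrow> complex) set" where
  "H1_class s = {t. s \<in> cauchy_seqs V (H1_dist M \<A> g) \<and> t \<in> cauchy_seqs V (H1_dist M \<A> g) \<and>
     (\<lambda>n. H1_dist M \<A> g (s n) (t n)) \<longlonglongrightarrow> 0}"

lemma H1_perp_eq: "H1_perp M \<A> g = H1_class ` cauchy_seqs V (H1_dist M \<A> g)"
  unfolding H1_perp_def cauchy_completion_def quotient_def H1_class_def by auto

lemma H1_class_self:
  assumes "s \<in> cauchy_seqs V (H1_dist M \<A> g)"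
  shows "s \<in> H1_class s"
proof -
  have "H1_dist M \<A> g (s n) (s n) = 0" for n
    using energy.scale_left[OF energy.zero_mem energy.zero_mem, of 0]
    by (simp add: H1_dist_def L2_product_def)
  with assms show ?thesis
    by (simp add: H1_class_def)
qed

text \<open>Two members of a class are compared through the sequence generating it. This makes
  limits along a representative picked by \<open>SOME\<close> independent of the pick.\<close>

lemma H1_perp_members:
  assumes u: "u \<in> H1_perp M \<A> g" and s: "s \<in> u" and t: "t \<in> u"
  shows "s \<in> cauchy_seqs V (H1_dist M \<A> g)" "s n \<in> V"
    "(\<lambda>n. L2_norm \<mu> (\<lambda>x. s n x - t n x)) \<longlonglongrightarrow> 0" "(\<lambda>n. energy.nrm (\<lambda>x. s n x - t n x)) \<longlonglongrightarrow> 0"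
proof -
  obtain r where r: "r \<in> cauchy_seqs V (H1_dist M \<A> g)" "u = H1_class r"
    using u unfolding H1_perp_eq by blast
  have mem: "s n \<in> V" "t n \<in> V" "r n \<in> V" for n
    using r s t by (auto simp: H1_class_def cauchy_seqs_def)
  show "s \<in> cauchy_seqs V (H1_dist M \<A> g)" "s n \<in> V"
    using r s mem by (auto simp: H1_class_def)
  have "(\<lambda>n. H1_dist M \<A> g (r n) (s n)) \<longlonglongrightarrow> 0" "(\<lambda>n. H1_dist M \<A> g (r n) (t n)) \<longlonglongrightarrow> 0"
    using r s t by (auto simp: H1_class_def)
  then have lim: "(\<lambda>n. L2_norm \<mu> (\<lambda>x. r n x - s n x)) \<longlonglongrightarrow> 0" "(\<lambda>n. energy.nrm (\<lambda>x. r n x - s n x)) \<longlonglongrightarrow> 0"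
    "(\<lambda>n. L2_norm \<mu> (\<lambda>x. r n x - t n x)) \<longlonglongrightarrow> 0" "(\<lambda>n. energy.nrm (\<lambda>x. r n x - t n x)) \<longlonglongrightarrow> 0"
    using H1_dist_tendsto_iff mem by auto
  note sq = V_square_integrable
  have le: "L2_norm \<mu> (\<lambda>x. s n x - t n x) \<le> L2_norm \<mu> (\<lambda>x. r n x - s n x) + L2_norm \<mu> (\<lambda>x. r n x - t n x)" for n
    using L2.nrm_diff_triangle[OF sq sq sq, OF mem(1)[of n] mem(3)[of n] mem(2)[of n]]
      L2.nrm_minus_commute[OF sq sq, OF mem(1)[of n] mem(3)[of n]] by simp
  have nn: "0 \<le> L2_norm \<mu> (\<lambda>x. s n x - t n x)" for n
    by (intro L2.nrm_nonneg V_square_integrable energy.diff_mem mem)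
  have lim0: "(\<lambda>n. L2_norm \<mu> (\<lambda>x. r n x - s n x) + L2_norm \<mu> (\<lambda>x. r n x - t n x)) \<longlonglongrightarrow> 0"
    using tendsto_add[OF lim(1,3)] by simp
  show "(\<lambda>n. L2_norm \<mu> (\<lambda>x. s n x - t n x)) \<longlonglongrightarrow> 0"
    by (rule tendsto_zero_squeeze[OF nn le lim0])
  have le: "energy.nrm (\<lambda>x. s n x - t n x) \<le> energy.nrm (\<lambda>x. r n x - s n x) + energy.nrm (\<lambda>x. r n x - t n x)" for n
    using energy.nrm_diff_triangle[OF mem(1)[of n] mem(3)[of n] mem(2)[of n]]
      energy.nrm_minus_commute[OF mem(1)[of n] mem(3)[of n]] by simp
  have nn: "0 \<le> energy.nrm (\<lambda>x. s n x - t n x)" for n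
    by (intro energy.nrm_nonneg energy.diff_mem mem)
  have lim0: "(\<lambda>n. energy.nrm (\<lambda>x. r n x - s n x) + energy.nrm (\<lambda>x. r n x - t n x)) \<longlonglongrightarrow> 0"
    using tendsto_add[OF lim(2,4)] by simp
  show "(\<lambda>n. energy.nrm (\<lambda>x. s n x - t n x)) \<longlonglongrightarrow> 0"
    by (rule tendsto_zero_squeeze[OF nn le lim0])
qed

lemma H1_rep_mem:
  assumes "u \<in> H1_perp M \<A> g"
  shows "(SOME s. s \<in> u) \<in> u"
proof -
  obtain s where "s \<in> cauchy_seqs V (H1_dist M \<A> g)" "u = H1_class s"
    using assms unfolding H1_perp_eq by blast
  then have "s \<in> u"
    using H1_class_self by simp
  then show ?thesis
    by (rule someI[of "\<lambda>s. s \<in> u"])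
qed

text \<open>The L^2 limit of one representative is a limit for all of them, so the choice in the
  definition of \<open>H1_fun\<close> has a witness.\<close>

lemma H1_fun:
  assumes u: "u \<in> H1_perp M \<A> g"
  shows "square_integrable \<mu> (H1_fun M \<A> g u)"
    and "s \<in> u \<Longrightarrow> (\<lambda>n. L2_norm \<mu> (\<lambda>x. s n x - H1_fun M \<A> g u x)) \<longlonglongrightarrow> 0"
proof -
  define r where "r = (SOME s. s \<in> u)"
  have r: "r \<in> u"
    unfolding r_def by (rule H1_rep_mem[OF u])
  note rV = H1_perp_members(2)[OF u r r] and sq = V_square_integrable
  have cauchy: "\<exists>N. \<forall>m\<ge>N. \<forall>n\<ge>N. L2_norm \<mu> (\<lambda>x. r m x - r n x) < e" if "0 < e" for e
    using H1_perp_members(1)[OF u r r] that H1_dist_bounds(1)[OF rV rV]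
    unfolding cauchy_seqs_H1_iff by (meson le_less_trans)
  from L2_complete[OF sq[OF rV] cauchy]
  obtain w where w: "square_integrable \<mu> w" and lim: "(\<lambda>n. L2_norm \<mu> (\<lambda>x. r n x - w x)) \<longlonglongrightarrow> 0"
    by blast
  have "(\<lambda>n. L2_norm \<mu> (\<lambda>x. s n x - w x)) \<longlonglongrightarrow> 0" if s: "s \<in> u" for s
  proof -
    note sV = H1_perp_members(2)[OF u s s]
    have lim0: "(\<lambda>n. L2_norm \<mu> (\<lambda>x. s n x - r n x) + L2_norm \<mu> (\<lambda>x. r n x - w x)) \<longlonglongrightarrow> 0"
      using tendsto_add[OF H1_perp_members(3)[OF u s r] lim] by simp
    have le: "L2_norm \<mu> (\<lambda>x. s n x - w x) \<le> L2_norm \<mu> (\<lambda>x. s n x - r n x) + L2_norm \<mu> (\<lambda>x. r n x - w x)" for n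
      by (rule L2.nrm_diff_triangle[OF sq[OF sV] sq[OF rV] w])
    have nn: "0 \<le> L2_norm \<mu> (\<lambda>x. s n x - w x)" for n
      by (intro L2.nrm_nonneg L2.diff_mem sq sV w)
    show ?thesis
      by (rule tendsto_zero_squeeze[OF nn le lim0])
  qed
  with w have "\<exists>w. square_integrable \<mu> w \<and> (\<forall>s\<in>u. (\<lambda>n. L2_norm \<mu> (\<lambda>x. s n x - w x)) \<longlonglongrightarrow> 0)"
    by blast
  from someI_ex[OF this, folded H1_fun_def]
  show "square_integrable \<mu> (H1_fun M \<A> g u)"
    "s \<in> u \<Longrightarrow> (\<lambda>n. L2_norm \<mu> (\<lambda>x. s n x - H1_fun M \<A> g u x)) \<longlonglongrightarrow> 0"
    by auto
qed

text \<open>The inequality is assumed on the completion; constant sequences bring it down to the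
  smooth functions on which the construction runs.\<close>

lemma Poincare_smooth:
  assumes poincare: "\<forall>u\<in>H1_perp M \<A> g. L2_norm \<mu> (H1_fun M \<A> g u) \<le> C * H1_energy_norm M \<A> g u"
    and v: "v \<in> V"
  shows "L2_norm \<mu> v \<le> C * energy.nrm v"
proof -
  define s :: "nat \<Rightarrow> 'a \<Rightarrow> complex" where "s n = v" for n
  have zero: "H1_dist M \<A> g v v = 0"
    using energy.scale_left[OF energy.zero_mem energy.zero_mem, of 0]
    by (simp add: H1_dist_def L2_product_def)
  have s: "s \<in> cauchy_seqs V (H1_dist M \<A> g)"
    using v by (simp add: cauchy_seqs_def s_def zero)
  define u where "u = H1_class s"
  have u: "u \<in> H1_perp M \<A> g" "s \<in> u"
    using s H1_class_self by (auto simp: u_def H1_perp_eq)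
  define w where "w = H1_fun M \<A> g u"
  have w: "square_integrable \<mu> w"
    unfolding w_def by (rule H1_fun(1)[OF u(1)])
  have "(\<lambda>n::nat. L2_norm \<mu> (\<lambda>x. v x - w x)) \<longlonglongrightarrow> 0"
    using H1_fun(2)[OF u] by (simp add: s_def w_def)
  then have "L2_norm \<mu> (\<lambda>x. v x - w x) = 0"
    by (simp add: LIMSEQ_const_iff)
  then have "L2_norm \<mu> v \<le> L2_norm \<mu> w"
    using L2.nrm_le_add_diff[OF V_square_integrable[OF v] w] by simp
  \<comment> \<open>The representative used by \<open>H1_energy\<close> need not be the constant
    sequence, but its seminorms converge to that of \<open>v\<close>.\<close>
  moreover have "H1_energy_norm M \<A> g u = energy.nrm v"
  proof -
    define t where "t = (SOME t. t \<in> u)"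
    have t: "t \<in> u"
      unfolding t_def by (rule H1_rep_mem[OF u(1)])
    note tV = H1_perp_members(2)[OF u(1) t t]
    have lim: "(\<lambda>n. energy.nrm (\<lambda>x. t n x - v x)) \<longlonglongrightarrow> 0"
      using H1_perp_members(4)[OF u(1) t u(2)] by (simp add: s_def)
    have "\<bar>energy.nrm (t n) - energy.nrm v\<bar> \<le> energy.nrm (\<lambda>x. t n x - v x)" for n
      using energy.nrm_le_add_diff[OF tV[of n] v] energy.nrm_le_add_diff[OF v tV[of n]]
        energy.nrm_minus_commute[OF v tV[of n]] by linarith
    then have "(\<lambda>n. \<bar>energy.nrm (t n) - energy.nrm v\<bar>) \<longlonglongrightarrow> 0"
      by (rule tendsto_zero_squeeze[OF abs_ge_zero _ lim])
    then have "(\<lambda>n. energy.nrm (t n)) \<longlonglongrightarrow> energy.nrm v"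
      by (rule LIM_zero_cancel[OF tendsto_rabs_zero_cancel])
    then have "(\<lambda>n. E (t n) (t n)) \<longlonglongrightarrow> of_real ((energy.nrm v)\<^sup>2)"
      unfolding energy.self_eq[OF tV] by (intro tendsto_intros)
    then have "H1_energy M \<A> g u u = of_real ((energy.nrm v)\<^sup>2)"
      unfolding H1_energy_def t_def[symmetric] by (rule limI)
    then show ?thesis
      using energy.nrm_nonneg[OF v] by (simp add: H1_energy_norm_def)
  qed
  ultimately show ?thesis
    using bspec[OF poincare u(1)] by (simp add: w_def)
qed

text \<open>Such a sequence is Cauchy; its class is the Riesz representative of \<open>v \<mapsto> \<langle>v, h\<rangle>\<close> in the completion.
  The rate \<open>1 / (n + 1)\<close> is uniform in \<open>v\<close>, so that \<open>v\<close> may vary with \<open>n\<close> in the limit.\<close>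

definition weak_solution_seq :: "('a \<Rightarrow> complex) \<Rightarrow> (nat \<Rightarrow> 'a \<Rightarrow> complex) \<Rightarrow> bool" where
  "weak_solution_seq h s \<longleftrightarrow> (\<forall>n. s n \<in> V) \<and>
     (\<forall>n. \<forall>v\<in>V. cmod (E v (s n) - L2_product \<mu> v h) \<le> 1 / real (Suc n) * energy.nrm v)"

lemma ex_weak_solution_seq:
  assumes poincare: "\<And>v. v \<in> V \<Longrightarrow> L2_norm \<mu> v \<le> C * energy.nrm v"
    and h: "square_integrable \<mu> h"
  shows "\<exists>s. weak_solution_seq h s"
proof -
  have "\<exists>u\<in>V. \<forall>v\<in>V. cmod (E v u - L2_product \<mu> v h) \<le> 1 / real (Suc n) * energy.nrm v" for n
  proof (rule energy.Riesz_approximation)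
    fix u assume u: "u \<in> V"
    have "cmod (L2_product \<mu> u h) \<le> L2_norm \<mu> u * L2_norm \<mu> h"
      by (rule L2.Cauchy_Schwarz[OF V_square_integrable[OF u] h])
    also have "\<dots> \<le> C * energy.nrm u * L2_norm \<mu> h"
      by (intro mult_right_mono poincare u L2.nrm_nonneg h)
    finally show "cmod (L2_product \<mu> u h) \<le> (C * L2_norm \<mu> h) * energy.nrm u"
      by (simp add: mult_ac)
  qed (use h V_square_integrable in \<open>auto intro: L2.add_left L2.scale_left\<close>)
  then show ?thesis
    unfolding weak_solution_seq_def by metis
qed

text \<open>Test both approximate equations with the difference itself: every term of the bound
  carries a factor \<open>energy.nrm d\<close>, which cancels. For \<open>h = k\<close> this is the
  Cauchy property, otherwise Lipschitz dependence on the data.\<close>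

lemma weak_solution_seq_diff:
  assumes C: "0 \<le> C" and poincare: "\<And>v. v \<in> V \<Longrightarrow> L2_norm \<mu> v \<le> C * energy.nrm v"
    and h: "square_integrable \<mu> h" "square_integrable \<mu> k"
    and s: "weak_solution_seq h s" and t: "weak_solution_seq k t"
  shows "energy.nrm (\<lambda>x. s m x - t n x) \<le> C * L2_norm \<mu> (\<lambda>x. h x - k x) + 1 / real (Suc m) + 1 / real (Suc n)"
proof -
  have mem: "s m \<in> V" "t n \<in> V"
    using s t by (auto simp: weak_solution_seq_def)
  define d where "d = (\<lambda>x. s m x - t n x)"
  have d: "d \<in> V"
    unfolding d_def by (intro energy.diff_mem mem)
  let ?e = "energy.nrm d"
  let ?R = "C * L2_norm \<mu> (\<lambda>x. h x - k x) + 1 / real (Suc m) + 1 / real (Suc n)"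
  have "0 \<le> energy.nrm d"
    by (rule energy.nrm_nonneg[OF d])
  have "?e\<^sup>2 = cmod (E d d)"
    by (simp only: energy.self_eq[OF d] norm_of_real abs_power2)
  also have "E d d = (E d (s m) - L2_product \<mu> d h) - (E d (t n) - L2_product \<mu> d k) + L2_product \<mu> d (\<lambda>x. h x - k x)"
    using energy.diff_right[OF mem d] L2.diff_right[OF h V_square_integrable[OF d]] by (simp add: d_def)
  also have "cmod \<dots> \<le> cmod (E d (s m) - L2_product \<mu> d h) + cmod (E d (t n) - L2_product \<mu> d k) + cmod (L2_product \<mu> d (\<lambda>x. h x - k x))"
    by (rule order_trans[OF norm_triangle_ineq add_right_mono[OF norm_triangle_ineq4]])
  also have "\<dots> \<le> 1 / real (Suc m) * ?e + 1 / real (Suc n) * ?e + C * ?e * L2_norm \<mu> (\<lambda>x. h x - k x)"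
  proof (intro add_mono)
    show "cmod (E d (s m) - L2_product \<mu> d h) \<le> 1 / real (Suc m) * ?e"
      using s d unfolding weak_solution_seq_def by blast
    show "cmod (E d (t n) - L2_product \<mu> d k) \<le> 1 / real (Suc n) * ?e"
      using t d unfolding weak_solution_seq_def by blast
    have "cmod (L2_product \<mu> d (\<lambda>x. h x - k x)) \<le> L2_norm \<mu> d * L2_norm \<mu> (\<lambda>x. h x - k x)"
      by (rule L2.Cauchy_Schwarz[OF V_square_integrable[OF d] L2.diff_mem[OF h]])
    also have "\<dots> \<le> C * ?e * L2_norm \<mu> (\<lambda>x. h x - k x)"
      by (intro mult_right_mono poincare d L2.nrm_nonneg L2.diff_mem h)
    finally show "cmod (L2_product \<mu> d (\<lambda>x. h x - k x)) \<le> C * ?e * L2_norm \<mu> (\<lambda>x. h x - k x)" .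
  qed
  finally have "?e * ?e \<le> ?e * ?R"
    by (simp add: power2_eq_square algebra_simps)
  have "0 \<le> ?R"
    using C by (intro add_nonneg_nonneg mult_nonneg_nonneg L2.nrm_nonneg L2.diff_mem h) auto
  with \<open>0 \<le> ?e\<close> \<open>?e * ?e \<le> ?e * ?R\<close> have "?e \<le> ?R"
    by (cases "?e = 0") auto
  then show ?thesis
    by (simp add: d_def)
qed

lemma weak_solution_seq_cauchy:
  assumes C: "0 \<le> C" and poincare: "\<And>v. v \<in> V \<Longrightarrow> L2_norm \<mu> v \<le> C * energy.nrm v"
    and h: "square_integrable \<mu> h" and s: "weak_solution_seq h s"
  shows "s \<in> cauchy_seqs V (H1_dist M \<A> g)"
  unfolding cauchy_seqs_H1_iff
proof (intro conjI allI impI)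
  show sV: "s n \<in> V" for n
    using s by (simp add: weak_solution_seq_def)
  fix e :: real assume e: "0 < e"
  \<comment> \<open>Two tolerances below half of e / (C + 1) keep the energy of the difference below
    e / (C + 1); the Poincare inequality bounds the full distance by C + 1 times that
    energy.\<close>
  obtain N where N: "1 / real (Suc N) < e / (C + 1) / 2"
    using reals_Archimedean[of "e / (C + 1) / 2"] e C by (auto simp: inverse_eq_divide)
  have "H1_dist M \<A> g (s m) (s n) < e" if mn: "m \<ge> N" "n \<ge> N" for m n
  proof -
    let ?d = "energy.nrm (\<lambda>x. s m x - s n x)"
    have "?d \<le> 1 / real (Suc m) + 1 / real (Suc n)"
      using weak_solution_seq_diff[OF C poincare h h s s, of m n] L2.nrm_scale[OF L2.zero_mem, of \<mu> 0] by simp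
    also have "\<dots> \<le> 1 / real (Suc N) + 1 / real (Suc N)"
      using mn by (intro add_mono divide_left_mono) auto
    also have "\<dots> < 2 * (e / (C + 1) / 2)"
      using N by linarith
    also have "\<dots> = e / (C + 1)"
      by (rule field_sum_of_halves[of "e / (C + 1)", folded mult_2])
    finally have "(C + 1) * ?d < e"
      using C by (simp add: pos_less_divide_eq mult.commute)
    moreover have "H1_dist M \<A> g (s m) (s n) \<le> C * ?d + ?d"
      using H1_dist_bounds(3)[OF sV sV, of m n] poincare[OF energy.diff_mem[OF sV sV], of m n] by linarith
    ultimately show ?thesis
      by (simp add: algebra_simps)
  qed
  then show "\<exists>N. \<forall>m\<ge>N. \<forall>n\<ge>N. H1_dist M \<A> g (s m) (s n) < e"
    by blast
qed

text \<open>The energy estimate contributes one factor \<open>C\<close> and the Poincare inequality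
  the second. With \<open>h = k\<close> it also shows that L^2 limits for the same data agree up to
  null functions.\<close>

lemma weak_solution_seq_L2_diff:
  assumes C: "0 \<le> C" and poincare: "\<And>v. v \<in> V \<Longrightarrow> L2_norm \<mu> v \<le> C * energy.nrm v"
    and h: "square_integrable \<mu> h" "square_integrable \<mu> k"
    and s: "weak_solution_seq h s" and t: "weak_solution_seq k t"
    and w: "square_integrable \<mu> w" "(\<lambda>n. L2_norm \<mu> (\<lambda>x. s n x - w x)) \<longlonglongrightarrow> 0"
    and z: "square_integrable \<mu> z" "(\<lambda>n. L2_norm \<mu> (\<lambda>x. t n x - z x)) \<longlonglongrightarrow> 0"
  shows "L2_norm \<mu> (\<lambda>x. w x - z x) \<le> C\<^sup>2 * L2_norm \<mu> (\<lambda>x. h x - k x)"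
proof -
  have V: "s n \<in> V" "t n \<in> V" for n
    using s t by (auto simp: weak_solution_seq_def)
  note sq = V_square_integrable[OF V(1)] V_square_integrable[OF V(2)]
  let ?K = "L2_norm \<mu> (\<lambda>x. h x - k x)"
  let ?r = "\<lambda>n. 1 / real (Suc n)"
  have "L2_norm \<mu> (\<lambda>x. w x - z x) \<le> L2_norm \<mu> (\<lambda>x. s n x - w x) + C * (C * ?K + ?r n + ?r n) +
      L2_norm \<mu> (\<lambda>x. t n x - z x)" for n
  proof -
    have "L2_norm \<mu> (\<lambda>x. s n x - t n x) \<le> C * energy.nrm (\<lambda>x. s n x - t n x)"
      by (intro poincare energy.diff_mem V)
    also have "\<dots> \<le> C * (C * ?K + ?r n + ?r n)"
      by (intro mult_left_mono weak_solution_seq_diff[OF C poincare h s t] C)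
    finally show ?thesis
      using L2.nrm_diff_triangle[OF w(1) sq(1) z(1), of n] L2.nrm_diff_triangle[OF sq(1) sq(2) z(1), of n n]
        L2.nrm_minus_commute[OF w(1) sq(1), of n] by linarith
  qed
  moreover have "?r \<longlonglongrightarrow> 0"
    using LIMSEQ_Suc[OF lim_1_over_n] by simp
  then have "(\<lambda>n. L2_norm \<mu> (\<lambda>x. s n x - w x) + C * (C * ?K + ?r n + ?r n) + L2_norm \<mu> (\<lambda>x. t n x - z x))
      \<longlonglongrightarrow> 0 + C * (C * ?K + 0 + 0) + 0"
    by (intro tendsto_add tendsto_mult tendsto_const w z)
  ultimately have "L2_norm \<mu> (\<lambda>x. w x - z x) \<le> 0 + C * (C * ?K + 0 + 0) + 0"
    by (intro LIMSEQ_le_const) auto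
  then show ?thesis
    by (simp add: power2_eq_square mult.assoc)
qed

text \<open>\<open>H1_energy\<close> runs along arbitrary representatives \<open>r\<close> and
  \<open>t\<close>. Replacing \<open>t\<close> by \<open>s\<close>, then the energy pairing by the
  L^2 pairing with \<open>h\<close>, and finally \<open>r\<close> by its L^2 limit costs the three
  terms of \<open>?B\<close>.\<close>

lemma H1_energy_weak_solution_seq:
  assumes h: "square_integrable \<mu> h" and s: "weak_solution_seq h s" "s \<in> cauchy_seqs V (H1_dist M \<A> g)"
    and v: "v \<in> H1_perp M \<A> g"
  shows "H1_energy M \<A> g v (H1_class s) = L2_product \<mu> (H1_fun M \<A> g v) h"
proof -
  define u where "u = H1_class s"
  have u: "u \<in> H1_perp M \<A> g" "s \<in> u"
    using s(2) H1_class_self by (auto simp: u_def H1_perp_eq)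
  define r where "r = (SOME r. r \<in> v)"
  define t where "t = (SOME t. t \<in> u)"
  have r: "r \<in> v" and t: "t \<in> u"
    unfolding r_def t_def by (intro H1_rep_mem u v)+
  have mem: "r n \<in> V" "t n \<in> V" "s n \<in> V" for n
    using H1_perp_members(2)[OF v r r] H1_perp_members(2)[OF u(1) t t] H1_perp_members(2)[OF u(1) u(2) u(2)] by auto
  note sq = V_square_integrable[OF mem(1)]
  define \<phi> where "\<phi> = H1_fun M \<A> g v"
  have \<phi>: "square_integrable \<mu> \<phi>" "(\<lambda>n. L2_norm \<mu> (\<lambda>x. r n x - \<phi> x)) \<longlonglongrightarrow> 0"
    unfolding \<phi>_def by (rule H1_fun(1)[OF v], rule H1_fun(2)[OF v r])
  \<comment> \<open>Two terms of the error carry the factor \<open>energy.nrm (r n)\<close>, which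
    must stay bounded; it even converges.\<close>
  have "Cauchy (\<lambda>n. energy.nrm (r n))"
  proof (rule metric_CauchyI)
    fix e :: real assume "0 < e"
    then obtain N where N: "\<forall>m\<ge>N. \<forall>n\<ge>N. H1_dist M \<A> g (r m) (r n) < e"
      using H1_perp_members(1)[OF v r r] unfolding cauchy_seqs_H1_iff by blast
    have "dist (energy.nrm (r m)) (energy.nrm (r n)) < e" if "m \<ge> N" "n \<ge> N" for m n
    proof -
      have "energy.nrm (\<lambda>x. r m x - r n x) < e"
        using H1_dist_bounds(2)[OF mem(1) mem(1), of m n] N that by (meson le_less_trans)
      then show ?thesis
        using energy.nrm_le_add_diff[OF mem(1) mem(1), of m n] energy.nrm_le_add_diff[OF mem(1) mem(1), of n m]
          energy.nrm_minus_commute[OF mem(1) mem(1), of m n] by (simp add: dist_real_def)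
    qed
    then show "\<exists>N. \<forall>m\<ge>N. \<forall>n\<ge>N. dist (energy.nrm (r m)) (energy.nrm (r n)) < e"
      by blast
  qed
  then obtain b where b: "(\<lambda>n. energy.nrm (r n)) \<longlonglongrightarrow> b"
    using real_Cauchy_convergent convergentD by blast
  let ?B = "\<lambda>n. energy.nrm (r n) * energy.nrm (\<lambda>x. t n x - s n x) + 1 / real (Suc n) * energy.nrm (r n) +
      L2_norm \<mu> (\<lambda>x. r n x - \<phi> x) * L2_norm \<mu> h"
  have le: "cmod (E (r n) (t n) - L2_product \<mu> \<phi> h) \<le> ?B n" for n
  proof -
    have eq: "E (r n) (t n) - L2_product \<mu> \<phi> h = E (r n) (\<lambda>x. t n x - s n x) + (E (r n) (s n) - L2_product \<mu> (r n) h) +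
        L2_product \<mu> (\<lambda>x. r n x - \<phi> x) h"
      using energy.diff_right[OF mem(2) mem(3) mem(1)] L2.diff_left[OF sq \<phi>(1) h] by simp
    have "cmod (E (r n) (t n) - L2_product \<mu> \<phi> h) \<le> cmod (E (r n) (\<lambda>x. t n x - s n x)) + cmod (E (r n) (s n) - L2_product \<mu> (r n) h) +
        cmod (L2_product \<mu> (\<lambda>x. r n x - \<phi> x) h)"
      unfolding eq by (rule order_trans[OF norm_triangle_ineq add_right_mono[OF norm_triangle_ineq]])
    also have "\<dots> \<le> ?B n"
      using s(1) mem unfolding weak_solution_seq_def
      by (intro add_mono energy.Cauchy_Schwarz L2.Cauchy_Schwarz energy.diff_mem L2.diff_mem sq \<phi> h) auto
    finally show ?thesis .
  qed
  have "?B \<longlonglongrightarrow> b * 0 + 0 * b + 0 * L2_norm \<mu> h"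
  proof (intro tendsto_add tendsto_mult tendsto_const b \<phi>(2))
    show "(\<lambda>n. energy.nrm (\<lambda>x. t n x - s n x)) \<longlonglongrightarrow> 0"
      by (rule H1_perp_members(4)[OF u(1) t u(2)])
    show "(\<lambda>n. 1 / real (Suc n)) \<longlonglongrightarrow> 0"
      by (rule LIMSEQ_Suc[OF lim_1_over_n])
  qed
  then have lim: "?B \<longlonglongrightarrow> 0"
    by (simp only: mult_zero_left mult_zero_right add_0_left)
  have "(\<lambda>n. cmod (E (r n) (t n) - L2_product \<mu> \<phi> h)) \<longlonglongrightarrow> 0"
    by (rule tendsto_zero_squeeze[OF norm_ge_zero le lim])
  then have "(\<lambda>n. E (r n) (t n)) \<longlonglongrightarrow> L2_product \<mu> \<phi> h"
    by (rule LIM_zero_cancel[OF tendsto_norm_zero_cancel])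
  then show ?thesis
    unfolding H1_energy_def u_def[symmetric] r_def[symmetric] t_def[symmetric] \<phi>_def[symmetric] by (rule limI)
qed

lemma ex_weak_neumann_solution:
  assumes f: "square_integrable \<mu> f" and "C > 0"
    and poincare: "\<forall>u\<in>H1_perp M \<A> g. L2_norm \<mu> (H1_fun M \<A> g u) \<le> C * H1_energy_norm M \<A> g u"
    and F: "K-lipschitz_on UNIV F" and small: "K * C\<^sup>2 < 1"
  shows "\<exists>u. weak_neumann_solution M \<A> g F f u"
proof -
  have C: "0 \<le> C"
    using \<open>C > 0\<close> by simp
  have K: "0 \<le> K"
    using F by (rule lipschitz_on_nonneg)
  note smooth = Poincare_smooth[OF poincare]
  note FL = square_integrable_lipschitz[OF finite_measure_vol F]
  define H where "H w = (\<lambda>x. f x - F (w x))" for w :: "'a \<Rightarrow> complex"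
  have H: "square_integrable \<mu> (H w)" if "square_integrable \<mu> w" for w
    unfolding H_def by (intro L2.diff_mem f FL that)
  have H_diff: "L2_norm \<mu> (\<lambda>x. H w x - H z x) \<le> K * L2_norm \<mu> (\<lambda>x. w x - z x)"
    if "square_integrable \<mu> w" "square_integrable \<mu> z" for w z
    using L2_norm_lipschitz[OF finite_measure_vol F that(2,1)] L2.nrm_minus_commute[OF that]
    by (simp add: H_def)
  have ex: "\<exists>s z. weak_solution_seq (H w) s \<and> square_integrable \<mu> z \<and> (\<lambda>n. L2_norm \<mu> (\<lambda>x. s n x - z x)) \<longlonglongrightarrow> 0"
    if w: "square_integrable \<mu> w" for w
  proof -
    obtain s where s: "weak_solution_seq (H w) s"
      using ex_weak_solution_seq[OF smooth H[OF w]] by blast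
    have "s \<in> cauchy_seqs V (H1_dist M \<A> g)"
      by (rule weak_solution_seq_cauchy[OF C smooth H[OF w] s])
    then have "H1_class s \<in> H1_perp M \<A> g" "s \<in> H1_class s"
      using H1_class_self by (auto simp: H1_perp_eq)
    with s H1_fun show ?thesis
      by blast
  qed
  \<comment> \<open>For each \<open>w\<close> an approximate solution sequence and its L^2 limit are
    chosen together, since the solution map \<open>T\<close> is not determined pointwise.\<close>
  have "\<forall>w. \<exists>p. square_integrable \<mu> w \<longrightarrow> weak_solution_seq (H w) (fst p) \<and> square_integrable \<mu> (snd p) \<and>
      (\<lambda>n. L2_norm \<mu> (\<lambda>x. fst p n x - snd p x)) \<longlonglongrightarrow> 0"
    using ex by fastforce
  from choice[OF this] obtain p where p: "\<forall>w. square_integrable \<mu> w \<longrightarrow> weak_solution_seq (H w) (fst (p w)) \<and>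
      square_integrable \<mu> (snd (p w)) \<and> (\<lambda>n. L2_norm \<mu> (\<lambda>x. fst (p w) n x - snd (p w) x)) \<longlonglongrightarrow> 0" ..
  define S T where "S w = fst (p w)" and "T w = snd (p w)" for w
  have S: "weak_solution_seq (H w) (S w)" and T: "square_integrable \<mu> (T w)"
    and ST: "(\<lambda>n. L2_norm \<mu> (\<lambda>x. S w n x - T w x)) \<longlonglongrightarrow> 0" if "square_integrable \<mu> w" for w
    using p that by (simp_all add: S_def T_def)
  have "L2_norm \<mu> (\<lambda>x. T w x - T z x) \<le> (K * C\<^sup>2) * L2_norm \<mu> (\<lambda>x. w x - z x)"
    if w: "square_integrable \<mu> w" and z: "square_integrable \<mu> z" for w z
  proof -
    have "L2_norm \<mu> (\<lambda>x. T w x - T z x) \<le> C\<^sup>2 * L2_norm \<mu> (\<lambda>x. H w x - H z x)"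
      by (rule weak_solution_seq_L2_diff[OF C smooth H[OF w] H[OF z] S[OF w] S[OF z] T[OF w] ST[OF w] T[OF z] ST[OF z]])
    also have "\<dots> \<le> C\<^sup>2 * (K * L2_norm \<mu> (\<lambda>x. w x - z x))"
      by (intro mult_left_mono H_diff w z) simp
    finally show ?thesis
      by (simp add: mult_ac)
  qed
  then obtain w where w: "square_integrable \<mu> w" and fixed: "L2_norm \<mu> (\<lambda>x. T w x - w x) = 0"
    using L2_contraction_fixed_point[of \<mu> T "K * C\<^sup>2"] T K small by auto
  define u where "u = H1_class (S w)"
  have cauchy: "S w \<in> cauchy_seqs V (H1_dist M \<A> g)"
    by (rule weak_solution_seq_cauchy[OF C smooth H[OF w] S[OF w]])
  have u: "u \<in> H1_perp M \<A> g" "S w \<in> u"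
    using cauchy H1_class_self by (auto simp: u_def H1_perp_eq)
  define z where "z = H1_fun M \<A> g u"
  have z: "square_integrable \<mu> z" "(\<lambda>n. L2_norm \<mu> (\<lambda>x. S w n x - z x)) \<longlonglongrightarrow> 0"
    unfolding z_def by (rule H1_fun(1)[OF u(1)], rule H1_fun(2)[OF u])
  \<comment> \<open>\<open>T w\<close> and the function \<open>z\<close> of the class are both L^2
    limits of \<open>S w\<close>, so the stability estimate with equal data makes their distance
    zero.\<close>
  have "L2_norm \<mu> (\<lambda>x. T w x - z x) \<le> C\<^sup>2 * L2_norm \<mu> (\<lambda>x. H w x - H w x)"
    by (rule weak_solution_seq_L2_diff[OF C smooth H[OF w] H[OF w] S[OF w] S[OF w] T[OF w] ST[OF w] z])
  then have "L2_norm \<mu> (\<lambda>x. w x - z x) \<le> 0"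
    using L2.nrm_diff_triangle[OF w T[OF w] z(1)] L2.nrm_minus_commute[OF w T[OF w]] fixed
      L2.nrm_scale[OF L2.zero_mem, of \<mu> 0] by simp
  then have "K * L2_norm \<mu> (\<lambda>x. w x - z x) \<le> 0"
    by (rule mult_nonneg_nonpos[OF K])
  \<comment> \<open>The equation holds with F(w) while the claim is about F(z); the Lipschitz bound
    makes the two right-hand sides indistinguishable in L^2, hence in every pairing by
    Cauchy--Schwarz.\<close>
  then have H_zero: "L2_norm \<mu> (\<lambda>x. H w x - H z x) = 0"
    using H_diff[OF w z(1)] L2.nrm_nonneg[OF L2.diff_mem[OF H[OF w] H[OF z(1)]]] by simp
  have "H1_energy M \<A> g v u + L2_product \<mu> (H1_fun M \<A> g v) (\<lambda>x. F (z x)) = L2_product \<mu> (H1_fun M \<A> g v) f"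
    if v: "v \<in> H1_perp M \<A> g" for v
  proof -
    let ?\<phi> = "H1_fun M \<A> g v"
    have \<phi>: "square_integrable \<mu> ?\<phi>"
      by (rule H1_fun(1)[OF v])
    have "L2_product \<mu> ?\<phi> (H w) - L2_product \<mu> ?\<phi> (H z) = 0"
      using L2.Cauchy_Schwarz[OF \<phi> L2.diff_mem[OF H[OF w] H[OF z(1)]]] H_zero
      by (simp add: L2.diff_right[OF H[OF w] H[OF z(1)] \<phi>])
    moreover have "L2_product \<mu> ?\<phi> (H z) = L2_product \<mu> ?\<phi> f - L2_product \<mu> ?\<phi> (\<lambda>x. F (z x))"
      unfolding H_def by (rule L2.diff_right[OF f FL[OF z(1)] \<phi>])
    moreover have "H1_energy M \<A> g v u = L2_product \<mu> ?\<phi> (H w)"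
      unfolding u_def by (rule H1_energy_weak_solution_seq[OF H[OF w] S[OF w] cauchy v])
    ultimately show ?thesis
      by simp
  qed
  with u(1) show ?thesis
    unfolding weak_neumann_solution_def z_def by blast
qed

end

theorem theorem3p8:
  fixes M :: "'a::t2_space set"
    and \<A> :: "('a, 'n::finite) chart set"
    and g :: "('a, 'n) metric_tensor"
    and f :: "'a \<Rightarrow> complex"
    and F :: "complex \<Rightarrow> complex"
    and C C\<^sub>1 :: real
  assumes "riemannian_manifold M \<A> g" "compact M" "connected M"
    and "square_integrable (vol M \<A> g) f"
    and "C > 0"
    and "\<forall>u\<in>H1_perp M \<A> g.
           L2_norm (vol M \<A> g) (H1_fun M \<A> g u) \<le> C * H1_energy_norm M \<A> g u"
    and "C\<^sub>1-lipschitz_on UNIV F"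
    and "C\<^sub>1 * C\<^sup>2 < 1"
  shows "\<exists>u. weak_neumann_solution M \<A> g F f u"
proof -
  interpret compact_riemannian M \<A> g
    using assms(1,2) by unfold_locales
  show ?thesis
    by (rule ex_weak_neumann_solution[OF assms(4-8)])
qed

end
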